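(* Let $R$ be a spherical random walk on a $2$-dimensional lattice $Z\subset\mathbb{C}\cong\mathbb{R}^2$, with harmonic potential $a$. Then for every integer $K\ge1$ there are real constants $\alpha,\lambda$ and complex coefficients $\alpha_{lk}$, indexed by a finite set of integer pairs $(l,k)$ with $l\ge0$, $k\ge0$, $-K\le l-k\le-1$, such that \[ a(z)=\alpha\log|z|+\lambda+\operatorname{Re}\Big(\sum\alpha_{lk}\frac{z^l}{|z|^k}\Big)+O(|z|^{-K})\qquad(z\in Z,\ |z|\to\infty), \] and moreover $\alpha_{lk}=0$ whenever $l<\tfrac12 k$.
   Context: A random walk on a lattice $Z$: $R_0=0$, $R_n=X_1+\dots+X_n$ with $X_i$ i.i.d. $Z$-valued, every $z\in Z$ reachable with positive probability. It is spherical if it is bounded ($X_1$ bounded), balanced ($\mathbb{E}X_1=0$), and $\mathbb{E}\langle X_1,e_i\rangle\langle X_1,e_j\rangle=C\delta_{ij}$ for some constant $C$ (the $e_i$ standard unit vectors). The harmonic potential is $a(z)=\sum_{n\ge0}(P_n(0)-P_n(z))$ with $P_n(z)=\mathbb{P}(R_n=z)$. *)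

theory Defs
  imports "HOL-Probability.Probability" "HOL-Library.Landau_Symbols"
begin

definition lattice2 :: "complex \<Rightarrow> complex \<Rightarrow> complex set" where
  "lattice2 w1 w2 = {of_int m * w1 + of_int n * w2 | m n :: int. True}"

definition lin_indep2 :: "complex \<Rightarrow> complex \<Rightarrow> bool" where
  "lin_indep2 w1 w2 \<longleftrightarrow> Im (cnj w1 * w2) \<noteq> 0"

primrec walk_dist :: "complex pmf \<Rightarrow> nat \<Rightarrow> complex pmf" where
  "walk_dist p 0 = return_pmf 0"
| "walk_dist p (Suc n) = bind_pmf (walk_dist p n) (\<lambda>x. map_pmf (\<lambda>y. x + y) p)"

definition random_walk_on :: "complex set \<Rightarrow> complex pmf \<Rightarrow> bool" where
  "random_walk_on Z p \<longleftrightarrow> set_pmf p \<subseteq> Z \<and>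
     (\<forall>z\<in>Z. \<exists>n. pmf (walk_dist p n) z > 0)"

definition spherical :: "complex pmf \<Rightarrow> bool" where
  "spherical p \<longleftrightarrow> bounded (set_pmf p) \<and>
     measure_pmf.expectation p (\<lambda>x. x) = 0 \<and>
     (\<exists>C::real.
        measure_pmf.expectation p (\<lambda>x. Re x * Re x) = C \<and>
        measure_pmf.expectation p (\<lambda>x. Im x * Im x) = C \<and>
        measure_pmf.expectation p (\<lambda>x. Re x * Im x) = 0 \<and>
        measure_pmf.expectation p (\<lambda>x. Im x * Re x) = 0)"

definition harmonic_potential :: "complex pmf \<Rightarrow> complex \<Rightarrow> real" where
  "harmonic_potential p z = (\<Sum>n. pmf (walk_dist p n) 0 - pmf (walk_dist p n) z)"

end

theory Submission
  imports Defs "HOL-Real_Asymp.Real_Asymp"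
begin

text \<open>
  Let \<open>lap u z = E u(z - X) - u z\<close>. If \<open>v\<close> satisfies \<open>lap v = \<delta>\<^sub>0\<close> on the lattice and
  \<open>v (z - y) - v z \<longrightarrow> 0\<close>, then \<open>E v(z - R\<^sub>n) = v z + \<Sum>k<n. P\<^sub>k(z)\<close>, and \<open>P\<^sub>n(x) \<longrightarrow> 0\<close> yields
  \<open>a z = v z - v 0\<close>. The same argument is a Liouville theorem. So it suffices to construct such a
  \<open>v\<close> with an explicit expansion.

  By sphericity \<open>lap\<close> maps \<open>cnj z ^ a / z ^ b\<close> to a multiple of \<open>cnj z ^ (a-1) / z ^ (b+1)\<close> plus
  terms that are at least three orders smaller than the original, all of them again of this form.
  Solving order by order, \<open>ln \<bar>z\<bar>\<close> and each \<open>1 / z ^ m\<close> can be corrected to functions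
  \<open>L\<close>, \<open>B m\<close> whose \<open>lap\<close> decays as fast as desired. The corrections only contain
  monomials with \<open>b > a \<ge> 0\<close>, and \<open>cnj z ^ a / z ^ b = cnj z ^ (a+b) / \<bar>z\<bar> ^ (2b)\<close>, which gives the
  restriction on the coefficients.

  On the Fourier side, \<open>lap u = g\<close> has a solution \<open>u = O(\<bar>z\<bar> powr (-(N-1) - 1/3))\<close> when \<open>g\<close> decays fast
  and its moments of degree below \<open>N\<close> vanish. Modulo \<open>lap\<close> of finitely supported functions, only
  the harmonic moments \<open>z ^ m\<close>, \<open>cnj z ^ m\<close> matter, and there are as many of them as there are
  functions \<open>L\<close>, \<open>B m\<close>, \<open>cnj (B m)\<close>. If the moments of these functions were linearly
  dependent, some combination of them would decay faster than its leading term, by the Fourier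
  estimate and the Liouville theorem. Hence the moments of \<open>\<delta>\<^sub>0\<close> can be matched.
\<close>

section \<open>Random walks on planar lattices\<close>

text \<open>The Fourier symbol of \<open>kap\<close> vanishes to second order at the origin, so its
  reciprocal is not integrable in two dimensions, and \<open>lap v = \<delta>\<^sub>0\<close> cannot
  be solved directly by a Fourier integral. A right-hand side of total mass 0 gives an integrand of
  order -1, which is integrable, and every further vanishing degree of moments gains a power of
  decay. Hence the logarithm and the powers have to be split off before Fourier inversion. The walk
  may be periodic, so no local limit theorem is invoked: reachability of all lattice points alone
  confines the zeros of the symbol to the origin of the box, and the only asymptotic fact about
  transition probabilities is \<open>P n z \<longlonglongrightarrow> 0\<close>. Matching proceeds by
  degree: degree 0 has one harmonic moment against the one function \<open>L\<close>, degree
  \<open>n \<ge> 1\<close> has \<open>(n, 0)\<close> and \<open>(0, n)\<close> against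
  \<open>B n\<close> and \<open>cnj (B n)\<close>. The exponent 1/3 stems from an interpolation; its
  purpose is to separate a decay estimate from the integer order of a leading term.\<close>

definition conv :: "complex set \<Rightarrow> (complex \<Rightarrow> complex) \<Rightarrow> (complex \<Rightarrow> complex) \<Rightarrow> complex \<Rightarrow> complex" where
  "conv X \<kappa> u z = (\<Sum>x\<in>X. \<kappa> x * u (z - x))"

locale spherical_walk =
  fixes w1 w2 :: complex and p :: "complex pmf"
  assumes indep: "lin_indep2 w1 w2"
    and walk: "random_walk_on (lattice2 w1 w2) p"
    and sph: "spherical p"
begin

section \<open>Real coordinates in the lattice basis\<close>

abbreviation Z :: "complex set" where "Z \<equiv> lattice2 w1 w2"

definition det :: real where "det = Im (cnj w1 * w2)"
text \<open>Cramer's rule in the basis \<open>w1\<close>, \<open>w2\<close>. The coordinates are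
  defined on the whole plane; lattice points are those where both are integers.\<close>

definition c1 :: "complex \<Rightarrow> real" where "c1 z = Im (cnj z * w2) / det"
definition c2 :: "complex \<Rightarrow> real" where "c2 z = Im (cnj w1 * z) / det"

lemma det_nz: "det \<noteq> 0"
  using indep by (simp add: lin_indep2_def det_def)

lemma c1_add: "c1 (x + y) = c1 x + c1 y" and c2_add: "c2 (x + y) = c2 x + c2 y"
  and c1_diff: "c1 (x - y) = c1 x - c1 y" and c2_diff: "c2 (x - y) = c2 x - c2 y"
  and c1_0: "c1 0 = 0" and c2_0: "c2 0 = 0"
  by (simp_all add: c1_def c2_def add_divide_distrib diff_divide_distrib algebra_simps)

lemma c1_w: "c1 (of_real a * w1 + of_real b * w2) = a"
  and c2_w: "c2 (of_real a * w1 + of_real b * w2) = b"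
  using det_nz by (simp_all add: c1_def c2_def det_def field_simps)

lemma coord: "z = of_real (c1 z) * w1 + of_real (c2 z) * w2"
proof -
  have "of_real det * z = of_real (c1 z * det) * w1 + of_real (c2 z * det) * w2"
    using det_nz by (simp add: c1_def c2_def det_def complex_eq_iff) (auto simp: algebra_simps)
  hence "of_real det * z = of_real det * (of_real (c1 z) * w1 + of_real (c2 z) * w2)"
    by (simp add: algebra_simps)
  thus ?thesis using det_nz by (metis mult_left_cancel of_real_eq_0_iff)
qed

lemma Z_iff: "z \<in> Z \<longleftrightarrow> c1 z \<in> \<int> \<and> c2 z \<in> \<int>"
proof
  assume "z \<in> Z"
  then obtain m n :: int where "z = of_int m * w1 + of_int n * w2" by (auto simp: lattice2_def)
  hence "z = of_real (of_int m) * w1 + of_real (of_int n) * w2" by simp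
  thus "c1 z \<in> \<int> \<and> c2 z \<in> \<int>" by (metis c1_w c2_w Ints_of_int)
next
  assume "c1 z \<in> \<int> \<and> c2 z \<in> \<int>"
  then obtain m n :: int where "c1 z = of_int m" "c2 z = of_int n" by (auto elim!: Ints_cases)
  with coord[of z] have "z = of_int m * w1 + of_int n * w2" by simp
  thus "z \<in> Z" by (auto simp: lattice2_def)
qed

lemma Z_0 [simp]: "0 \<in> Z" by (simp add: Z_iff c1_0 c2_0)
lemma Z_add: "x \<in> Z \<Longrightarrow> y \<in> Z \<Longrightarrow> x + y \<in> Z" by (simp add: Z_iff c1_add c2_add)
lemma Z_diff: "x \<in> Z \<Longrightarrow> y \<in> Z \<Longrightarrow> x - y \<in> Z" by (simp add: Z_iff c1_diff c2_diff)
lemma Z_w: "of_int m * w1 + of_int n * w2 \<in> Z" by (auto simp: lattice2_def)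

text \<open>The added 1 makes the constant at least 1, so that it can be used in monotonicity
  arguments without a case distinction.\<close>

definition coord_bound :: real where "coord_bound = (cmod w1 + cmod w2) / \<bar>det\<bar> + 1"

lemma coord_bound_ge1: "coord_bound \<ge> 1" by (simp add: coord_bound_def)

lemma c1_le: "\<bar>c1 z\<bar> \<le> coord_bound * cmod z" and c2_le: "\<bar>c2 z\<bar> \<le> coord_bound * cmod z"
proof -
  have d: "\<bar>det\<bar> > 0" using det_nz by simp
  have "\<bar>Im (cnj z * w2)\<bar> \<le> cmod z * cmod w2"
    by (metis abs_Im_le_cmod norm_mult complex_mod_cnj)
  hence "\<bar>c1 z\<bar> \<le> cmod z * cmod w2 / \<bar>det\<bar>" using d by (simp add: c1_def abs_divide divide_right_mono)
  also have "\<dots> \<le> coord_bound * cmod z" using d by (simp add: coord_bound_def field_simps)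
  finally show "\<bar>c1 z\<bar> \<le> coord_bound * cmod z" .
  have "\<bar>Im (cnj w1 * z)\<bar> \<le> cmod w1 * cmod z"
    by (metis abs_Im_le_cmod norm_mult complex_mod_cnj)
  hence "\<bar>c2 z\<bar> \<le> cmod w1 * cmod z / \<bar>det\<bar>" using d by (simp add: c2_def abs_divide divide_right_mono)
  also have "\<dots> \<le> coord_bound * cmod z" using d by (simp add: coord_bound_def field_simps)
  finally show "\<bar>c2 z\<bar> \<le> coord_bound * cmod z" .
qed

lemma norm_le_coord: "cmod z \<le> \<bar>c1 z\<bar> * cmod w1 + \<bar>c2 z\<bar> * cmod w2"
  using norm_triangle_ineq[of "of_real (c1 z) * w1" "of_real (c2 z) * w2"] coord[of z]
  by (simp add: norm_mult)

lemma finite_Z_ball: "finite {z \<in> Z. cmod z \<le> R}"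
proof -
  define B where "B = \<lceil>coord_bound * R\<rceil>"
  have "{z \<in> Z. cmod z \<le> R} \<subseteq> (\<lambda>(m,n). of_int m * w1 + of_int n * w2) ` ({-B..B} \<times> {-B..B})"
  proof
    fix z assume "z \<in> {z \<in> Z. cmod z \<le> R}"
    hence z: "z \<in> Z" "cmod z \<le> R" by auto
    then obtain m n :: int where mn: "c1 z = of_int m" "c2 z = of_int n" by (auto elim!: Ints_cases simp: Z_iff)
    have "\<bar>of_int m\<bar> \<le> coord_bound * R" "\<bar>of_int n\<bar> \<le> coord_bound * R"
      using c1_le[of z] c2_le[of z] mn z(2) coord_bound_ge1 by (auto intro: order_trans[OF _ mult_left_mono])
    hence "\<bar>m\<bar> \<le> B" "\<bar>n\<bar> \<le> B" unfolding B_def by linarith+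
    moreover have "z = of_int m * w1 + of_int n * w2" using coord[of z] mn by simp
    ultimately show "z \<in> (\<lambda>(m,n). of_int m * w1 + of_int n * w2) ` ({-B..B} \<times> {-B..B})"
      by (intro image_eqI[of _ _ "(m,n)"]) auto
  qed
  thus ?thesis by (rule finite_subset) auto
qed

lemma supp_Z: "set_pmf p \<subseteq> Z" using walk by (simp add: random_walk_on_def)

lemma finite_supp: "finite (set_pmf p)"
proof -
  obtain B where "\<forall>x\<in>set_pmf p. cmod x \<le> B"
    using sph by (auto simp: spherical_def bounded_iff)
  hence "set_pmf p \<subseteq> {z \<in> Z. cmod z \<le> B}" using supp_Z by auto
  thus ?thesis using finite_Z_ball finite_subset by blast
qed

lemma reach: "z \<in> Z \<Longrightarrow> \<exists>n. pmf (walk_dist p n) z > 0"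
  using walk by (simp add: random_walk_on_def)

section \<open>The step kernel, its operator and its low moments\<close>

definition X :: "complex set" where "X = insert 0 (set_pmf p)"
text \<open>The law of one step minus the unit mass at 0, so that convolution with it is the
  generator of the walk; the second term is the reason for inserting 0 into
  \<open>X\<close>.\<close>

definition kap :: "complex \<Rightarrow> complex" where
  "kap x = of_real (pmf p x) - (if x = 0 then 1 else 0)"
definition lap :: "(complex \<Rightarrow> complex) \<Rightarrow> complex \<Rightarrow> complex" where "lap = conv X kap"
definition kmom :: "nat \<Rightarrow> nat \<Rightarrow> complex" where
  "kmom i j = (\<Sum>x\<in>X. kap x * x ^ i * cnj x ^ j)"

lemma X_Z: "X \<subseteq> Z" and finite_X [simp]: "finite X" and X_0: "0 \<in> X"
  using supp_Z finite_supp by (auto simp: X_def)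

lemma sum_p: "(\<Sum>x\<in>X. of_real (pmf p x) * f x) = (\<Sum>x\<in>set_pmf p. of_real (pmf p x) * (f x :: complex))"
  unfolding X_def by (rule sum.mono_neutral_right) (auto simp: finite_supp set_pmf_iff)

lemma sum_kap: "(\<Sum>x\<in>X. kap x * f x) = (\<Sum>x\<in>set_pmf p. of_real (pmf p x) * f x) - f 0"
proof -
  have "(\<Sum>x\<in>X. kap x * f x) = (\<Sum>x\<in>X. of_real (pmf p x) * f x) - (\<Sum>x\<in>X. if x = 0 then f x else 0)"
    unfolding sum_subtractf[symmetric] by (rule sum.cong) (auto simp: kap_def algebra_simps)
  thus ?thesis using X_0 by (simp add: sum_p sum.delta)
qed

lemma lap_eq: "lap u z = (\<Sum>x\<in>set_pmf p. of_real (pmf p x) * u (z - x)) - u z"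
  unfolding lap_def conv_def by (subst sum_kap) simp

lemma expect: "measure_pmf.expectation p (f :: complex \<Rightarrow> 'b::{banach,second_countable_topology}) = (\<Sum>x\<in>set_pmf p. pmf p x *\<^sub>R f x)"
  by (rule integral_measure_pmf[OF finite_supp]) (auto simp: set_pmf_iff)

lemma sum_pmf_1: "(\<Sum>x\<in>set_pmf p. pmf p x) = 1"
  by (rule sum_pmf_eq_1[OF finite_supp order_refl])

lemma kmom00: "kmom 0 0 = 0"
  using sum_pmf_1 sum_kap[of "\<lambda>_. 1"] by (simp add: kmom_def flip: of_real_sum)

definition sig :: real where "sig = 2 * measure_pmf.expectation p (\<lambda>x. Re x * Re x)"

text \<open>In complex notation sphericity says that the mean of \<open>x ^ 2\<close> is 0: its real
  part is the difference of the two variances, its imaginary part twice the covariance. Only the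
  mixed second moment survives.\<close>

lemma kmoms: "kmom (Suc 0) 0 = 0" "kmom 0 (Suc 0) = 0" "kmom 2 0 = 0" "kmom 0 2 = 0" "kmom (Suc 0) (Suc 0) = of_real sig"
proof -
  from sph obtain C where
    m: "(\<Sum>x\<in>set_pmf p. pmf p x *\<^sub>R x) = 0"
    and rr: "(\<Sum>x\<in>set_pmf p. pmf p x * (Re x * Re x)) = C"
    and ii: "(\<Sum>x\<in>set_pmf p. pmf p x * (Im x * Im x)) = C"
    and ri: "(\<Sum>x\<in>set_pmf p. pmf p x * (Re x * Im x)) = 0"
    unfolding spherical_def expect by auto
  show 1: "kmom (Suc 0) 0 = 0" using m by (simp add: kmom_def sum_kap mult.assoc scaleR_conv_of_real)
  have "cnj (\<Sum>x\<in>set_pmf p. pmf p x *\<^sub>R x) = 0" using m by simp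
  thus "kmom 0 (Suc 0) = 0" by (simp add: kmom_def sum_kap mult.assoc scaleR_conv_of_real)
  have "(\<Sum>x\<in>set_pmf p. of_real (pmf p x) * (x^2)) = 0"
  proof (rule complex_eqI)
    show "Re (\<Sum>x\<in>set_pmf p. of_real (pmf p x) * x^2) = Re 0"
      using rr ii by (simp add: power2_eq_square sum_subtractf algebra_simps)
    have "Im (\<Sum>x\<in>set_pmf p. of_real (pmf p x) * x^2) = 2 * (\<Sum>x\<in>set_pmf p. pmf p x * (Re x * Im x))"
      unfolding sum_distrib_left by (simp add: power2_eq_square algebra_simps)
    thus "Im (\<Sum>x\<in>set_pmf p. of_real (pmf p x) * x^2) = Im 0" using ri by simp
  qed
  thus 2: "kmom 2 0 = 0" by (simp add: kmom_def sum_kap mult.assoc)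
  have "cnj (\<Sum>x\<in>set_pmf p. of_real (pmf p x) * (x^2)) = 0" using 2 by (simp add: kmom_def sum_kap mult.assoc)
  thus "kmom 0 2 = 0" by (simp add: kmom_def sum_kap mult.assoc)
  have "(\<Sum>x\<in>set_pmf p. of_real (pmf p x) * (x * cnj x)) = of_real sig"
    using rr ii unfolding sig_def expect by (auto simp: complex_eq_iff power2_eq_square sum.distrib algebra_simps)
  thus "kmom (Suc 0) (Suc 0) = of_real sig" by (simp add: kmom_def sum_kap mult.assoc)
qed

lemma sig_eq: "sig = (\<Sum>x\<in>set_pmf p. pmf p x * (cmod x)^2)"
proof -
  have "complex_of_real sig = (\<Sum>x\<in>set_pmf p. of_real (pmf p x) * (x * cnj x))"
    using kmoms(5) by (simp add: kmom_def sum_kap mult.assoc)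
  also have "\<dots> = of_real (\<Sum>x\<in>set_pmf p. pmf p x * (cmod x)^2)"
    by (simp add: complex_norm_square[symmetric])
  finally show ?thesis using of_real_eq_iff by blast
qed

lemma w1_nz: "w1 \<noteq> 0"
  using indep by (auto simp: lin_indep2_def)

lemma supp_walk_0: assumes "set_pmf p \<subseteq> {0}" shows "set_pmf (walk_dist p n) \<subseteq> {0}"
  using assms by (induction n) fastforce+

lemma ex_nonzero_step: "\<exists>x\<in>set_pmf p. x \<noteq> 0"
proof (rule ccontr)
  assume "\<not> ?thesis"
  hence "set_pmf p \<subseteq> {0}" by auto
  note s = supp_walk_0[OF this]
  have "w1 \<in> Z" using Z_w[of 1 0] by simp
  then obtain n where "w1 \<in> set_pmf (walk_dist p n)" using reach[of w1] by (auto simp: pmf_positive_iff)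
  with s[of n] w1_nz show False by auto
qed

lemma sig_pos: "sig > 0"
proof -
  obtain x where x: "x \<in> set_pmf p" "x \<noteq> 0" using ex_nonzero_step by blast
  have "pmf p x * (cmod x)^2 \<le> sig" unfolding sig_eq
    by (rule member_le_sum) (use x finite_supp in auto)
  moreover have "pmf p x * (cmod x)^2 > 0" using x by (simp add: pmf_positive)
  ultimately show ?thesis by linarith
qed

text \<open>A walk with a single possible step has that step as its mean, which is 0, contradicting
  the existence of a nonzero step.\<close>

lemma two_steps: "\<exists>x\<in>set_pmf p. \<exists>y\<in>set_pmf p. x \<noteq> y"
proof (rule ccontr)
  assume n: "\<not> ?thesis"
  obtain x where x: "x \<in> set_pmf p" "x \<noteq> 0" using ex_nonzero_step by blast
  hence "set_pmf p = {x}" using n by auto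
  moreover hence "pmf p x = 1" using sum_pmf_1 by simp
  ultimately have "kmom (Suc 0) 0 = x" by (simp add: kmom_def sum_kap mult.assoc)
  with kmoms x show False by simp
qed

section \<open>Transition probabilities and their decay\<close>

abbreviation P :: "nat \<Rightarrow> complex \<Rightarrow> real" where "P n z \<equiv> pmf (walk_dist p n) z"

lemma finite_walk: "finite (set_pmf (walk_dist p n))"
  by (induction n) (auto simp: finite_supp)

lemma walk_Z: "set_pmf (walk_dist p n) \<subseteq> Z"
  by (induction n) (use supp_Z in \<open>auto intro!: Z_add\<close>)

text \<open>Exchanging the two draws puts the single step outside, so that the recursions for
  \<open>P\<close> and \<open>EN\<close> become sums over the steps.\<close>

lemma walk_Suc: "walk_dist p (Suc n) = bind_pmf p (\<lambda>y. map_pmf (\<lambda>x. x + y) (walk_dist p n))"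
  unfolding walk_dist.simps map_pmf_def by (subst bind_commute_pmf) simp

lemma pmf_shift: "pmf (map_pmf (\<lambda>x. x + y) q) z = pmf q (z - (y::complex))"
  using pmf_map_inj'[of "\<lambda>x. x + y" q "z - y"] by (simp add: inj_on_def)

lemma P_Suc: "P (Suc n) z = (\<Sum>y\<in>set_pmf p. pmf p y * P n (z - y))"
  unfolding walk_Suc pmf_bind expect pmf_shift by simp

text \<open>The mean of \<open>v (z - R\<^sub>n)\<close>, written as a sum over the finite support
  so that no integrability question arises.\<close>

definition EN :: "nat \<Rightarrow> (complex \<Rightarrow> complex) \<Rightarrow> complex \<Rightarrow> complex" where
  "EN n v z = (\<Sum>x\<in>set_pmf (walk_dist p n). of_real (P n x) * v (z - x))"

lemma EN_superset: "finite A \<Longrightarrow> set_pmf (walk_dist p n) \<subseteq> A \<Longrightarrow> EN n v z = (\<Sum>x\<in>A. of_real (P n x) * v (z - x))"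
  unfolding EN_def by (rule sum.mono_neutral_left) (auto simp: set_pmf_iff)

lemma EN_Suc: "EN (Suc n) v z = (\<Sum>y\<in>set_pmf p. of_real (pmf p y) * EN n v (z - y))"
proof -
  define A where "A = set_pmf (walk_dist p n)"
  define B where "B = (\<lambda>(y,x). x + y) ` (set_pmf p \<times> A)"
  have fB: "finite B" using finite_walk finite_supp by (auto simp: B_def A_def)
  have sB: "set_pmf (walk_dist p (Suc n)) \<subseteq> B" unfolding walk_Suc B_def A_def by auto
  have "EN (Suc n) v z = (\<Sum>x\<in>B. of_real (P (Suc n) x) * v (z - x))"
    by (rule EN_superset[OF fB sB])
  also have "\<dots> = (\<Sum>y\<in>set_pmf p. of_real (pmf p y) * (\<Sum>x\<in>B. of_real (P n (x - y)) * v (z - x)))"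
    unfolding P_Suc of_real_sum sum_distrib_right sum_distrib_left
    by (subst sum.swap) (simp add: mult_ac)
  also have "\<dots> = (\<Sum>y\<in>set_pmf p. of_real (pmf p y) * EN n v (z - y))"
  proof (rule sum.cong[OF refl])
    fix y assume y: "y \<in> set_pmf p"
    have "(\<Sum>x\<in>B. of_real (P n (x - y)) * v (z - x)) = (\<Sum>x\<in>(\<lambda>x. x + y) ` A. of_real (P n (x - y)) * v (z - x))"
      by (rule sum.mono_neutral_right[OF fB]) (use y in \<open>force simp: B_def A_def set_pmf_iff image_iff\<close>)+
    also have "\<dots> = (\<Sum>x\<in>A. of_real (P n x) * v (z - y - x))"
      by (subst sum.reindex) (auto simp: inj_on_def algebra_simps)
    finally show "of_real (pmf p y) * (\<Sum>x\<in>B. of_real (P n (x - y)) * v (z - x)) = of_real (pmf p y) * EN n v (z - y)"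
      by (simp add: EN_def A_def)
  qed
  finally show ?thesis .
qed

text \<open>Each further step adds the average of \<open>lap v\<close>, which is
  \<open>\<epsilon>\<close> times a transition probability. The factor \<open>\<epsilon>\<close>
  lets one identity serve Green functions (value 1) and harmonic functions (value 0).\<close>

lemma EN_lap:
  assumes "\<And>z. z \<in> Z \<Longrightarrow> lap v z = (if z = 0 then \<epsilon> else 0)" and "z \<in> Z"
  shows "EN n v z = v z + \<epsilon> * (\<Sum>k<n. of_real (P k z))"
  using assms(2)
proof (induction n arbitrary: z)
  case 0
  show ?case by (simp add: EN_def)
next
  case (Suc n)
  have "EN (Suc n) v z = (\<Sum>y\<in>set_pmf p. of_real (pmf p y) * (v (z - y) + \<epsilon> * (\<Sum>k<n. of_real (P k (z - y)))))"
    unfolding EN_Suc using Suc.prems supp_Z by (intro sum.cong refl) (subst Suc.IH, auto intro: Z_diff)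
  also have "\<dots> = (\<Sum>y\<in>set_pmf p. of_real (pmf p y) * v (z - y))
      + \<epsilon> * (\<Sum>k<n. \<Sum>y\<in>set_pmf p. of_real (pmf p y) * of_real (P k (z - y)))"
    by (subst sum.swap) (simp add: distrib_left sum.distrib sum_distrib_left mult.left_commute)
  also have "(\<Sum>y\<in>set_pmf p. of_real (pmf p y) * v (z - y)) = v z + \<epsilon> * of_real (P 0 z)"
    using assms(1)[OF Suc.prems] unfolding lap_eq by (auto simp: algebra_simps indicator_def split: if_splits)
  also have "(\<Sum>k<n. \<Sum>y\<in>set_pmf p. of_real (pmf p y) * of_real (P k (z - y))) = (\<Sum>k<n. complex_of_real (P (Suc k) z))"
    by (simp add: P_Suc del: walk_dist.simps)
  finally show ?case unfolding sum.lessThan_Suc_shift by (simp add: algebra_simps del: walk_dist.simps)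
qed

text \<open>Chapman-Kolmogorov, read off from the fact that \<open>EN k\<close> is the
  \<open>k\<close>-fold one-step average, applied to \<open>P n\<close>.\<close>

lemma P_add: "P (k + n) z = (\<Sum>w\<in>set_pmf (walk_dist p k). P k w * P n (z - w))"
proof -
  have "EN k (\<lambda>z. of_real (P n z)) z = of_real (P (k + n) z)"
  proof (induction k arbitrary: z)
    case 0
    show ?case by (simp add: EN_def)
  next
    case (Suc k)
    show ?case unfolding EN_Suc Suc.IH add_Suc P_Suc by simp
  qed
  hence "complex_of_real (\<Sum>w\<in>set_pmf (walk_dist p k). P k w * P n (z - w)) = of_real (P (k + n) z)"
    by (simp add: EN_def)
  thus ?thesis using of_real_eq_iff by metis
qed

lemma sum_P: "(\<Sum>x\<in>set_pmf (walk_dist p n). P n x) = 1"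
  by (rule sum_pmf_eq_1[OF finite_walk order_refl])

lemma sum_P_le: "finite A \<Longrightarrow> (\<Sum>x\<in>A. P n x) \<le> 1"
  by (metis measure_measure_pmf_finite measure_pmf.prob_le_1)

text \<open>For distinct \<open>x\<close> and \<open>y\<close> these are \<open>k + 1\<close>
  different points, all charged by the walk at time \<open>k\<close>; this prevents the mass from
  concentrating.\<close>

lemma walk_spread:
  assumes "x \<in> set_pmf p" "y \<in> set_pmf p"
  shows "j \<le> k \<Longrightarrow> of_nat j * x + of_nat (k - j) * y \<in> set_pmf (walk_dist p k)"
proof (induction k arbitrary: j)
  case 0
  thus ?case by simp
next
  case (Suc k)
  show ?case
  proof (cases "j \<le> k")
    case True
    from Suc.IH[OF this] assms(2)
    have "of_nat j * x + of_nat (k - j) * y + y \<in> set_pmf (walk_dist p (Suc k))" by auto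
    moreover have "of_nat j * x + of_nat (k - j) * y + y = of_nat j * x + of_nat (Suc k - j) * y"
      using True by (simp add: Suc_diff_le algebra_simps)
    ultimately show ?thesis by simp
  next
    case False
    hence j: "j = Suc k" using Suc.prems by simp
    from Suc.IH[OF order_refl] assms(1)
    have "of_nat k * x + of_nat (k - k) * y + x \<in> set_pmf (walk_dist p (Suc k))" by auto
    thus ?thesis using j by (simp add: algebra_simps del: walk_dist.simps)
  qed
qed

definition max_prob :: "nat \<Rightarrow> real" where "max_prob n = Max (P n ` set_pmf (walk_dist p n))"

lemma P_le_PM: "P n z \<le> max_prob n"
proof (cases "z \<in> set_pmf (walk_dist p n)")
  case True
  thus ?thesis unfolding max_prob_def by (intro Max_ge) (auto simp: finite_walk)
next
  case False
  obtain y where "y \<in> set_pmf (walk_dist p n)" using set_pmf_not_empty[of "walk_dist p n"] by blast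
  hence "P n y \<le> max_prob n" unfolding max_prob_def by (intro Max_ge) (auto simp: finite_walk)
  moreover have "P n z = 0" using False by (simp add: set_pmf_iff)
  ultimately show ?thesis using pmf_nonneg[of "walk_dist p n" y] by linarith
qed

lemma max_prob_attained: "\<exists>z. P n z = max_prob n"
proof -
  have "max_prob n \<in> P n ` set_pmf (walk_dist p n)"
    unfolding max_prob_def by (rule Max_in) (auto simp: finite_walk set_pmf_not_empty)
  thus ?thesis by auto
qed

lemma max_prob_nonneg: "max_prob n \<ge> 0" by (rule order_trans[OF pmf_nonneg P_le_PM])

lemma max_prob_decseq: "decseq max_prob"
proof (rule decseq_SucI)
  fix n
  obtain z where "P (Suc n) z = max_prob (Suc n)" using max_prob_attained by blast
  moreover have "P (Suc n) z \<le> (\<Sum>y\<in>set_pmf p. pmf p y * max_prob n)"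
    unfolding P_Suc by (intro sum_mono mult_left_mono P_le_PM) auto
  moreover have "\<dots> = max_prob n" by (simp add: sum_pmf_1 flip: sum_distrib_right)
  ultimately show "max_prob (Suc n) \<le> max_prob n" by linarith
qed

text \<open>If the maximal probability stayed above \<open>l\<close>, then at a maximiser of step \<open>n + k\<close> all the
  points reachable backwards in \<open>k\<close> steps would carry almost that mass, and there are more than
  \<open>k\<close> of them.\<close>

lemma max_prob_tendsto_0: "max_prob \<longlonglongrightarrow> 0"
proof -
  have bd: "\<forall>n. 0 \<le> max_prob n" by (simp add: max_prob_nonneg)
  obtain l where l: "max_prob \<longlonglongrightarrow> l" "\<And>n. l \<le> max_prob n"
    using decseq_convergent[OF max_prob_decseq bd] by blast
  have l0: "l \<ge> 0" using l(1) max_prob_nonneg by (intro LIMSEQ_le_const[OF l(1)]) auto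
  have "\<not> l > 0"
  proof
    assume lp: "l > 0"
    obtain x y where xy: "x \<in> set_pmf p" "y \<in> set_pmf p" "x \<noteq> y" using two_steps by blast
    \<comment> \<open>With this \<open>k\<close>, disjoint masses of at least \<open>l / 2\<close>
      at \<open>k + 1\<close> points add up to more than 1.\<close>
    obtain k :: nat where k: "2 < real k * l"
      using reals_Archimedean3[OF lp] by blast
    define pt where "pt j = of_nat j * x + of_nat (k - j) * y" for j
    have inj: "inj_on pt {..k}"
    proof (rule inj_onI)
      fix i j assume ij: "i \<in> {..k}" "j \<in> {..k}" "pt i = pt j"
      hence "(of_nat i - of_nat j) * (x - y) = 0"
        by (simp add: pt_def of_nat_diff algebra_simps)
      thus "i = j" using xy by simp
    qed
    have pos: "P k (pt j) > 0" if "j \<le> k" for j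
      using walk_spread[OF xy(1,2) that] by (simp add: pt_def pmf_positive)
    \<comment> \<open>The smallest weight among the chosen points: once \<open>max_prob\<close>
      drops by less than \<open>e * (l / 2)\<close>, each of them misses the maximum by less than
      \<open>l / 2\<close>.\<close>
    define e where "e = Min ((\<lambda>j. P k (pt j)) ` {..k})"
    have e: "e > 0" "\<And>j. j \<le> k \<Longrightarrow> e \<le> P k (pt j)"
      unfolding e_def using pos by (subst Min_gr_iff) auto
    have "(\<lambda>n. max_prob n - max_prob (n + k)) \<longlonglongrightarrow> l - l"
      by (intro tendsto_diff l LIMSEQ_ignore_initial_segment)
    hence "eventually (\<lambda>n. max_prob n - max_prob (n + k) < e * (l / 2)) sequentially"
      using e lp by (intro order_tendstoD(2)) auto
    then obtain n where n: "max_prob n - max_prob (n + k) < e * (l / 2)" by (auto simp: eventually_sequentially)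
    obtain z where z: "P (k + n) z = max_prob (k + n)" using max_prob_attained by blast
    have big: "P n (z - pt j) \<ge> l / 2" if j: "j \<le> k" for j
    proof -
      let ?w = "pt j" and ?S = "set_pmf (walk_dist p k)"
      have wS: "?w \<in> ?S" using pos[OF j] by (simp add: set_pmf_iff)
      have "max_prob (k + n) = P k ?w * P n (z - ?w) + (\<Sum>w\<in>?S - {?w}. P k w * P n (z - w))"
        unfolding z[symmetric] P_add by (subst sum.remove[OF finite_walk wS]) simp
      also have "(\<Sum>w\<in>?S - {?w}. P k w * P n (z - w)) \<le> (\<Sum>w\<in>?S - {?w}. P k w * max_prob n)"
        by (intro sum_mono mult_left_mono P_le_PM) auto
      also have "\<dots> = (1 - P k ?w) * max_prob n"
        using sum.remove[OF finite_walk wS, of "P k"] sum_P[of k] by (simp flip: sum_distrib_right)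
      finally have a: "P k ?w * (max_prob n - P n (z - ?w)) \<le> max_prob n - max_prob (n + k)"
        by (simp add: algebra_simps)
      have "e * (max_prob n - P n (z - ?w)) \<le> P k ?w * (max_prob n - P n (z - ?w))"
        using e(2)[OF j] P_le_PM[of n "z - ?w"] by (intro mult_right_mono) auto
      hence "e * (max_prob n - P n (z - ?w)) < e * (l / 2)" using a n by linarith
      hence "max_prob n - P n (z - ?w) < l / 2" using e(1) by simp
      thus ?thesis using l(2)[of n] by linarith
    qed
    have "real (Suc k) * (l / 2) = (\<Sum>j\<le>k. l / 2)" by simp
    also have "\<dots> \<le> (\<Sum>j\<le>k. P n (z - pt j))" using big by (intro sum_mono) auto
    also have "\<dots> = (\<Sum>w\<in>(\<lambda>j. z - pt j) ` {..k}. P n w)"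
      using inj by (subst sum.reindex) (auto simp: inj_on_def)
    also have "\<dots> \<le> 1" by (rule sum_P_le) auto
    finally show False using k lp by (simp add: algebra_simps)
  qed
  hence "l = 0" using l0 by simp
  thus ?thesis using l by simp
qed

lemma P_tendsto_0: "(\<lambda>n. P n z) \<longlonglongrightarrow> 0"
  by (rule tendsto_sandwich[OF _ _ tendsto_const max_prob_tendsto_0]) (auto intro!: always_eventually P_le_PM)

section \<open>Slow variation, the Liouville theorem and the potential\<close>

definition slow :: "(complex \<Rightarrow> complex) \<Rightarrow> bool" where
  "slow v \<longleftrightarrow> (\<forall>y\<in>Z. \<forall>e>0. \<exists>R. \<forall>z\<in>Z. cmod z \<ge> R \<longrightarrow> cmod (v (z - y) - v z) \<le> e)"

text \<open>Far away the increments of \<open>v\<close> are small because \<open>v\<close> is slow;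
  in a ball there are finitely many points and each of their probabilities tends to 0. This covers
  unbounded functions such as the logarithm.\<close>

lemma EN_slow:
  assumes "slow v" "z \<in> Z"
  shows "(\<lambda>n. EN n v z - EN n v 0) \<longlonglongrightarrow> 0"
proof (rule LIMSEQ_I)
  fix e :: real assume e: "e > 0"
  \<comment> \<open>The increments occurring in \<open>EN\<close> have base point \<open>- x\<close>
    and shift \<open>- z\<close>, so slowness is applied to the reflected point.\<close>
  have mz: "- z \<in> Z" using Z_diff[OF Z_0 assms(2)] by simp
  from assms(1) mz e obtain R where R: "\<And>x. x \<in> Z \<Longrightarrow> cmod x \<ge> R \<Longrightarrow> cmod (v (x + z) - v x) \<le> e / 2"
    unfolding slow_def by (metis diff_minus_eq_add half_gt_zero)
  define A where "A = {x \<in> Z. cmod x \<le> R}"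
  have fA: "finite A" unfolding A_def by (rule finite_Z_ball)
  have mA: "x \<in> Z \<Longrightarrow> x \<notin> A \<Longrightarrow> cmod (v (z - x) - v (- x)) \<le> e / 2" for x
    using R[of "- x"] Z_diff[OF Z_0, of x] by (auto simp: A_def)
  have "(\<lambda>n. \<Sum>x\<in>A. P n x * cmod (v (z - x) - v (- x))) \<longlonglongrightarrow> (\<Sum>x\<in>A. 0 * cmod (v (z - x) - v (- x)))"
    by (intro tendsto_intros P_tendsto_0)
  hence "eventually (\<lambda>n. (\<Sum>x\<in>A. P n x * cmod (v (z - x) - v (- x))) < e / 2) sequentially"
    using e by (intro order_tendstoD(2)) auto
  then obtain N where N: "\<And>n. n \<ge> N \<Longrightarrow> (\<Sum>x\<in>A. P n x * cmod (v (z - x) - v (- x))) < e / 2"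
    by (auto simp: eventually_sequentially)
  show "\<exists>no. \<forall>n\<ge>no. norm (EN n v z - EN n v 0 - 0) < e"
  proof (intro exI allI impI)
    fix n assume n: "n \<ge> N"
    let ?S = "set_pmf (walk_dist p n)"
    have "EN n v z - EN n v 0 = (\<Sum>x\<in>?S. of_real (P n x) * (v (z - x) - v (- x)))"
      by (simp add: EN_def sum_subtractf algebra_simps)
    also have "cmod \<dots> \<le> (\<Sum>x\<in>?S. P n x * cmod (v (z - x) - v (- x)))"
      by (rule sum_norm_le) (simp add: norm_mult)
    also have "\<dots> \<le> (\<Sum>x\<in>?S. (if x \<in> A then P n x * cmod (v (z - x) - v (- x)) else 0) + P n x * (e / 2))"
      using mA walk_Z[of n] e by (intro sum_mono) (auto intro!: mult_left_mono simp del: times_divide_eq_right)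
    also have "\<dots> = (\<Sum>x\<in>?S \<inter> A. P n x * cmod (v (z - x) - v (- x))) + e / 2"
      by (simp add: sum.distrib sum_P sum.inter_restrict[OF finite_walk] flip: sum_distrib_right sum_divide_distrib)
    also have "(\<Sum>x\<in>?S \<inter> A. P n x * cmod (v (z - x) - v (- x))) \<le> (\<Sum>x\<in>A. P n x * cmod (v (z - x) - v (- x)))"
      by (rule sum_mono2[OF fA]) auto
    finally show "norm (EN n v z - EN n v 0 - 0) < e" using N[OF n] by simp
  qed
qed

text \<open>Averages of a harmonic function do not depend on \<open>n\<close>, so their difference
  at \<open>z\<close> and 0 equals its own limit, which is 0.\<close>

lemma harmonic_slow_const:
  assumes "slow v" "\<And>z. z \<in> Z \<Longrightarrow> lap v z = 0" "z \<in> Z"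
  shows "v z = v 0"
proof -
  have "EN n v z - EN n v 0 = v z - v 0" for n
    using EN_lap[of v 0 z n] EN_lap[of v 0 0 n] assms by simp
  with EN_slow[OF assms(1,3)] have "(\<lambda>n::nat. v z - v 0) \<longlonglongrightarrow> 0" by simp
  thus ?thesis by (simp add: LIMSEQ_const_iff)
qed

text \<open>The difference of the averages is \<open>v z - v 0\<close> minus a partial sum of the
  potential. Its convergence to 0 yields the convergence of the series together with its
  value.\<close>

lemma harmonic_potential_eq:
  assumes "slow v" "\<And>z. z \<in> Z \<Longrightarrow> lap v z = (if z = 0 then 1 else 0)" "z \<in> Z"
  shows "harmonic_potential p z = Re (v z - v 0)"
proof -
  have e: "EN n v z - EN n v 0 = (v z - v 0) - of_real (\<Sum>k<n. P k 0 - P k z)" for n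
    using EN_lap[of v 1 z n] EN_lap[of v 1 0 n] assms by (simp add: sum_subtractf)
  have "(\<lambda>n. (v z - v 0) - of_real (\<Sum>k<n. P k 0 - P k z)) \<longlonglongrightarrow> 0"
    using EN_slow[OF assms(1,3)] unfolding e .
  from tendsto_Re[OF this] have "(\<lambda>n. Re (v z - v 0) - (\<Sum>k<n. P k 0 - P k z)) \<longlonglongrightarrow> 0" by simp
  from tendsto_diff[OF tendsto_const[of "Re (v z - v 0)"] this]
  have "(\<lambda>k. P k 0 - P k z) sums Re (v z - v 0)" by (simp add: sums_def)
  thus ?thesis unfolding harmonic_potential_def by (simp add: sums_iff)
qed

end

section \<open>Asymptotic expansions in monomials\<close>

text \<open>\<open>M\<close> counts the order of decay and may be negative. The bound is on the
  plane and not only on the lattice, so expansions can be multiplied and shifted freely.\<close>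

definition bigO :: "int \<Rightarrow> (complex \<Rightarrow> complex) \<Rightarrow> bool" where
  "bigO M f \<longleftrightarrow> (\<exists>C. \<forall>\<^sub>F z in at_infinity. cmod (f z) \<le> C * cmod z powi (-M))"

lemma eventually_norm_ge: "\<forall>\<^sub>F z in at_infinity. cmod z \<ge> B" for B
  by (auto simp: eventually_at_infinity)

lemma bigO_0: "bigO M (\<lambda>_. 0)"
  by (auto simp: bigO_def intro: exI[of _ 0])

lemma bigO_cong: "bigO M f \<Longrightarrow> \<forall>\<^sub>F z in at_infinity. cmod (g z) \<le> cmod (f z) \<Longrightarrow> bigO M g"
  unfolding bigO_def by (elim exE, rule exI, rule eventually_elim2, assumption, assumption, rule order_trans)

lemma bigO_add: assumes "bigO M f" "bigO M g" shows "bigO M (\<lambda>z. f z + g z)"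
proof -
  from assms obtain C D where "\<forall>\<^sub>F z in at_infinity. cmod (f z) \<le> C * cmod z powi (-M)"
    "\<forall>\<^sub>F z in at_infinity. cmod (g z) \<le> D * cmod z powi (-M)" unfolding bigO_def by blast
  hence "\<forall>\<^sub>F z in at_infinity. cmod (f z + g z) \<le> (C + D) * cmod z powi (-M)"
    by eventually_elim (auto simp: distrib_right intro: norm_triangle_mono)
  thus ?thesis unfolding bigO_def by blast
qed

lemma bigO_mult: assumes "bigO M f" "bigO N g" shows "bigO (M + N) (\<lambda>z. f z * g z)"
proof -
  from assms obtain C D where "\<forall>\<^sub>F z in at_infinity. cmod (f z) \<le> C * cmod z powi (-M)"
    "\<forall>\<^sub>F z in at_infinity. cmod (g z) \<le> D * cmod z powi (-N)" unfolding bigO_def by blast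
  hence "\<forall>\<^sub>F z in at_infinity. cmod (f z * g z) \<le> (C * D) * cmod z powi (-(M+N))"
    using eventually_norm_ge[of 1]
  proof eventually_elim
    case (elim z)
    have "cmod (f z * g z) \<le> (C * cmod z powi (-M)) * (D * cmod z powi (-N))"
      unfolding norm_mult using elim by (intro mult_mono) (auto intro: order_trans[OF norm_ge_zero])
    also have "\<dots> = (C * D) * (cmod z powi (-M) * cmod z powi (-N))" by simp
    also have "cmod z powi (-M) * cmod z powi (-N) = cmod z powi (-(M+N))"
      using elim by (subst power_int_add[symmetric]) (auto simp: algebra_simps)
    finally show ?case .
  qed
  thus ?thesis unfolding bigO_def by blast
qed

lemma bigO_mono: assumes "bigO M f" "N \<le> M" shows "bigO N f"
proof -
  from assms obtain C where "\<forall>\<^sub>F z in at_infinity. cmod (f z) \<le> C * cmod z powi (-M)" unfolding bigO_def by blast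
  hence "\<forall>\<^sub>F z in at_infinity. cmod (f z) \<le> \<bar>C\<bar> * cmod z powi (-N)"
    using eventually_norm_ge[of 1]
  proof eventually_elim
    case (elim z)
    have "C * cmod z powi (-M) \<le> \<bar>C\<bar> * cmod z powi (-N)"
      using elim assms(2) by (intro mult_mono power_int_increasing) auto
    thus ?case using elim by linarith
  qed
  thus ?thesis unfolding bigO_def by blast
qed

lemma bigO_const: "bigO 0 (\<lambda>_. c)"
  by (auto simp: bigO_def intro!: exI[of _ "cmod c"])

lemma bigO_cmult: "bigO M f \<Longrightarrow> bigO M (\<lambda>z. c * f z)"
  using bigO_mult[OF bigO_const[of c], of M f] by simp

lemma bigO_Re: "bigO M f \<Longrightarrow> bigO M (\<lambda>z. of_real (Re (f z)))"
  by (erule bigO_cong) (simp add: abs_Re_le_cmod)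

section \<open>Monomials and their finite spans\<close>

definition monE :: "nat \<Rightarrow> nat \<Rightarrow> complex \<Rightarrow> complex" where
  "monE a b z = cnj z ^ a * inverse z ^ b"

lemma monE_mult: "monE a b z * monE a' b' z = monE (a + a') (b + b') z"
  by (simp add: monE_def power_add)

lemma bigO_monE: assumes "m \<le> int b - int a" shows "bigO m (monE a b)"
proof -
  have "bigO (int b - int a) (monE a b)" unfolding bigO_def
  proof (rule exI[of _ 1], use eventually_norm_ge[of 1] in eventually_elim)
    case (elim z)
    hence "cmod (monE a b z) = cmod z powi (int a + (- int b))"
      by (subst power_int_add) (auto simp: monE_def norm_mult norm_power norm_inverse power_int_minus power_inverse)
    thus ?case by simp
  qed
  thus ?thesis using assms by (rule bigO_mono)
qed

text \<open>The span of monomials of order at least \<open>m\<close>, with repetitions allowed. The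
  inductive form supplies the induction over monomials by which \<open>lap\<close> is inverted and
  the final normal form is reached.\<close>

inductive_set Mon :: "int \<Rightarrow> (complex \<Rightarrow> complex) set" for m where
  Mon_0: "(\<lambda>_. 0) \<in> Mon m"
| Mon_step: "f \<in> Mon m \<Longrightarrow> m \<le> int b - int a \<Longrightarrow> (\<lambda>z. f z + c * monE a b z) \<in> Mon m"

lemma Mon_monE: "m \<le> int b - int a \<Longrightarrow> (\<lambda>z. c * monE a b z) \<in> Mon m"
  using Mon_step[OF Mon_0, of m b a c] by simp

lemma Mon_add: "g \<in> Mon m \<Longrightarrow> f \<in> Mon m \<Longrightarrow> (\<lambda>z. f z + g z) \<in> Mon m"
proof (induction rule: Mon.induct)
  case Mon_0
  thus ?case by simp
next
  case (Mon_step g b a c)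
  show ?case using Mon.Mon_step[OF Mon_step.IH[OF Mon_step.prems] Mon_step.hyps(2), of c] by (simp add: add.assoc)
qed

lemma Mon_cmult: "f \<in> Mon m \<Longrightarrow> (\<lambda>z. d * f z) \<in> Mon m"
proof (induction rule: Mon.induct)
  case Mon_0
  thus ?case using Mon.Mon_0 by simp
next
  case (Mon_step g b a c)
  show ?case using Mon.Mon_step[OF Mon_step.IH Mon_step.hyps(2), of "d * c"] by (simp add: algebra_simps)
qed

lemma Mon_mult: "f \<in> Mon m \<Longrightarrow> g \<in> Mon n \<Longrightarrow> (\<lambda>z. f z * g z) \<in> Mon (m + n)"
proof (induction rule: Mon.induct)
  case Mon_0
  thus ?case using Mon.Mon_0 by simp
next
  case (Mon_step f b a c)
  have "(\<lambda>z. c * monE a b z * g z) \<in> Mon (m + n)" using Mon_step.prems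
  proof (induction rule: Mon.induct)
    case Mon_0
    thus ?case using Mon.Mon_0 by simp
  next
    case (Mon_step g b' a' c')
    have "m + n \<le> int (b + b') - int (a + a')" using Mon_step.hyps \<open>m \<le> int b - int a\<close> by simp
    from Mon.Mon_step[OF Mon_step.IH this, of "c * c'"] show ?case
      by (simp add: algebra_simps flip: monE_mult)
  qed
  from Mon_add[OF this Mon_step.IH[OF Mon_step.prems]] show ?case by (simp add: algebra_simps)
qed

lemma Mon_mono: "f \<in> Mon m \<Longrightarrow> n \<le> m \<Longrightarrow> f \<in> Mon n"
  by (induction rule: Mon.induct) (auto intro: Mon.intros)

lemma Mon_bO: "f \<in> Mon m \<Longrightarrow> bigO m f"
  by (induction rule: Mon.induct) (auto intro!: bigO_0 bigO_add bigO_cmult bigO_monE)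

lemma Mon_uminus: "f \<in> Mon m \<Longrightarrow> (\<lambda>z. - f z) \<in> Mon m"
  using Mon_cmult[of f m "-1"] by simp

lemma Mon_diff: "f \<in> Mon m \<Longrightarrow> g \<in> Mon m \<Longrightarrow> (\<lambda>z. f z - g z) \<in> Mon m"
  using Mon_add[OF Mon_uminus[of g]] by simp

definition Expan :: "int \<Rightarrow> (complex \<Rightarrow> complex) set" where
  "Expan m = {f. \<forall>M. \<exists>r\<in>Mon m. bigO M (\<lambda>z. f z - r z)}"

lemma Expan_I: "(\<And>M. \<exists>r\<in>Mon m. bigO M (\<lambda>z. f z - r z)) \<Longrightarrow> f \<in> Expan m" by (simp add: Expan_def)
lemma Expan_D: "f \<in> Expan m \<Longrightarrow> \<exists>r\<in>Mon m. bigO M (\<lambda>z. f z - r z)" by (simp add: Expan_def)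

lemma Mon_RR: "f \<in> Mon m \<Longrightarrow> f \<in> Expan m"
  by (rule Expan_I) (auto intro!: bexI[of _ f] bigO_0)

lemma Expan_0: "(\<lambda>_. 0) \<in> Expan m" by (rule Mon_RR[OF Mon_0])

lemma Expan_monE: "m \<le> int b - int a \<Longrightarrow> (\<lambda>z. c * monE a b z) \<in> Expan m"
  by (rule Mon_RR[OF Mon_monE])

lemma Expan_add: assumes "f \<in> Expan m" "g \<in> Expan m" shows "(\<lambda>z. f z + g z) \<in> Expan m"
proof (rule Expan_I)
  fix M
  from assms obtain r s where "r \<in> Mon m" "s \<in> Mon m" "bigO M (\<lambda>z. f z - r z)" "bigO M (\<lambda>z. g z - s z)"
    using Expan_D[OF assms(1)] Expan_D[OF assms(2)] by meson
  thus "\<exists>r\<in>Mon m. bigO M (\<lambda>z. f z + g z - r z)"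
    by (intro bexI[of _ "\<lambda>z. r z + s z"] Mon_add) (auto dest: bigO_add simp: algebra_simps)
qed

lemma Expan_mono: "f \<in> Expan m \<Longrightarrow> n \<le> m \<Longrightarrow> f \<in> Expan n"
  unfolding Expan_def using Mon_mono by blast

lemma Expan_bO: assumes "f \<in> Expan m" shows "bigO m f"
proof -
  from Expan_D[OF assms, of m] obtain r where r: "r \<in> Mon m" "bigO m (\<lambda>z. f z - r z)" by blast
  from bigO_add[OF r(2) Mon_bO[OF r(1)]] show ?thesis by simp
qed

lemma Expan_mult: assumes "f \<in> Expan m" "g \<in> Expan n" shows "(\<lambda>z. f z * g z) \<in> Expan (m + n)"
proof (rule Expan_I)
  fix M
  \<comment> \<open>\<open>N\<close> is large enough to reach order \<open>M\<close> even when the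
    other factor grows, that is, when \<open>m\<close> or \<open>n\<close> is negative.\<close>
  define N where "N = \<bar>M\<bar> + \<bar>m\<bar> + \<bar>n\<bar>"
  from assms obtain r s where r: "r \<in> Mon m" "s \<in> Mon n" "bigO N (\<lambda>z. f z - r z)" "bigO N (\<lambda>z. g z - s z)"
    using Expan_D[OF assms(1)] Expan_D[OF assms(2)] by meson
  have "bigO M (\<lambda>z. f z * (g z - s z))"
    by (rule bigO_mono[OF bigO_mult[OF Expan_bO[OF assms(1)] r(4)]]) (simp add: N_def)
  moreover have "bigO M (\<lambda>z. (f z - r z) * s z)"
    by (rule bigO_mono[OF bigO_mult[OF r(3) Mon_bO[OF r(2)]]]) (simp add: N_def)
  ultimately have "bigO M (\<lambda>z. f z * (g z - s z) + (f z - r z) * s z)" by (rule bigO_add)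
  thus "\<exists>r\<in>Mon (m + n). bigO M (\<lambda>z. f z * g z - r z)"
    by (intro bexI[of _ "\<lambda>z. r z * s z"] Mon_mult r) (simp add: algebra_simps)
qed

lemma Expan_cmult: "f \<in> Expan m \<Longrightarrow> (\<lambda>z. c * f z) \<in> Expan m"
  using Expan_mult[OF Expan_monE[of 0 0 0 c], of f m] by (simp add: monE_def)

lemma Expan_sum: "(\<And>x. x \<in> A \<Longrightarrow> f x \<in> Expan m) \<Longrightarrow> (\<lambda>z. \<Sum>x\<in>A. f x z) \<in> Expan m"
  by (induction A rule: infinite_finite_induct) (auto intro: Expan_0 Expan_add)

section \<open>Three leading terms of shifted functions\<close>

definition exp3 :: "int \<Rightarrow> (complex \<Rightarrow> complex) \<Rightarrow> (complex \<Rightarrow> complex) \<Rightarrow> (complex \<Rightarrow> complex) \<Rightarrow> (complex \<Rightarrow> complex) \<Rightarrow> bool" where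
  "exp3 m f f0 f1 f2 \<longleftrightarrow> f0 \<in> Expan m \<and> f1 \<in> Expan (m+1) \<and> f2 \<in> Expan (m+2) \<and> (\<lambda>z. f z - f0 z - f1 z - f2 z) \<in> Expan (m+3)"

text \<open>Three terms are kept because averaging against \<open>kap\<close> kills orders 0 and 1
  and, except for the mixed moment, order 2. The remainder telescopes over the terms of
  \<open>g\<close>, each multiplied by what is left of \<open>f\<close>, so that every product has
  order \<open>m + n + 3\<close>.\<close>

lemma exp3_mult:
  assumes "exp3 m f f0 f1 f2" "exp3 n g g0 g1 g2"
  shows "exp3 (m + n) (\<lambda>z. f z * g z) (\<lambda>z. f0 z * g0 z) (\<lambda>z. f0 z * g1 z + f1 z * g0 z)
     (\<lambda>z. f0 z * g2 z + f1 z * g1 z + f2 z * g0 z)"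
proof -
  let ?rf = "\<lambda>z. f z - f0 z - f1 z - f2 z" and ?rg = "\<lambda>z. g z - g0 z - g1 z - g2 z"
  note F = assms[unfolded exp3_def]
  have fr: "f0 \<in> Expan m" "f1 \<in> Expan (m+1)" "f2 \<in> Expan (m+2)" "?rf \<in> Expan (m+3)"
    and gr: "g0 \<in> Expan n" "g1 \<in> Expan (n+1)" "g2 \<in> Expan (n+2)" "?rg \<in> Expan (n+3)" using F by auto
  have f1': "f1 \<in> Expan m" and f2': "f2 \<in> Expan (m+1)" "f2 \<in> Expan m" and rf': "?rf \<in> Expan m"
    using Expan_mono[OF fr(2), of m] Expan_mono[OF fr(3), of m] Expan_mono[OF fr(3), of "m+1"] Expan_mono[OF fr(4), of m] by auto
  have f: "f \<in> Expan m"
    using Expan_add[OF Expan_add[OF Expan_add[OF fr(1) f1'] f2'(2)] rf'] by simp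
  have *: "(\<lambda>z. f z * ?rg z) \<in> Expan (m+n+3)" "(\<lambda>z. ?rf z * g0 z) \<in> Expan (m+n+3)"
      "(\<lambda>z. (?rf z + f2 z) * g1 z) \<in> Expan (m+n+3)" "(\<lambda>z. (?rf z + f2 z + f1 z) * g2 z) \<in> Expan (m+n+3)"
    using Expan_mult[OF f gr(4)] Expan_mult[OF fr(4) gr(1)]
      Expan_mult[OF Expan_add[OF Expan_mono[OF fr(4)] fr(3)] gr(2)]
      Expan_mult[OF Expan_add[OF Expan_add[OF Expan_mono[OF fr(4)] f2'(1)] fr(2)] gr(3)]
    by (simp_all add: algebra_simps)
  have "(\<lambda>z. f z * ?rg z + ?rf z * g0 z + (?rf z + f2 z) * g1 z + (?rf z + f2 z + f1 z) * g2 z) \<in> Expan (m+n+3)"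
    by (intro Expan_add *)
  also have "(\<lambda>z. f z * ?rg z + ?rf z * g0 z + (?rf z + f2 z) * g1 z + (?rf z + f2 z + f1 z) * g2 z)
    = (\<lambda>z. f z * g z - f0 z * g0 z - (f0 z * g1 z + f1 z * g0 z) - (f0 z * g2 z + f1 z * g1 z + f2 z * g0 z))"
    by (simp add: algebra_simps)
  finally have r: "\<dots> \<in> Expan (m+n+3)" .
  have 1: "(\<lambda>z. f0 z * g1 z + f1 z * g0 z) \<in> Expan (m+n+1)"
    using Expan_mult[OF fr(1) gr(2)] Expan_mult[OF fr(2) gr(1)] by (intro Expan_add) (simp_all add: algebra_simps)
  have 2: "(\<lambda>z. f0 z * g2 z + f1 z * g1 z + f2 z * g0 z) \<in> Expan (m+n+2)"
    using Expan_mult[OF fr(1) gr(3)] Expan_mult[OF fr(2) gr(2)] Expan_mult[OF fr(3) gr(1)] by (intro Expan_add) (simp_all add: algebra_simps)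
  show ?thesis unfolding exp3_def using Expan_mult[OF fr(1) gr(1)] 1 2 r by blast
qed

text \<open>The remainder of the geometric series is kept in exact form, so that its order can be
  read off from its factors.\<close>

lemma geom_rem:
  assumes "z \<noteq> 0" "z \<noteq> (x::complex)"
  shows "inverse (z - x) - (\<Sum>i<n. x ^ i * inverse z ^ Suc i) = x ^ n * inverse z ^ n * inverse (z - x)"
proof (induction n)
  case (Suc n)
  have "inverse (z - x) - inverse z = x * inverse z * inverse (z - x)" using assms by (simp add: field_simps)
  hence "x ^ n * inverse z ^ n * (inverse (z - x) - inverse z) = x ^ n * inverse z ^ n * (x * inverse z * inverse (z - x))"
    by simp
  hence e: "x ^ n * inverse z ^ n * inverse (z - x) - x ^ n * inverse z ^ Suc n = x ^ Suc n * inverse z ^ Suc n * inverse (z - x)"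
    by (simp add: algebra_simps)
  have "inverse (z - x) - (\<Sum>i<Suc n. x ^ i * inverse z ^ Suc i)
      = (inverse (z - x) - (\<Sum>i<n. x ^ i * inverse z ^ Suc i)) - x ^ n * inverse z ^ Suc n" by simp
  thus ?case unfolding Suc.IH e .
qed simp

lemma bigO_inverse_shift: "bigO 1 (\<lambda>z. inverse (z - x))"
  unfolding bigO_def
proof (rule exI[of _ 2], use eventually_norm_ge[of "2 * cmod x + 1"] in eventually_elim)
  case (elim z)
  have "cmod (z - x) \<ge> cmod z - cmod x" by (rule norm_triangle_ineq2)
  hence "cmod (z - x) \<ge> cmod z / 2" "cmod z > 0" using elim norm_ge_zero[of x] by linarith+
  moreover from this have "cmod (z - x) > 0" by linarith
  ultimately show ?case unfolding norm_inverse power_int_minus by (simp add: field_simps)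
qed

lemma exp3_inverse: "exp3 1 (\<lambda>z. inverse (z - x)) (monE 0 1) (\<lambda>z. x * monE 0 2 z) (\<lambda>z. x^2 * monE 0 3 z)"
proof -
  have "(\<lambda>z. inverse (z - x) - monE 0 1 z - x * monE 0 2 z - x^2 * monE 0 3 z) \<in> Expan 4"
  proof (rule Expan_I)
    fix M
    \<comment> \<open>At least 3 terms, so that the leading three can be split off, and at least
      \<open>M\<close>, so that the remainder has order \<open>M\<close>.\<close>
    define n where "n = nat \<bar>M\<bar> + 3"
    define r where "r = (\<lambda>z. \<Sum>i\<in>{3..<n}. x ^ i * monE 0 (Suc i) z)"
    have "finite A \<Longrightarrow> A \<subseteq> {3..} \<Longrightarrow> (\<lambda>z. \<Sum>i\<in>A. x ^ i * monE 0 (Suc i) z) \<in> Mon 4" for A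
      by (induction A rule: finite_induct) (auto intro!: Mon_0 Mon_add Mon_monE)
    from this[of "{3..<n}"] have r: "r \<in> Mon 4" unfolding r_def by fastforce
    have e: "(\<Sum>i<n. x ^ i * inverse z ^ Suc i) = monE 0 1 z + x * monE 0 2 z + x^2 * monE 0 3 z + r z" for z
    proof -
      have "(\<Sum>i<n. x ^ i * inverse z ^ Suc i) = (\<Sum>i<3. x ^ i * inverse z ^ Suc i) + (\<Sum>i\<in>{3..<n}. x ^ i * inverse z ^ Suc i)"
        unfolding lessThan_atLeast0 by (rule sum.atLeastLessThan_concat[symmetric]) (auto simp: n_def)
      also have "(\<Sum>i<3. x ^ i * inverse z ^ Suc i) = monE 0 1 z + x * monE 0 2 z + x^2 * monE 0 3 z"
        by (simp add: monE_def eval_nat_numeral)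
      finally show ?thesis by (simp add: r_def monE_def)
    qed
    have "bigO (int n + 1) (\<lambda>z. x ^ n * (monE 0 n z * inverse (z - x)))"
      by (intro bigO_cmult bigO_mult bigO_monE bigO_inverse_shift) auto
    hence "bigO M (\<lambda>z. x ^ n * (monE 0 n z * inverse (z - x)))" by (rule bigO_mono) (auto simp: n_def)
    hence "bigO M (\<lambda>z. inverse (z - x) - monE 0 1 z - x * monE 0 2 z - x^2 * monE 0 3 z - r z)"
    proof (rule bigO_cong, use eventually_norm_ge[of "cmod x + 1"] in eventually_elim)
      case (elim z)
      have "cmod z > 0" using elim norm_ge_zero[of x] by linarith
      hence "z \<noteq> 0" "z \<noteq> x" using elim by auto
      from geom_rem[OF this, of n] have "inverse (z - x) - monE 0 1 z - x * monE 0 2 z - x^2 * monE 0 3 z - r z =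
          x ^ n * (monE 0 n z * inverse (z - x))"
        unfolding e by (simp add: monE_def algebra_simps)
      thus ?case by simp
    qed
    thus "\<exists>r\<in>Mon 4. bigO M (\<lambda>z. inverse (z - x) - monE 0 1 z - x * monE 0 2 z - x^2 * monE 0 3 z - r z)"
      using r by blast
  qed
  thus ?thesis unfolding exp3_def using Expan_monE[of 1 1 0 1] by (auto intro!: Expan_monE)
qed

lemma exp3_const: "exp3 0 (\<lambda>z. 1) (\<lambda>z. 1) (\<lambda>z. 0) (\<lambda>z. 0)"
  unfolding exp3_def using Expan_monE[of 0 0 0 1] by (auto simp: monE_def Expan_0)

lemma exp3_cong:
  assumes "exp3 m f f0 f1 f2" "\<And>z. f z = g z" "\<And>z. f0 z = g0 z" "\<And>z. f1 z = g1 z" "\<And>z. f2 z = g2 z" "m = n"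
  shows "exp3 n g g0 g1 g2"
proof -
  have "f = g" "f0 = g0" "f1 = g1" "f2 = g2" using assms by auto
  thus ?thesis using assms by simp
qed

lemma exp3_inverse_power: "exp3 (int b) (\<lambda>z. inverse (z - x) ^ b) (\<lambda>z. inverse z ^ b)
   (\<lambda>z. of_nat b * x * inverse z ^ (b + 1)) (\<lambda>z. of_nat b * of_nat (b + 1) / 2 * x^2 * inverse z ^ (b + 2))"
proof (induction b)
  case 0
  show ?case by (rule exp3_cong[OF exp3_const]) auto
next
  case (Suc b)
  have id: "Y ^ b * (x * Y^2) + of_nat b * x * Y ^ (b + 1) * Y ^ 1 = of_nat (Suc b) * x * Y ^ (Suc b + 1)"
    "Y ^ b * (x^2 * Y^3) + of_nat b * x * Y ^ (b + 1) * (x * Y^2) + of_nat b * of_nat (b + 1) / 2 * x^2 * Y ^ (b + 2) * Y ^ 1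
     = of_nat (Suc b) * of_nat (Suc b + 1) / 2 * x^2 * Y ^ (Suc b + 2)" for Y
    by (simp_all add: field_simps eval_nat_numeral)
  show ?case
    by (rule exp3_cong[OF exp3_mult[OF Suc.IH exp3_inverse[of x]]])
       (use id[of "inverse z" for z] in \<open>simp_all add: monE_def\<close>)
qed

lemma exp3_cnj: "exp3 (-1) (\<lambda>z. cnj (z - x)) cnj (\<lambda>z. - cnj x) (\<lambda>z. 0)"
  unfolding exp3_def using Expan_monE[of "-1" 0 1 1] Expan_monE[of 0 0 0 "- cnj x"] by (auto simp: monE_def Expan_0)

text \<open>The truncated subtractions \<open>a - 1\<close> and \<open>a - 2\<close> are harmless:
  where they truncate, the coefficient in front is 0.\<close>

lemma exp3_cnj_power: "exp3 (- int a) (\<lambda>z. cnj (z - x) ^ a) (\<lambda>z. cnj z ^ a)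
   (\<lambda>z. - of_nat a * cnj x * cnj z ^ (a - 1)) (\<lambda>z. of_nat a * (of_nat a - 1) / 2 * cnj x^2 * cnj z ^ (a - 2))"
proof (induction a)
  case 0
  show ?case by (rule exp3_cong[OF exp3_const]) auto
next
  case (Suc a)
  consider "a = 0" | "a = 1" | c where "a = Suc (Suc c)" by (metis One_nat_def not0_implies_Suc)
  thus ?case
    by cases (rule exp3_cong[OF exp3_mult[OF Suc.IH exp3_cnj[of x]]];
       auto simp: field_simps eval_nat_numeral)+
qed

lemma exp3_monE_shift: "exp3 (int b - int a) (\<lambda>z. monE a b (z - x)) (monE a b)
   (\<lambda>z. of_nat b * x * monE a (b+1) z - of_nat a * cnj x * monE (a - 1) b z)
   (\<lambda>z. of_nat b * of_nat (b + 1) / 2 * x^2 * monE a (b + 2) z - of_nat a * of_nat b * (x * cnj x) * monE (a-1) (b+1) z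
      + of_nat a * (of_nat a - 1) / 2 * cnj x^2 * monE (a-2) b z)"
  by (rule exp3_cong[OF exp3_mult[OF exp3_cnj_power[of a x] exp3_inverse_power[of b x]]])
     (auto simp: monE_def algebra_simps)

text \<open>The tail of the logarithmic series is compared with a geometric series of ratio at most
  1/2, whence the factor 2. The term of index 0 is \<open>1 / 0 = 0\<close>.\<close>

lemma Ln_rem:
  assumes "cmod w \<le> 1/2"
  shows "cmod (Ln (1 - w) + (\<Sum>i<Suc n. w ^ i / of_nat i)) \<le> 2 * cmod w ^ Suc n"
proof -
  let ?f = "\<lambda>i. - (w ^ i / of_nat i)"
  have s: "?f sums Ln (1 - w)" using Ln_series'[of "- w"] assms by simp
  have "(\<lambda>i. ?f (i + Suc n)) sums (Ln (1 - w) - (\<Sum>i<Suc n. ?f i))"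
    using s by (rule sums_split_initial_segment)
  moreover have g: "(\<lambda>i. cmod w ^ Suc n * cmod w ^ i) sums (cmod w ^ Suc n * (1 / (1 - cmod w)))"
    using assms by (intro sums_mult geometric_sums) auto
  ultimately have "cmod (Ln (1 - w) - (\<Sum>i<Suc n. ?f i)) \<le> cmod w ^ Suc n * (1 / (1 - cmod w))"
  proof (rule norm_sums_le)
    fix i
    have "cmod (?f (i + Suc n)) = cmod w ^ (i + Suc n) / real (i + Suc n)" by (simp add: norm_divide norm_power norm_mult del: of_nat_Suc of_nat_add)
    also have "\<dots> \<le> cmod w ^ (i + Suc n) / 1" by (intro divide_left_mono) auto
    finally show "cmod (?f (i + Suc n)) \<le> cmod w ^ Suc n * cmod w ^ i" by (simp add: power_add mult_ac)
  qed
  also have "\<dots> \<le> cmod w ^ Suc n * 2" using assms by (intro mult_left_mono) (auto simp: field_simps)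
  finally show ?thesis by (simp add: sum_negf algebra_simps)
qed

text \<open>Increments of the logarithm are expanded instead of the logarithm itself: far from the
  origin the real part of \<open>Ln (1 - x / z)\<close> is
  \<open>ln (cmod (z - x)) - ln (cmod z)\<close>, free of any choice of branch.\<close>

lemma Ln_RR: "(\<lambda>z. Ln (1 - x / z) + x * monE 0 1 z + x^2 / 2 * monE 0 2 z) \<in> Expan 3"
proof (rule Expan_I)
  fix M
  define n where "n = nat \<bar>M\<bar> + 3"
  define r where "r = (\<lambda>z. \<Sum>i\<in>{3..<Suc n}. - (x ^ i / of_nat i) * monE 0 i z)"
  have "finite A \<Longrightarrow> A \<subseteq> {3..} \<Longrightarrow> (\<lambda>z. \<Sum>i\<in>A. c i * monE 0 i z) \<in> Mon 3" for A c
    by (induction A rule: finite_induct) (auto intro!: Mon_0 Mon_add Mon_monE)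
  from this[of "{3..<Suc n}"] have r: "r \<in> Mon 3" unfolding r_def by fastforce
  have e: "(\<Sum>i<Suc n. (x / z) ^ i / of_nat i) = x * monE 0 1 z + x^2 / 2 * monE 0 2 z - r z" for z
  proof -
    have "(\<Sum>i<Suc n. (x / z) ^ i / of_nat i) = (\<Sum>i<3. (x / z) ^ i / of_nat i) + (\<Sum>i\<in>{3..<Suc n}. (x / z) ^ i / of_nat i)"
      unfolding lessThan_atLeast0 by (rule sum.atLeastLessThan_concat[symmetric]) (auto simp: n_def)
    also have "(\<Sum>i<3. (x / z) ^ i / of_nat i) = x * monE 0 1 z + x^2 / 2 * monE 0 2 z"
      by (simp add: monE_def eval_nat_numeral field_simps)
    also have "(\<Sum>i\<in>{3..<Suc n}. (x / z) ^ i / of_nat i) = - r z"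
      unfolding r_def sum_negf[symmetric]
      by (rule sum.cong) (auto simp: monE_def divide_inverse power_mult_distrib mult_ac)
    finally show ?thesis by simp
  qed
  have "bigO (int (Suc n)) (\<lambda>z. 2 * x ^ Suc n * monE 0 (Suc n) z)"
    by (intro bigO_cmult bigO_monE) auto
  hence "bigO M (\<lambda>z. 2 * x ^ Suc n * monE 0 (Suc n) z)" by (rule bigO_mono) (auto simp: n_def)
  hence "bigO M (\<lambda>z. Ln (1 - x / z) + x * monE 0 1 z + x^2 / 2 * monE 0 2 z - r z)"
  proof (rule bigO_cong, use eventually_norm_ge[of "2 * cmod x + 1"] in eventually_elim)
    case (elim z)
    have "cmod z > 0" using elim norm_ge_zero[of x] by linarith
    hence "z \<noteq> 0" by simp
    hence "cmod (x / z) \<le> 1 / 2" using elim by (simp add: norm_divide field_simps)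
    from Ln_rem[OF this, of n] show ?case
      unfolding e by (simp add: monE_def norm_mult norm_power norm_divide norm_inverse field_simps)
  qed
  thus "\<exists>r\<in>Mon 3. bigO M (\<lambda>z. Ln (1 - x / z) + x * monE 0 1 z + x^2 / 2 * monE 0 2 z - r z)" using r by blast
qed

context spherical_walk
begin

section \<open>Inverting the generator order by order\<close>

lemma lap_add: "lap (\<lambda>z. f z + g z) z = lap f z + lap g z"
  by (simp add: lap_def conv_def algebra_simps sum.distrib)
lemma lap_cmult: "lap (\<lambda>z. c * f z) z = c * lap f z"
  by (simp add: lap_def conv_def sum_distrib_left mult.left_commute)
lemma lap_diff: "lap (\<lambda>z. f z - g z) z = lap f z - lap g z"
  by (simp add: lap_def conv_def algebra_simps sum_subtractf)
lemma lap_0: "lap (\<lambda>z. 0) z = 0"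
  by (simp add: lap_def conv_def)
lemma cnj_kap: "cnj (kap x) = kap x" by (simp add: kap_def)
lemma Im_kap: "Im (kap x) = 0" by (simp add: kap_def)
lemma lap_cnj: "lap (\<lambda>z. cnj (f z)) z = cnj (lap f z)"
  by (simp add: lap_def conv_def cnj_kap)
lemma lap_Re: "lap (\<lambda>z. of_real (Re (f z))) z = of_real (Re (lap f z))"
  by (simp add: lap_def conv_def Im_kap complex_eq_iff)

text \<open>Summed against \<open>kap\<close>, the coefficients of the three-term expansion become
  moments of degree at most 2, and only the mixed one is not 0. The surviving term is what
  differentiating once in \<open>z\<close> and once in \<open>cnj z\<close> would give.\<close>

lemma lap_monE: "(\<lambda>z. lap (monE a b) z + of_nat a * of_nat b * of_real sig * monE (a-1) (b+1) z) \<in> Expan (int b - int a + 3)"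
proof -
  let ?f1 = "\<lambda>x z. of_nat b * x * monE a (b+1) z - of_nat a * cnj x * monE (a - 1) b z"
  let ?f2 = "\<lambda>x z. of_nat b * of_nat (b + 1) / 2 * x^2 * monE a (b + 2) z - of_nat a * of_nat b * (x * cnj x) * monE (a-1) (b+1) z
      + of_nat a * (of_nat a - 1) / 2 * cnj x^2 * monE (a-2) b z"
  have "(\<lambda>z. \<Sum>x\<in>X. kap x * (monE a b (z - x) - monE a b z - ?f1 x z - ?f2 x z)) \<in> Expan (int b - int a + 3)"
    using exp3_monE_shift[of b a] unfolding exp3_def by (intro Expan_sum Expan_cmult) blast
  also have "(\<lambda>z. \<Sum>x\<in>X. kap x * (monE a b (z - x) - monE a b z - ?f1 x z - ?f2 x z)) =
    (\<lambda>z. lap (monE a b) z - kmom 0 0 * monE a b z - (of_nat b * monE a (b+1) z * kmom 1 0 - of_nat a * monE (a - 1) b z * kmom 0 1)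
      - (of_nat b * of_nat (b + 1) / 2 * monE a (b + 2) z * kmom 2 0 - of_nat a * of_nat b * monE (a-1) (b+1) z * kmom 1 1
         + of_nat a * (of_nat a - 1) / 2 * monE (a-2) b z * kmom 0 2))"
    unfolding lap_def conv_def kmom_def
    by (simp add: fun_eq_iff sum_distrib_left sum_distrib_right sum_subtractf[symmetric] sum.distrib[symmetric])
       (auto intro!: sum.cong simp: algebra_simps)
  also have "\<dots> = (\<lambda>z. lap (monE a b) z + of_nat a * of_nat b * of_real sig * monE (a-1) (b+1) z)"
    by (simp add: kmom00 kmoms fun_eq_iff)
  finally show ?thesis .
qed

lemma lap_monE_RR: "lap (monE 0 m) \<in> Expan (int m + 3)"
  using lap_monE[of 0 m] by simp

text \<open>Up to higher order the monomial \<open>(a, b)\<close> has a multiple of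
  \<open>(a + 1, b - 1)\<close> as preimage. The bound \<open>m \<ge> 3\<close> forces
  \<open>b \<ge> 3\<close>, so the factor to be divided out is not 0 and the preimage still
  decays.\<close>

lemma lap_solve_step:
  assumes "f \<in> Mon m" "m \<ge> 3"
  shows "\<exists>G\<in>Mon (m - 2). (\<lambda>z. lap G z - f z) \<in> Expan (m + 1)"
  using assms
proof (induction rule: Mon.induct)
  case Mon_0
  show ?case by (rule bexI[OF _ Mon.Mon_0]) (simp add: lap_0 Expan_0)
next
  case (Mon_step f b a c)
  then obtain G where G: "G \<in> Mon (m - 2)" "(\<lambda>z. lap G z - f z) \<in> Expan (m + 1)" by blast
  obtain b' where b: "b = Suc b'" using Mon_step by (cases b) auto
  define k where "k = - c / (of_nat (a+1) * of_nat b' * of_real sig)"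
  have nz: "of_nat (a+1) * of_nat b' * complex_of_real sig \<noteq> 0"
    using Mon_step sig_pos b by (auto simp del: of_nat_Suc of_nat_add)
  have r: "(\<lambda>z. k * (lap (monE (a+1) b') z + of_nat (a+1) * of_nat b' * of_real sig * monE a b z)) \<in> Expan (m+1)"
    using lap_monE[of "a+1" b'] Mon_step b by (intro Expan_cmult) (auto elim!: Expan_mono)
  have e: "k * (of_nat (a+1) * of_nat b' * of_real sig * y) = - (c * y)" for y
    using nz by (simp add: k_def del: of_nat_Suc of_nat_add)
  have "(\<lambda>z. (lap G z - f z) + k * (lap (monE (a+1) b') z + of_nat (a+1) * of_nat b' * of_real sig * monE a b z)) \<in> Expan (m+1)"
    by (intro Expan_add G r)
  hence "(\<lambda>z. lap (\<lambda>z. G z + k * monE (a+1) b' z) z - (f z + c * monE a b z)) \<in> Expan (m+1)"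
    unfolding lap_add lap_cmult distrib_left[of k] e by (simp add: algebra_simps)
  moreover have "(\<lambda>z. G z + k * monE (a+1) b' z) \<in> Mon (m - 2)"
    using Mon_step b by (intro Mon.Mon_step G) auto
  ultimately show ?case by blast
qed

text \<open>Each round replaces the error by one of the next order; the induction is on the number
  of rounds missing to reach \<open>M\<close>.\<close>

lemma lap_solve:
  assumes "f \<in> Expan m" "m \<ge> 3"
  shows "\<exists>G\<in>Mon (m - 2). bigO M (\<lambda>z. lap G z - f z)"
  using assms
proof (induction "nat (M - m)" arbitrary: m f)
  case 0
  have "bigO m f" using 0 by (simp add: Expan_bO)
  hence "bigO M f" by (rule bigO_mono) (use 0 in auto)
  hence "bigO M (\<lambda>z. lap (\<lambda>_. 0) z - f z)" using bigO_cmult[of M f "-1"] by (simp add: lap_0)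
  thus ?case using Mon.Mon_0 by blast
next
  case (Suc k)
  obtain r where r: "r \<in> Mon m" "bigO M (\<lambda>z. f z - r z)" using Expan_D[OF Suc.prems(1)] by blast
  obtain G where G: "G \<in> Mon (m - 2)" "(\<lambda>z. lap G z - r z) \<in> Expan (m + 1)"
    using lap_solve_step[OF r(1) Suc.prems(2)] by blast
  have k: "k = nat (M - (m + 1))" using Suc.hyps(2) by linarith
  obtain H where H: "H \<in> Mon (m + 1 - 2)" "bigO M (\<lambda>z. lap H z - (lap G z - r z))"
    using Suc.hyps(1)[OF k G(2)] Suc.prems by auto
  have "bigO M (\<lambda>z. - 1 * ((lap H z - (lap G z - r z)) + (f z - r z)))"
    by (intro bigO_cmult bigO_add H r)
  moreover have "(\<lambda>z. - 1 * ((lap H z - (lap G z - r z)) + (f z - r z))) = (\<lambda>z. lap (\<lambda>z. G z - H z) z - f z)"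
    by (simp add: lap_diff fun_eq_iff)
  moreover have "(\<lambda>z. G z - H z) \<in> Mon (m - 2)"
    using G H by (intro Mon_diff) (auto elim: Mon_mono)
  ultimately show ?case by metis
qed

text \<open>For \<open>a = 0\<close> the main term of \<open>lap_monE\<close> disappears, so the
  error starts at order \<open>m + 3\<close> and the correction at order \<open>m + 1\<close>: the
  leading term \<open>1 / z ^ m\<close> stays intact.\<close>

lemma ex_harmonic_monE: "\<exists>G\<in>Mon (int m + 1). bigO M (lap (\<lambda>z. monE 0 m z - G z))"
proof -
  obtain G where G: "G \<in> Mon (int m + 3 - 2)" "bigO M (\<lambda>z. lap G z - lap (monE 0 m) z)"
    using lap_solve[OF lap_monE_RR, of m M] by auto
  have "(\<lambda>z. -1 * (lap G z - lap (monE 0 m) z)) = lap (\<lambda>z. monE 0 m z - G z)"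
    by (simp add: lap_diff fun_eq_iff)
  with bigO_cmult[OF G(2), of "-1"] have "bigO M (lap (\<lambda>z. monE 0 m z - G z))" by simp
  thus ?thesis using G by (intro bexI[of _ G]) (auto simp: add.commute)
qed

text \<open>As \<open>kap\<close> is real with total mass 0, \<open>ln (cmod z)\<close> may be
  subtracted inside the sum, and \<open>lap\<close> of the logarithm becomes the real part of
  \<open>F\<close>. The vanishing of the means of \<open>x\<close> and \<open>x ^ 2\<close> removes
  orders 1 and 2 of \<open>F\<close>.\<close>

lemma ex_harmonic_ln: "\<exists>G\<in>Mon 1. bigO M (lap (\<lambda>z. of_real (ln (cmod z)) - of_real (Re (G z))))"
proof -
  define F where "F = (\<lambda>z. \<Sum>x\<in>X. kap x * Ln (1 - x / z))"
  have "(\<lambda>z. \<Sum>x\<in>X. kap x * (Ln (1 - x / z) + x * monE 0 1 z + x^2 / 2 * monE 0 2 z)) \<in> Expan 3"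
    by (intro Expan_sum Expan_cmult Ln_RR)
  also have "(\<lambda>z. \<Sum>x\<in>X. kap x * (Ln (1 - x / z) + x * monE 0 1 z + x^2 / 2 * monE 0 2 z)) =
      (\<lambda>z. F z + kmom 1 0 * monE 0 1 z + kmom 2 0 / 2 * monE 0 2 z)"
    unfolding F_def kmom_def
    by (simp add: fun_eq_iff sum_distrib_left sum_distrib_right sum_divide_distrib sum.distrib[symmetric])
       (auto intro!: sum.cong simp: algebra_simps)
  finally have F: "F \<in> Expan 3" by (simp add: kmoms)
  obtain B where B: "\<And>x. x \<in> X \<Longrightarrow> cmod x \<le> B" using finite_imp_bounded[OF finite_X] by (auto simp: bounded_iff)
  have lnF: "\<forall>\<^sub>F z in at_infinity. lap (\<lambda>z. of_real (ln (cmod z))) z = of_real (Re (F z))"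
    using eventually_norm_ge[of "B + 1"]
  proof eventually_elim
    case (elim z)
    have z: "cmod z > 0" using elim order_trans[OF norm_ge_zero B[OF X_0]] by linarith
    have "lap (\<lambda>z. of_real (ln (cmod z))) z = (\<Sum>x\<in>X. kap x * of_real (ln (cmod (z - x)))) - kmom 0 0 * of_real (ln (cmod z))"
      by (simp add: lap_def conv_def kmom00)
    also have "\<dots> = (\<Sum>x\<in>X. kap x * of_real (ln (cmod (z - x)) - ln (cmod z)))"
      by (simp add: kmom_def sum_distrib_right sum_subtractf right_diff_distrib)
    also have "\<dots> = (\<Sum>x\<in>X. of_real (Re (kap x * Ln (1 - x / z))))"
    proof (rule sum.cong[OF refl])
      fix x assume x: "x \<in> X"
      have nz: "1 - x / z \<noteq> 0" using B[OF x] elim z by (auto simp: field_simps)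
      have "z - x = (1 - x / z) * z" using z by (auto simp: field_simps)
      hence "cmod (z - x) = cmod (1 - x / z) * cmod z" by (metis norm_mult)
      hence "ln (cmod (z - x)) - ln (cmod z) = Re (Ln (1 - x / z))"
        using nz z by (simp add: ln_mult)
      thus "kap x * of_real (ln (cmod (z - x)) - ln (cmod z)) = of_real (Re (kap x * Ln (1 - x / z)))"
        by (simp add: complex_eq_iff Im_kap)
    qed
    finally show ?case by (simp add: F_def)
  qed
  obtain G where G: "G \<in> Mon (3 - 2)" "bigO M (\<lambda>z. lap G z - F z)" using lap_solve[OF F, of M] by auto
  have "bigO M (\<lambda>z. - 1 * of_real (Re (lap G z - F z)))" by (intro bigO_cmult bigO_Re G)
  hence "bigO M (lap (\<lambda>z. of_real (ln (cmod z)) - of_real (Re (G z))))"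
  proof (rule bigO_cong, use lnF in eventually_elim)
    case (elim z)
    have "lap (\<lambda>z. of_real (ln (cmod z)) - of_real (Re (G z))) z = of_real (Re (F z) - Re (lap G z))"
      by (subst lap_diff) (simp add: elim lap_Re)
    thus ?case by (simp only: norm_of_real norm_mult) (simp add: abs_minus_commute flip: of_real_diff)
  qed
  thus ?thesis using G by auto
qed

end

section \<open>Orders of vanishing and oscillatory integrals\<close>

definition punctured :: "real set" where "punctured = {t. t \<noteq> 0 \<and> \<bar>t\<bar> \<le> pi}"

text \<open>The growth bound is asked for on one period only, since
  \<open>\<bar>s\<bar> + \<bar>t\<bar>\<close> is not periodic; periodicity in \<open>s\<close> is
  there to cancel the boundary terms of integrations by parts.\<close>

definition ord0 :: "int \<Rightarrow> (real \<Rightarrow> real \<Rightarrow> complex) \<Rightarrow> bool" where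
  "ord0 N F \<longleftrightarrow> (\<forall>t\<in>punctured. continuous_on UNIV (\<lambda>s. F s t)) \<and> (\<forall>t\<in>punctured. \<forall>s. F (s + 2 * pi) t = F s t) \<and>
     (\<exists>C\<ge>0. \<forall>t\<in>punctured. \<forall>s. \<bar>s\<bar> \<le> pi \<longrightarrow> cmod (F s t) \<le> C * (\<bar>s\<bar> + \<bar>t\<bar>) powi N)"

text \<open>\<open>N\<close> may be negative, for functions of \<open>(s, t)\<close> that are singular at the origin; since \<open>t = 0\<close> is
  excluded, they are still smooth and periodic in \<open>s\<close> for each fixed \<open>t\<close>, and only derivatives in
  \<open>s\<close> are needed.\<close>

fun ord :: "nat \<Rightarrow> int \<Rightarrow> (real \<Rightarrow> real \<Rightarrow> complex) \<Rightarrow> bool" where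
  "ord 0 N F \<longleftrightarrow> ord0 N F"
| "ord (Suc K) N F \<longleftrightarrow> ord0 N F \<and>
     (\<exists>F'. (\<forall>t\<in>punctured. \<forall>s. ((\<lambda>s. F s t) has_vector_derivative F' s t) (at s)) \<and> ord K (N - 1) F')"

lemma ord_imp_ord0: "ord K N F \<Longrightarrow> ord0 N F"
  by (cases K) auto

lemma ord_SucI:
  assumes "ord0 N F" "\<forall>t\<in>punctured. \<forall>s. ((\<lambda>s. F s t) has_vector_derivative F' s t) (at s)" "ord K (N - 1) F'"
  shows "ord (Suc K) N F"
  using assms unfolding ord.simps by blast

lemma ord_SucE:
  assumes "ord (Suc K) N F"
  obtains F' where "ord0 N F" "\<forall>t\<in>punctured. \<forall>s. ((\<lambda>s. F s t) has_vector_derivative F' s t) (at s)" "ord K (N - 1) F'"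
  using assms unfolding ord.simps by blast

lemma ord_SucD: "ord (Suc K) N F \<Longrightarrow> ord K N F"
proof (induction K arbitrary: N F)
  case (Suc K)
  show ?case using Suc.prems by (rule ord_SucE) (rule ord_SucI, assumption, assumption, rule Suc.IH)
qed simp

lemma ord0_add:
  assumes "ord0 N F" "ord0 N G" shows "ord0 N (\<lambda>s t. F s t + G s t)"
proof -
  from assms obtain C D where CD: "C \<ge> 0" "D \<ge> 0" "\<And>t s. t \<in> punctured \<Longrightarrow> \<bar>s\<bar> \<le> pi \<Longrightarrow> cmod (F s t) \<le> C * (\<bar>s\<bar> + \<bar>t\<bar>) powi N"
    "\<And>t s. t \<in> punctured \<Longrightarrow> \<bar>s\<bar> \<le> pi \<Longrightarrow> cmod (G s t) \<le> D * (\<bar>s\<bar> + \<bar>t\<bar>) powi N" unfolding ord0_def by metis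
  hence "\<forall>t\<in>punctured. \<forall>s. \<bar>s\<bar> \<le> pi \<longrightarrow> cmod (F s t + G s t) \<le> (C + D) * (\<bar>s\<bar> + \<bar>t\<bar>) powi N"
    by (auto simp: distrib_right intro!: norm_triangle_mono)
  with CD(1,2) have "\<exists>C\<ge>0. \<forall>t\<in>punctured. \<forall>s. \<bar>s\<bar> \<le> pi \<longrightarrow> cmod (F s t + G s t) \<le> C * (\<bar>s\<bar> + \<bar>t\<bar>) powi N"
    by (intro exI[of _ "C + D"]) auto
  thus ?thesis using assms unfolding ord0_def by (auto intro: continuous_on_add)
qed

lemma ord0_mult:
  assumes "ord0 N F" "ord0 M G" shows "ord0 (N + M) (\<lambda>s t. F s t * G s t)"
proof -
  from assms obtain C D where CD: "C \<ge> 0" "D \<ge> 0" "\<And>t s. t \<in> punctured \<Longrightarrow> \<bar>s\<bar> \<le> pi \<Longrightarrow> cmod (F s t) \<le> C * (\<bar>s\<bar> + \<bar>t\<bar>) powi N"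
    "\<And>t s. t \<in> punctured \<Longrightarrow> \<bar>s\<bar> \<le> pi \<Longrightarrow> cmod (G s t) \<le> D * (\<bar>s\<bar> + \<bar>t\<bar>) powi M" unfolding ord0_def by metis
  have "cmod (F s t * G s t) \<le> (C * D) * (\<bar>s\<bar> + \<bar>t\<bar>) powi (N + M)" if "t \<in> punctured" "\<bar>s\<bar> \<le> pi" for s t
  proof -
    have "cmod (F s t * G s t) \<le> (C * (\<bar>s\<bar> + \<bar>t\<bar>) powi N) * (D * (\<bar>s\<bar> + \<bar>t\<bar>) powi M)"
      unfolding norm_mult using CD that by (intro mult_mono) auto
    also have "\<dots> = (C * D) * (\<bar>s\<bar> + \<bar>t\<bar>) powi (N + M)"
      using that by (subst power_int_add) (auto simp: punctured_def)
    finally show ?thesis .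
  qed
  with CD(1,2) have "\<exists>C\<ge>0. \<forall>t\<in>punctured. \<forall>s. \<bar>s\<bar> \<le> pi \<longrightarrow> cmod (F s t * G s t) \<le> C * (\<bar>s\<bar> + \<bar>t\<bar>) powi (N + M)"
    by (intro exI[of _ "C * D"]) auto
  thus ?thesis using assms unfolding ord0_def by (auto intro: continuous_on_mult)
qed

lemma ord_add: "ord K N F \<Longrightarrow> ord K N G \<Longrightarrow> ord K N (\<lambda>s t. F s t + G s t)"
proof (induction K arbitrary: N F G)
  case 0
  thus ?case by (simp add: ord0_add)
next
  case (Suc K)
  then obtain F' G' where *: "\<forall>t\<in>punctured. \<forall>s. ((\<lambda>s. F s t) has_vector_derivative F' s t) (at s)" "ord K (N - 1) F'"
     "\<forall>t\<in>punctured. \<forall>s. ((\<lambda>s. G s t) has_vector_derivative G' s t) (at s)" "ord K (N - 1) G'" by auto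
  have "\<forall>t\<in>punctured. \<forall>s. ((\<lambda>s. F s t + G s t) has_vector_derivative F' s t + G' s t) (at s)"
    using * by (auto intro: has_vector_derivative_add)
  thus ?case using Suc.IH[OF *(2,4)] Suc.prems by (intro ord_SucI) (auto intro: ord0_add)
qed

lemma ord_mult: "ord K N F \<Longrightarrow> ord K M G \<Longrightarrow> ord K (N + M) (\<lambda>s t. F s t * G s t)"
proof (induction K arbitrary: N M F G)
  case 0
  thus ?case by (simp add: ord0_mult)
next
  case (Suc K)
  then obtain F' G' where *: "\<forall>t\<in>punctured. \<forall>s. ((\<lambda>s. F s t) has_vector_derivative F' s t) (at s)" "ord K (N - 1) F'"
     "\<forall>t\<in>punctured. \<forall>s. ((\<lambda>s. G s t) has_vector_derivative G' s t) (at s)" "ord K (M - 1) G'" by auto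
  have "\<forall>t\<in>punctured. \<forall>s. ((\<lambda>s. F s t * G s t) has_vector_derivative F s t * G' s t + F' s t * G s t) (at s)"
    using * by (auto intro: has_vector_derivative_mult)
  moreover have "ord K (N + M - 1) (\<lambda>s t. F s t * G' s t + F' s t * G s t)"
    using Suc.IH[OF ord_SucD[OF Suc.prems(1)] *(4)] Suc.IH[OF *(2) ord_SucD[OF Suc.prems(2)]]
    by (intro ord_add) (simp_all add: algebra_simps)
  ultimately show ?case using Suc.prems by (intro ord_SucI) (auto intro: ord0_mult)
qed

lemma ord_const: "ord K 0 (\<lambda>s t. c)"
proof -
  have c: "ord0 N (\<lambda>s t. 0)" for N unfolding ord0_def by (auto intro!: exI[of _ 0])
  have z: "ord K N (\<lambda>s t. 0)" for K N
    by (induction K arbitrary: N) (auto simp: c intro!: exI[of _ "\<lambda>s t. 0"])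
  have "ord0 0 (\<lambda>s t. c)" unfolding ord0_def by (auto intro!: exI[of _ "cmod c"])
  thus ?thesis using z by (cases K) (auto intro!: ord_SucI[of _ _ "\<lambda>s t. 0"] simp del: ord.simps(2))
qed

lemma ord_cmult: "ord K N F \<Longrightarrow> ord K N (\<lambda>s t. c * F s t)"
  using ord_mult[OF ord_const[of K c], of N F] by simp

text \<open>The derivative \<open>- D' / D ^ 2\<close> has order 1 - 2 - 2 = -3, so differentiating
  the inverse again costs exactly one order and the induction closes.\<close>

lemma ord_inverse:
  assumes "c > 0" "\<And>s t. t \<in> punctured \<Longrightarrow> \<bar>s\<bar> \<le> pi \<Longrightarrow> c * (\<bar>s\<bar> + \<bar>t\<bar>)^2 \<le> cmod (D s t)"
    and nz: "\<And>s t. t \<in> punctured \<Longrightarrow> D s t \<noteq> 0"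
  shows "ord K 2 D \<Longrightarrow> ord K (-2) (\<lambda>s t. inverse (D s t))"
proof -
  have base: "ord0 (-2) (\<lambda>s t. inverse (D s t))" if "ord0 2 D"
  proof -
    have "cmod (inverse (D s t)) \<le> inverse c * (\<bar>s\<bar> + \<bar>t\<bar>) powi (-2)" if t: "t \<in> punctured" "\<bar>s\<bar> \<le> pi" for s t
    proof -
      have p: "c * (\<bar>s\<bar> + \<bar>t\<bar>)^2 > 0" using t assms(1) by (auto simp: punctured_def intro!: mult_pos_pos zero_less_power)
      have "inverse (cmod (D s t)) \<le> inverse (c * (\<bar>s\<bar> + \<bar>t\<bar>)^2)" by (rule le_imp_inverse_le[OF assms(2)[OF t] p])
      thus ?thesis by (simp add: norm_inverse power_int_minus)
    qed
    hence "\<exists>C\<ge>0. \<forall>t\<in>punctured. \<forall>s. \<bar>s\<bar> \<le> pi \<longrightarrow> cmod (inverse (D s t)) \<le> C * (\<bar>s\<bar> + \<bar>t\<bar>) powi (-2)"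
      using assms(1) by (intro exI[of _ "inverse c"]) auto
    thus ?thesis using that nz unfolding ord0_def by (auto intro!: continuous_on_inverse)
  qed
  show "ord K 2 D \<Longrightarrow> ord K (-2) (\<lambda>s t. inverse (D s t))"
  proof (induction K)
    case 0
    thus ?case by (simp add: base)
  next
    case (Suc K)
    then obtain D' where D': "\<forall>t\<in>punctured. \<forall>s. ((\<lambda>s. D s t) has_vector_derivative D' s t) (at s)" "ord K 1 D'" by auto
    have I: "ord K (-2) (\<lambda>s t. inverse (D s t))" using Suc ord_SucD by blast
    have "ord K (1 + (-2 + -2)) (\<lambda>s t. D' s t * (inverse (D s t) * inverse (D s t)))"
      by (intro ord_mult D' I)
    from ord_cmult[OF this, of "-1"] have "ord K (-2-1) (\<lambda>s t. - (D' s t * (inverse (D s t) * inverse (D s t))))" by simp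
    moreover have "\<forall>t\<in>punctured. \<forall>s. ((\<lambda>s. inverse (D s t)) has_vector_derivative - (D' s t * (inverse (D s t) * inverse (D s t)))) (at s)"
    proof (intro ballI allI)
      fix t s assume t: "t \<in> punctured"
      have "((\<lambda>x. inverse x) has_field_derivative - (inverse (D s t) * 1 * inverse (D s t))) (at (D s t))"
        by (rule DERIV_inverse'[OF DERIV_ident nz[OF t]])
      from field_vector_diff_chain_at[where f = "\<lambda>s. D s t", OF _ this] D'(1) t
      have "((\<lambda>x. inverse x) \<circ> (\<lambda>s. D s t) has_vector_derivative D' s t * - (inverse (D s t) * 1 * inverse (D s t))) (at s)" by blast
      thus "((\<lambda>s. inverse (D s t)) has_vector_derivative - (D' s t * (inverse (D s t) * inverse (D s t)))) (at s)"
        by (simp add: o_def algebra_simps)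
    qed
    ultimately show ?case using Suc.prems by (intro ord_SucI base) auto
  qed
qed

section \<open>Integration by parts over a period\<close>

lemma set_int_cont: "continuous_on UNIV (f :: real \<Rightarrow> complex) \<Longrightarrow> set_integrable lborel {-pi..pi} f"
  unfolding set_integrable_def by (rule borel_integrable_compact) (auto intro: continuous_on_subset)

lemma cis_shift: "cis (x + 2 * pi * of_int m) = cis x"
  by (simp add: complex_eq_iff cos_add sin_add)

text \<open>The two boundary terms are equal because \<open>F\<close> is periodic and
  \<open>m\<close> is an integer.\<close>

lemma osc_by_parts:
  fixes F :: "real \<Rightarrow> complex" and m :: int
  assumes d: "\<And>s. (F has_vector_derivative F' s) (at s)" and c: "continuous_on UNIV F'"
    and per: "\<And>s. F (s + 2 * pi) = F s" and m: "m \<noteq> 0"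
  shows "(LBINT s:{-pi..pi}. F s * cis (- (of_int m * s))) = (LBINT s:{-pi..pi}. F' s * cis (- (of_int m * s))) / (\<i> * of_int m)"
proof -
  let ?e = "\<lambda>s. cis (- (of_int m * s))"
  have cF: "continuous_on UNIV F"
    using d by (intro continuous_at_imp_continuous_on) (auto intro: has_vector_derivative_continuous)
  have ce: "continuous_on UNIV ?e" by (intro continuous_intros)
  have de: "(?e has_vector_derivative (- \<i> * of_int m * ?e s)) (at s)" for s
  proof -
    have "((\<lambda>z. exp (- (\<i> * of_int m) * z)) has_field_derivative exp (- (\<i> * of_int m) * of_real s) * - (\<i> * of_int m)) (at (of_real s))"
      by (auto intro!: derivative_eq_intros)
    from has_vector_derivative_real_field[OF this] show ?thesis
      by (simp add: cis_conv_exp algebra_simps)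
  qed
  have i1: "set_integrable lborel {-pi..pi} (\<lambda>s. F' s * ?e s)" and i2: "set_integrable lborel {-pi..pi} (\<lambda>s. F s * ?e s)"
    by (intro set_int_cont continuous_intros c cF ce)+
  have "((\<lambda>s. F s * ?e s) has_vector_derivative (F' s * ?e s - \<i> * of_int m * (F s * ?e s))) (at s)" for s
    using has_vector_derivative_mult[OF d[of s] de[of s]] by (simp add: algebra_simps)
  hence "(LBINT s:{-pi..pi}. (F' s * ?e s - \<i> * of_int m * (F s * ?e s))) = F pi * ?e pi - F (-pi) * ?e (-pi)"
    unfolding set_lebesgue_integral_def
    by (intro integral_FTC_Icc[where F = "\<lambda>s. F s * ?e s"] continuous_intros continuous_on_subset[OF c] continuous_on_subset[OF cF])
       (auto intro: has_vector_derivative_at_within)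
  also have "F pi = F (-pi)" using per[of "-pi"] by simp
  also have "?e pi = ?e (-pi)" using cis_shift[of "- (of_int m * pi)" m] by (simp add: algebra_simps)
  finally have "(LBINT s:{-pi..pi}. F' s * ?e s) - \<i> * of_int m * (LBINT s:{-pi..pi}. F s * ?e s) = 0"
    using i1 i2 by (subst set_integral_mult_right[symmetric], subst set_integral_diff(2)[symmetric]) auto
  thus ?thesis using m by (simp add: nonzero_eq_divide_eq mult_ac)
qed

text \<open>Every integration by parts gains a factor \<open>1 / \<bar>m\<bar>\<close> and costs one
  order at the origin.\<close>

lemma ord_osc:
  assumes "ord K N F"
  shows "\<exists>C\<ge>0. \<forall>t\<in>punctured. \<forall>m::int. m \<noteq> 0 \<longrightarrow>
     cmod (LBINT s:{-pi..pi}. F s t * cis (- (of_int m * s))) \<le> C * (LBINT s:{-pi..pi}. (\<bar>s\<bar> + \<bar>t\<bar>) powi (N - int K)) / \<bar>of_int m\<bar> ^ K"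
  using assms
proof (induction K arbitrary: N F)
  case 0
  then obtain C where C: "C \<ge> 0" "\<And>t s. t \<in> punctured \<Longrightarrow> \<bar>s\<bar> \<le> pi \<Longrightarrow> cmod (F s t) \<le> C * (\<bar>s\<bar> + \<bar>t\<bar>) powi N"
    and cF: "\<And>t. t \<in> punctured \<Longrightarrow> continuous_on UNIV (\<lambda>s. F s t)" unfolding ord.simps ord0_def by metis
  have "cmod (LBINT s:{-pi..pi}. F s t * cis (- (of_int m * s))) \<le> C * (LBINT s:{-pi..pi}. (\<bar>s\<bar> + \<bar>t\<bar>) powi N)"
    if t: "t \<in> punctured" for t and m :: int
  proof -
    have "cmod (LBINT s:{-pi..pi}. F s t * cis (- (of_int m * s))) \<le> (LBINT s:{-pi..pi}. cmod (F s t * cis (- (of_int m * s))))"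
      by (rule set_integral_norm_bound) (intro set_int_cont continuous_intros cF t)
    also have "\<dots> \<le> (LBINT s:{-pi..pi}. C * (\<bar>s\<bar> + \<bar>t\<bar>) powi N)"
    proof (rule set_integral_mono)
      show "set_integrable lborel {-pi..pi} (\<lambda>s. cmod (F s t * cis (- (of_int m * s))))"
        by (rule set_integrable_norm) (intro set_int_cont continuous_intros cF t)
      show "set_integrable lborel {-pi..pi} (\<lambda>s. C * (\<bar>s\<bar> + \<bar>t\<bar>) powi N)"
        unfolding set_integrable_def using t
        by (intro borel_integrable_compact continuous_intros) (auto simp: punctured_def)
    qed (use C(2)[OF t] in \<open>auto simp: norm_mult\<close>)
    finally show ?thesis by simp
  qed
  thus ?case using C(1) by (intro exI[of _ C]) auto
next
  case (Suc K)
  then obtain F' where F': "\<forall>t\<in>punctured. \<forall>s. ((\<lambda>s. F s t) has_vector_derivative F' s t) (at s)" "ord K (N - 1) F'" by auto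
  from Suc.IH[OF F'(2)] obtain C where C: "C \<ge> 0" and C2: "\<forall>t\<in>punctured. \<forall>m::int. m \<noteq> 0 \<longrightarrow>
     cmod (LBINT s:{-pi..pi}. F' s t * cis (- (of_int m * s))) \<le> C * (LBINT s:{-pi..pi}. (\<bar>s\<bar> + \<bar>t\<bar>) powi (N - 1 - int K)) / \<bar>of_int m\<bar> ^ K"
    by (elim exE conjE)
  have "ord0 N F" "ord0 (N-1) F'" using Suc.prems F' ord_imp_ord0 by auto
  hence per: "\<And>t s. t \<in> punctured \<Longrightarrow> F (s + 2 * pi) t = F s t" and c: "\<And>t. t \<in> punctured \<Longrightarrow> continuous_on UNIV (\<lambda>s. F' s t)"
    unfolding ord0_def by auto
  show ?case
  proof (intro exI[of _ C] conjI C ballI allI impI)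
    fix t and m :: int assume t: "t \<in> punctured" and m: "m \<noteq> 0"
    have "cmod (LBINT s:{-pi..pi}. F s t * cis (- (of_int m * s))) = cmod (LBINT s:{-pi..pi}. F' s t * cis (- (of_int m * s))) / \<bar>of_int m\<bar>"
      using F'(1) t by (subst osc_by_parts[where F' = "\<lambda>s. F' s t" and F = "\<lambda>s. F s t", OF _ c[OF t] per[OF t] m]) (auto simp: norm_divide norm_mult)
    also have "\<dots> \<le> (C * (LBINT s:{-pi..pi}. (\<bar>s\<bar> + \<bar>t\<bar>) powi (N - 1 - int K)) / \<bar>of_int m\<bar> ^ K) / \<bar>of_int m\<bar>"
      using C2[rule_format, OF t m] by (intro divide_right_mono) auto
    finally show "cmod (LBINT s:{-pi..pi}. F s t * cis (- (of_int m * s))) \<le> C * (LBINT s:{-pi..pi}. (\<bar>s\<bar> + \<bar>t\<bar>) powi (N - int (Suc K))) / \<bar>of_int m\<bar> ^ Suc K"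
      by (simp add: algebra_simps)
  qed
qed

section \<open>Integrable majorants near the singularity\<close>

lemma set_integrable_abs_powr:
  assumes "a > -1"
  shows "set_integrable lborel {-pi..pi} (\<lambda>s. \<bar>s\<bar> powr a)"
proof -
  have "(\<lambda>s. s powr a) integrable_on {0..pi}" using assms by (intro integrable_on_powr_from_0) auto
  hence "(\<lambda>s. s powr a) absolutely_integrable_on {0..pi}" by (intro nonnegative_absolutely_integrable_1) auto
  hence i: "integrable lborel (\<lambda>s. indicator {0..pi} s * s powr a)"
    unfolding set_integrable_def by (subst (asm) integrable_completion) auto
  have "integrable lborel (\<lambda>s. indicator {0..pi} (0 + (-1) * s) * (0 + (-1) * s) powr a)"
    using lborel_integrable_real_affine[OF i, of "-1" 0] by simp
  from Bochner_Integration.integrable_add[OF i this]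
  have "integrable lborel (\<lambda>s. indicator {0..pi} s * s powr a + indicator {0..pi} (- s) * (- s) powr a)" by simp
  also have "(\<lambda>s. indicator {0..pi} s * s powr a + indicator {0..pi} (- s) * (- s) powr a) = (\<lambda>s. indicator {-pi..pi} s *\<^sub>R \<bar>s\<bar> powr a)"
    by (auto simp: fun_eq_iff indicator_def)
  finally show ?thesis unfolding set_integrable_def .
qed

text \<open>The inequality of arithmetic and geometric means separates the variables, so that the
  two integrations can be carried out independently.\<close>

lemma rho_inv_le: "s \<noteq> 0 \<Longrightarrow> t \<noteq> 0 \<Longrightarrow> inverse (\<bar>s\<bar> + \<bar>t\<bar>) \<le> \<bar>s\<bar> powr (-1/2) * \<bar>t\<bar> powr (-1/2)" for s t :: real
proof -
  assume "s \<noteq> 0" "t \<noteq> 0"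
  hence p: "\<bar>s\<bar> > 0" "\<bar>t\<bar> > 0" by auto
  have "sqrt \<bar>s\<bar> * sqrt \<bar>t\<bar> \<le> (\<bar>s\<bar> + \<bar>t\<bar>) / 2" using arith_geo_mean_sqrt[of "\<bar>s\<bar>" "\<bar>t\<bar>"] by (simp add: real_sqrt_mult)
  moreover have "(\<bar>s\<bar> + \<bar>t\<bar>) / 2 \<le> \<bar>s\<bar> + \<bar>t\<bar>" by simp
  ultimately have "sqrt \<bar>s\<bar> * sqrt \<bar>t\<bar> \<le> \<bar>s\<bar> + \<bar>t\<bar>" by (rule order_trans)
  hence "inverse (\<bar>s\<bar> + \<bar>t\<bar>) \<le> inverse (sqrt \<bar>s\<bar> * sqrt \<bar>t\<bar>)" using p by (intro le_imp_inverse_le) auto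
  thus ?thesis using p by (simp add: powr_minus powr_half_sqrt)
qed

text \<open>The first bound is integrable in \<open>t\<close> near 0, the second is not; this is why
  the two are interpolated later instead of using the stronger oscillatory gain alone.\<close>

lemma int_rho:
  obtains A where "A \<ge> 0" "\<And>t. t \<in> punctured \<Longrightarrow> (LBINT s:{-pi..pi}. (\<bar>s\<bar> + \<bar>t\<bar>) powi (-1)) \<le> A * \<bar>t\<bar> powr (-1/2)"
    "\<And>t. t \<in> punctured \<Longrightarrow> (LBINT s:{-pi..pi}. (\<bar>s\<bar> + \<bar>t\<bar>) powi (-2)) \<le> A * \<bar>t\<bar> powr (-3/2)"
proof
  define A where "A = (LBINT s:{-pi..pi}. \<bar>s\<bar> powr (-1/2))"
  show "A \<ge> 0" unfolding A_def set_lebesgue_integral_def by (rule integral_nonneg_AE) auto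
  have si: "set_integrable lborel {-pi..pi} (\<lambda>s. \<bar>s\<bar> powr (-1/2) * x)" for x
    using set_integrable_abs_powr[of "-1/2"] by simp
  have ae: "AE s in lborel. s \<noteq> (0::real)" by (rule AE_lborel_singleton)
  have ci: "set_integrable lborel {-pi..pi} (\<lambda>s. (\<bar>s\<bar> + \<bar>t\<bar>) powi N)" if "t \<in> punctured" for t N
    unfolding set_integrable_def using that by (intro borel_integrable_compact continuous_intros) (auto simp: punctured_def)
  fix t assume t: "t \<in> punctured"
  have "(LBINT s:{-pi..pi}. (\<bar>s\<bar> + \<bar>t\<bar>) powi (-1)) \<le> (LBINT s:{-pi..pi}. \<bar>s\<bar> powr (-1/2) * \<bar>t\<bar> powr (-1/2))"
    by (rule set_integral_mono_AE[OF ci[OF t] si], use ae in eventually_elim)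
       (use t rho_inv_le in \<open>auto simp: punctured_def power_int_minus\<close>)
  thus "(LBINT s:{-pi..pi}. (\<bar>s\<bar> + \<bar>t\<bar>) powi (-1)) \<le> A * \<bar>t\<bar> powr (-1/2)" by (simp add: A_def)
  have tt: "\<bar>t\<bar> powr (-3/2) = \<bar>t\<bar> powr (-1/2) * inverse \<bar>t\<bar>"
    using t powr_add[of "\<bar>t\<bar>" "-1/2" "-1"] by (auto simp: punctured_def powr_minus)
  have "(LBINT s:{-pi..pi}. (\<bar>s\<bar> + \<bar>t\<bar>) powi (-2)) \<le> (LBINT s:{-pi..pi}. \<bar>s\<bar> powr (-1/2) * \<bar>t\<bar> powr (-3/2))"
  proof (rule set_integral_mono_AE[OF ci[OF t] si], use ae in eventually_elim)
    case (elim s)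
    have "(\<bar>s\<bar> + \<bar>t\<bar>) powi (-2) = inverse (\<bar>s\<bar> + \<bar>t\<bar>) * inverse (\<bar>s\<bar> + \<bar>t\<bar>)"
      by (simp add: power_int_minus power2_eq_square)
    also have "\<dots> \<le> (\<bar>s\<bar> powr (-1/2) * \<bar>t\<bar> powr (-1/2)) * inverse \<bar>t\<bar>"
      using t elim by (intro mult_mono rho_inv_le) (auto simp: punctured_def intro!: le_imp_inverse_le)
    finally show ?case unfolding tt by simp
  qed
  thus "(LBINT s:{-pi..pi}. (\<bar>s\<bar> + \<bar>t\<bar>) powi (-2)) \<le> A * \<bar>t\<bar> powr (-3/2)" by (simp add: A_def)
qed

text \<open>Interpolating between \<open>K\<close> and \<open>K + 1\<close> integrations by parts gains a third of a power while
  keeping the bound integrable in \<open>t\<close>.\<close>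

lemma ord_osc_interpolate:
  assumes "ord (Suc K) (int K - 1) F"
  shows "\<exists>C\<ge>0. \<forall>t\<in>punctured. \<forall>m::int. m \<noteq> 0 \<longrightarrow>
     cmod (LBINT s:{-pi..pi}. F s t * cis (- (of_int m * s))) \<le> C * \<bar>of_int m\<bar> powr (- real K - 1/3) * \<bar>t\<bar> powr (-5/6)"
proof -
  obtain A where A: "A \<ge> 0" "\<And>t. t \<in> punctured \<Longrightarrow> (LBINT s:{-pi..pi}. (\<bar>s\<bar> + \<bar>t\<bar>) powi (-1)) \<le> A * \<bar>t\<bar> powr (-1/2)"
    "\<And>t. t \<in> punctured \<Longrightarrow> (LBINT s:{-pi..pi}. (\<bar>s\<bar> + \<bar>t\<bar>) powi (-2)) \<le> A * \<bar>t\<bar> powr (-3/2)" using int_rho by metis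
  let ?I = "\<lambda>t m. cmod (LBINT s:{-pi..pi}. F s t * cis (- (of_int m * s)))"
  from ord_osc[OF ord_SucD[OF assms]] obtain C where C: "C \<ge> 0" and C2: "\<forall>t\<in>punctured. \<forall>m::int. m \<noteq> 0 \<longrightarrow>
     ?I t m \<le> C * (LBINT s:{-pi..pi}. (\<bar>s\<bar> + \<bar>t\<bar>) powi (int K - 1 - int K)) / \<bar>of_int m\<bar> ^ K"
    by (elim exE conjE)
  from ord_osc[OF assms] obtain D where D: "D \<ge> 0" and D2: "\<forall>t\<in>punctured. \<forall>m::int. m \<noteq> 0 \<longrightarrow>
     ?I t m \<le> D * (LBINT s:{-pi..pi}. (\<bar>s\<bar> + \<bar>t\<bar>) powi (int K - 1 - int (Suc K))) / \<bar>of_int m\<bar> ^ Suc K"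
    by (elim exE conjE)
  have nn: "0 \<le> (LBINT s:{-pi..pi}. (\<bar>s\<bar> + \<bar>t\<bar>) powi n)" for t n
    unfolding set_lebesgue_integral_def by (rule integral_nonneg_AE) simp
  define B where "B = max C D * A"
  have B: "B \<ge> 0" using A C by (simp add: B_def)
  show ?thesis
  proof (intro exI[of _ B] conjI B ballI allI impI)
    fix t and m :: int assume t: "t \<in> punctured" and m: "m \<noteq> 0"
    let ?m = "\<bar>of_int m\<bar> :: real"
    have mp: "?m > 0" and tp: "\<bar>t\<bar> > 0" using t m by (auto simp: punctured_def)
    have "C * (LBINT s:{-pi..pi}. (\<bar>s\<bar> + \<bar>t\<bar>) powi (-1)) \<le> max C D * (A * \<bar>t\<bar> powr (-1/2))"
      by (rule mult_mono[OF max.cobounded1 A(2)[OF t] _ nn]) (use C in auto)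
    hence "?I t m \<le> max C D * (A * \<bar>t\<bar> powr (-1/2)) / ?m ^ K"
      using C2[rule_format, OF t m] divide_right_mono[of _ "max C D * (A * \<bar>t\<bar> powr (-1/2))" "?m ^ K"]
      by (fastforce intro: order_trans)
    also have "\<dots> = B * \<bar>t\<bar> powr (-1/2) * ?m powr (- real K)"
      using mp by (simp add: B_def powr_minus powr_realpow field_simps)
    finally have 1: "?I t m \<le> B * \<bar>t\<bar> powr (-1/2) * ?m powr (- real K)" .
    have "D * (LBINT s:{-pi..pi}. (\<bar>s\<bar> + \<bar>t\<bar>) powi (-2)) \<le> max C D * (A * \<bar>t\<bar> powr (-3/2))"
      by (rule mult_mono[OF max.cobounded2 A(3)[OF t] _ nn]) (use C in auto)
    hence "?I t m \<le> max C D * (A * \<bar>t\<bar> powr (-3/2)) / ?m ^ Suc K"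
      using D2[rule_format, OF t m] divide_right_mono[of _ "max C D * (A * \<bar>t\<bar> powr (-3/2))" "?m ^ Suc K"]
      by (fastforce intro: order_trans)
    also have "\<dots> = B * \<bar>t\<bar> powr (-3/2) * ?m powr (- real (Suc K))"
      using mp unfolding powr_minus powr_realpow[OF mp] by (simp add: B_def field_simps)
    finally have 2: "?I t m \<le> B * \<bar>t\<bar> powr (-3/2) * ?m powr (- real (Suc K))" .
    show "?I t m \<le> B * ?m powr (- real K - 1/3) * \<bar>t\<bar> powr (-5/6)"
    proof (cases "B = 0")
      case True
      thus ?thesis using 1 by simp
    next
      case False
      hence Bp: "B > 0" using B by simp
      \<comment> \<open>Weight 1/3 on the second bound gives the exponent -5/6 in \<open>t\<close>;
        any weight below 1/2 would keep it above -1.\<close>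
      have "?I t m = ?I t m powr (2/3 + 1/3)" by simp
      also have "\<dots> = ?I t m powr (2/3) * ?I t m powr (1/3)" unfolding powr_add ..
      also have "\<dots> \<le> (B * \<bar>t\<bar> powr (-1/2) * ?m powr (- real K)) powr (2/3) * (B * \<bar>t\<bar> powr (-3/2) * ?m powr (- real (Suc K))) powr (1/3)"
        using 1 2 by (intro mult_mono powr_mono2) auto
      also have "\<dots> = (B powr (2/3) * B powr (1/3)) * (\<bar>t\<bar> powr (-1/2 * (2/3)) * \<bar>t\<bar> powr (-3/2 * (1/3)))
          * (?m powr (- real K * (2/3)) * ?m powr (- real (Suc K) * (1/3)))"
        using Bp mp tp by (simp only: powr_mult powr_powr) (simp only: mult_ac)
      also have "\<dots> = B * \<bar>t\<bar> powr (-5/6) * ?m powr (- real K - 1/3)"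
      proof -
        have "-1/2 * (2/3) + -3/2 * (1/3) = (-5/6 :: real)" "- real K * (2/3) + - real (Suc K) * (1/3) = - real K - 1/3" "2/3 + 1/3 = (1::real)"
          by (simp_all add: field_simps)
        thus ?thesis unfolding powr_add[symmetric] using Bp by simp
      qed
      finally show ?thesis by (simp add: mult_ac)
    qed
  qed
qed

section \<open>Fourier series of rapidly decaying functions on the lattice\<close>

lemma sum_inverse_squares_le:
  "(\<Sum>m\<in>{-B..B::int}. 1 / (1 + \<bar>real_of_int m\<bar>)^2) \<le> 4"
proof -
  define f where "f m = 1 / (1 + \<bar>real_of_int m\<bar>)^2" for m
  have f0: "f m \<ge> 0" for m by (simp add: f_def)
  define b where "b = nat B"
  have half: "(\<Sum>n\<le>b. f (int n)) \<le> 2"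
  proof -
    have "(\<Sum>n\<le>b. f (int n)) = (\<Sum>n<Suc b. 1 / real (Suc n)^2)"
      unfolding lessThan_Suc_atMost f_def by (rule sum.cong) (auto simp: add.commute)
    also have "\<dots> \<le> (\<Sum>n. 1 / real (Suc n)^2)"
      using inverse_squares_sums by (intro sum_le_suminf) (auto simp: sums_iff add.commute)
    also have "\<dots> = pi\<^sup>2 / 6" using inverse_squares_sums by (simp add: sums_iff add.commute)
    also have "\<dots> \<le> 2"
    proof -
      have "pi^2 \<le> (3.2)^2" using pi_approx by (intro power_mono) auto
      thus ?thesis by (simp add: power2_eq_square)
    qed
    finally show ?thesis .
  qed
  have "{-B..B} \<subseteq> int ` {..b} \<union> (\<lambda>n. - int n) ` {..b}"
  proof
    fix m assume "m \<in> {-B..B}"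
    thus "m \<in> int ` {..b} \<union> (\<lambda>n. - int n) ` {..b}"
      by (cases "m \<ge> 0") (auto simp: b_def image_iff intro: bexI[of _ "nat \<bar>m\<bar>"])
  qed
  hence "sum f {-B..B} \<le> sum f (int ` {..b} \<union> (\<lambda>n. - int n) ` {..b})"
    by (intro sum_mono2) (auto simp: f0)
  also have "\<dots> \<le> sum f (int ` {..b}) + sum f ((\<lambda>n. - int n) ` {..b})"
    using sum.union_inter[of "int ` {..b}" "(\<lambda>n. - int n) ` {..b}" f]
      sum_nonneg[of "int ` {..b} \<inter> (\<lambda>n. - int n) ` {..b}" f] f0 by simp
  also have "\<dots> = (\<Sum>n\<le>b. f (int n)) + (\<Sum>n\<le>b. f (- int n))"
    by (subst (1 2) sum.reindex) (auto simp: inj_on_def)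
  also have "(\<Sum>n\<le>b. f (- int n)) = (\<Sum>n\<le>b. f (int n))" by (simp add: f_def)
  finally show ?thesis using half by (simp add: f_def)
qed

lemma has_sum_minus:
  fixes f g :: "'a \<Rightarrow> complex"
  assumes "(f has_sum a) A" "(g has_sum b) A"
  shows "((\<lambda>x. f x - g x) has_sum (a - b)) A"
proof -
  have "((\<lambda>x. - g x) has_sum - b) A" using assms(2) by (simp add: has_sum_uminus)
  from has_sum_add[OF assms(1) this] show ?thesis by simp
qed

lemma has_sum_finite_sum:
  fixes f :: "'b \<Rightarrow> 'a \<Rightarrow> complex"
  assumes "\<And>i. i \<in> I \<Longrightarrow> (f i has_sum a i) A"
  shows "((\<lambda>x. \<Sum>i\<in>I. f i x) has_sum (\<Sum>i\<in>I. a i)) A"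
  using assms by (induction I rule: infinite_finite_induct) (auto intro!: has_sum_add has_sum_0)

text \<open>Serves to differentiate an infinite sum termwise: a summable majorant of the
  second-order Taylor errors yields such a quadratic bound.\<close>

lemma has_vector_derivative_quadratic:
  fixes f :: "real \<Rightarrow> 'a::real_normed_vector"
  assumes "\<And>h. norm (f (s + h) - f s - h *\<^sub>R f') \<le> C * h^2"
  shows "(f has_vector_derivative f') (at s)"
  unfolding has_vector_derivative_def has_derivative_at
proof (intro conjI bounded_linear_scaleR_left)
  have "((\<lambda>h. C * \<bar>h\<bar>) \<longlongrightarrow> C * \<bar>0\<bar>) (at (0::real))" by (intro tendsto_intros)
  hence "((\<lambda>h. C * \<bar>h\<bar>) \<longlongrightarrow> 0) (at (0::real))" by simp
  thus "(\<lambda>h. norm (f (s + h) - f s - h *\<^sub>R f') / norm h) \<midarrow>0\<rightarrow> 0"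
  proof (rule tendsto_0_le[where K = 1], intro always_eventually allI)
    fix h :: real
    have "norm (f (s + h) - f s - h *\<^sub>R f') / norm h \<le> C * h^2 / norm h"
      by (intro divide_right_mono assms) auto
    also have "\<dots> = C * \<bar>h\<bar>" by (cases "h = 0") (auto simp: power2_eq_square abs_if)
    also have "\<dots> \<le> \<bar>C * \<bar>h\<bar>\<bar>" by simp
    finally show "norm (norm (f (s + h) - f s - h *\<^sub>R f') / norm h) \<le> norm (C * \<bar>h\<bar>) * 1" by simp
  qed
qed

lemma norm_infsum_le_infsum:
  fixes f :: "'a \<Rightarrow> complex"
  assumes "g summable_on A" "\<And>x. x \<in> A \<Longrightarrow> cmod (f x) \<le> g x"
  shows "f summable_on A" "cmod (infsum f A) \<le> infsum g A"
proof -
  have a: "(\<lambda>x. cmod (f x)) summable_on A"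
    using assms by (intro summable_on_comparison_test[OF assms(1)]) auto
  thus s: "f summable_on A" by (rule abs_summable_summable)
  have "cmod (infsum f A) \<le> infsum (\<lambda>x. cmod (f x)) A" using norm_infsum_bound[of f A] a by simp
  also have "\<dots> \<le> infsum g A" using a assms by (intro infsum_mono) auto
  finally show "cmod (infsum f A) \<le> infsum g A" .
qed

lemma iexp_taylor: "cmod (cis x - (\<Sum>k<Suc n. (\<i> * of_real x) ^ k / fact k)) \<le> \<bar>x\<bar> ^ Suc n / fact (Suc n)"
  using iexp_approx1[of x n] by (simp add: cis_conv_exp lessThan_Suc_atMost)

context spherical_walk
begin

section \<open>Rapid decay, summability and moments on the lattice\<close>

definition rapid :: "nat \<Rightarrow> (complex \<Rightarrow> complex) \<Rightarrow> bool" where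
  "rapid M g \<longleftrightarrow> (\<exists>C\<ge>0. \<forall>z\<in>Z. cmod (g z) \<le> C / (1 + cmod z) ^ M)"

text \<open>The exponent 4 lets the majorant split into a product of inverse squares in the two
  coordinates, each with a convergent sum.\<close>

lemma summable_Z: "(\<lambda>z. 1 / (1 + cmod z) ^ 4) summable_on Z"
proof (rule nonneg_bdd_above_summable_on)
  show "bdd_above (sum (\<lambda>z. 1 / (1 + cmod z) ^ 4) ` {F. F \<subseteq> Z \<and> finite F})"
  proof (rule bdd_aboveI2)
    fix F assume "F \<in> {F. F \<subseteq> Z \<and> finite F}"
    hence F: "F \<subseteq> Z" "finite F" by auto
    define f where "f m = 1 / (1 + \<bar>real_of_int m\<bar>)^2" for m
    define \<phi> where "\<phi> z = (\<lfloor>c1 z\<rfloor>, \<lfloor>c2 z\<rfloor>)" for z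
    have fl: "of_int \<lfloor>c1 z\<rfloor> = c1 z" "of_int \<lfloor>c2 z\<rfloor> = c2 z" if "z \<in> F" for z
      using subsetD[OF F(1) that] by (auto simp: Z_iff Ints_def)
    have inj: "inj_on \<phi> F"
      by (rule inj_onI) (metis \<phi>_def coord fl(1) fl(2) prod.inject)
    obtain B where B: "\<phi> ` F \<subseteq> {-B..B} \<times> {-B..B}"
    proof -
      obtain A where A: "\<And>z. z \<in> F \<Longrightarrow> cmod z \<le> A" using finite_imp_bounded[OF F(2)] by (auto simp: bounded_iff)
      show ?thesis
      proof (rule that[of "\<lceil>coord_bound * A\<rceil>"], rule image_subsetI)
        fix z assume z: "z \<in> F"
        have "coord_bound * cmod z \<le> coord_bound * A" using A[OF z] coord_bound_ge1 by (intro mult_left_mono) auto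
        hence "\<bar>c1 z\<bar> \<le> coord_bound * A" "\<bar>c2 z\<bar> \<le> coord_bound * A" using c1_le[of z] c2_le[of z] by linarith+
        hence "\<bar>\<lfloor>c1 z\<rfloor>\<bar> \<le> \<lceil>coord_bound * A\<rceil>" "\<bar>\<lfloor>c2 z\<rfloor>\<bar> \<le> \<lceil>coord_bound * A\<rceil>" using fl[OF z] by linarith+
        thus "\<phi> z \<in> {- \<lceil>coord_bound * A\<rceil>..\<lceil>coord_bound * A\<rceil>} \<times> {- \<lceil>coord_bound * A\<rceil>..\<lceil>coord_bound * A\<rceil>}" by (auto simp: \<phi>_def abs_le_iff)
      qed
    qed
    have b: "1 / (1 + cmod z) ^ 4 \<le> coord_bound ^ 4 * (f (fst (\<phi> z)) * f (snd (\<phi> z)))" if z: "z \<in> F" for z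
    proof -
      have p: "1 + cmod z > 0" by (rule add_pos_nonneg) auto
      have "1 + \<bar>c1 z\<bar> \<le> coord_bound * (1 + cmod z)" "1 + \<bar>c2 z\<bar> \<le> coord_bound * (1 + cmod z)"
        using c1_le[of z] c2_le[of z] coord_bound_ge1 by (auto simp: distrib_left)
      hence "(1 + \<bar>c1 z\<bar>)^2 * (1 + \<bar>c2 z\<bar>)^2 \<le> (coord_bound * (1 + cmod z))^2 * (coord_bound * (1 + cmod z))^2"
        by (intro mult_mono power_mono) auto
      also have "\<dots> = coord_bound ^ 4 * (1 + cmod z) ^ 4" by (simp add: power_mult_distrib power4_eq_xxxx power2_eq_square mult_ac)
      finally have le: "(1 + \<bar>c1 z\<bar>)^2 * (1 + \<bar>c2 z\<bar>)^2 \<le> coord_bound ^ 4 * (1 + cmod z) ^ 4" .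
      have "(1 + \<bar>c1 z\<bar>)^2 * (1 + \<bar>c2 z\<bar>)^2 > 0" by (intro mult_pos_pos zero_less_power) auto
      hence "1 / (1 + cmod z) ^ 4 \<le> coord_bound ^ 4 * (1 / (1 + \<bar>c1 z\<bar>)^2 * (1 / (1 + \<bar>c2 z\<bar>)^2))"
        using le p by (simp add: field_simps)
      thus ?thesis unfolding f_def \<phi>_def fst_conv snd_conv fl[OF z] .
    qed
    have 1: "(\<Sum>z\<in>F. 1 / (1 + cmod z) ^ 4) \<le> coord_bound ^ 4 * (\<Sum>z\<in>F. f (fst (\<phi> z)) * f (snd (\<phi> z)))"
      unfolding sum_distrib_left by (rule sum_mono[OF b])
    have "(\<Sum>z\<in>F. f (fst (\<phi> z)) * f (snd (\<phi> z))) = (\<Sum>q\<in>\<phi> ` F. f (fst q) * f (snd q))"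
      by (subst sum.reindex[OF inj]) simp
    also have "\<dots> \<le> (\<Sum>q\<in>{-B..B} \<times> {-B..B}. f (fst q) * f (snd q))"
      using B by (intro sum_mono2) (auto simp: f_def)
    also have "\<dots> = (\<Sum>m\<in>{-B..B}. f m) * (\<Sum>n\<in>{-B..B}. f n)"
      by (simp add: sum_product sum.cartesian_product case_prod_unfold)
    also have "\<dots> \<le> 4 * 4"
      using sum_inverse_squares_le[of B] by (intro mult_mono) (auto simp: f_def intro!: sum_nonneg)
    finally have "coord_bound ^ 4 * (\<Sum>z\<in>F. f (fst (\<phi> z)) * f (snd (\<phi> z))) \<le> coord_bound ^ 4 * (4 * 4)"
      using coord_bound_ge1 by (intro mult_left_mono) auto
    with 1 show "(\<Sum>z\<in>F. 1 / (1 + cmod z) ^ 4) \<le> coord_bound ^ 4 * (4 * 4)" by (rule order_trans)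
  qed
qed auto

text \<open>Growth of degree \<open>n\<close> consumes \<open>n\<close> powers of decay and four are
  kept for summability; the offsets 4 in later hypotheses come from here, and the offsets 6 from two
  more factors in a Taylor remainder.\<close>

lemma rapid_summable_real:
  assumes "rapid M g" "\<And>z. z \<in> Z \<Longrightarrow> 0 \<le> h z \<and> h z \<le> D * (1 + cmod z) ^ n" "n + 4 \<le> M"
  shows "(\<lambda>z. cmod (g z) * h z) summable_on Z"
proof -
  obtain C where C: "C \<ge> 0" "\<And>z. z \<in> Z \<Longrightarrow> cmod (g z) \<le> C / (1 + cmod z) ^ M" using assms(1) by (auto simp: rapid_def)
  have "(\<lambda>z. C * D * (1 / (1 + cmod z) ^ 4)) summable_on Z" by (intro summable_on_cmult_right summable_Z)
  thus ?thesis
  proof (rule summable_on_comparison_test)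
    fix z assume z: "z \<in> Z"
    have p: "1 + cmod z > 0" "1 + cmod z \<ge> 1" by (auto intro: add_pos_nonneg)
    have D: "D \<ge> 0"
    proof (rule ccontr)
      assume "\<not> D \<ge> 0"
      hence "D * (1 + cmod z) ^ n < 0" using zero_less_power[OF p(1), of n] by (intro mult_neg_pos) auto
      thus False using assms(2)[OF z] by linarith
    qed
    have "cmod (g z) * h z \<le> (C / (1 + cmod z) ^ M) * (D * (1 + cmod z) ^ n)"
      using C z assms(2)[OF z] by (intro mult_mono) (auto intro!: divide_nonneg_nonneg)
    also have "\<dots> \<le> (C / (1 + cmod z) ^ (n + 4)) * (D * (1 + cmod z) ^ n)"
      using C p(2) D assms(3) by (intro mult_right_mono divide_left_mono power_increasing mult_pos_pos zero_less_power p(1)) auto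
    also have "\<dots> = C * D * (1 / (1 + cmod z) ^ 4)" using p by (simp add: power_add field_simps)
    finally show "cmod (g z) * h z \<le> C * D * (1 / (1 + cmod z) ^ 4)" .
    show "0 \<le> cmod (g z) * h z" using assms(2)[OF z] by auto
  qed
qed

lemma rapid_summable:
  assumes "rapid M g" "\<And>z. z \<in> Z \<Longrightarrow> cmod (h z) \<le> D * (1 + cmod z) ^ n" "n + 4 \<le> M"
  shows "(\<lambda>z. g z * h z) summable_on Z"
proof -
  have "(\<lambda>z. cmod (g z) * cmod (h z)) summable_on Z"
    by (rule rapid_summable_real[OF assms(1) _ assms(3)]) (use assms(2) in auto)
  hence "(\<lambda>z. cmod (g z * h z)) summable_on Z" by (simp add: norm_mult)
  thus ?thesis by (rule abs_summable_summable)
qed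

definition mom :: "(complex \<Rightarrow> complex) \<Rightarrow> nat \<Rightarrow> nat \<Rightarrow> complex" where
  "mom g i j = (\<Sum>\<^sub>\<infinity>w\<in>Z. g w * (w ^ i * cnj w ^ j))"

lemma mom_summable: "rapid M g \<Longrightarrow> i + j + 4 \<le> M \<Longrightarrow> (\<lambda>w. g w * (w ^ i * cnj w ^ j)) summable_on Z"
proof (rule rapid_summable[where D = 1 and n = "i + j"])
  fix z :: complex
  have "cmod (z ^ i * cnj z ^ j) = cmod z ^ (i + j)" by (simp add: norm_mult norm_power power_add)
  also have "\<dots> \<le> (1 + cmod z) ^ (i + j)" by (intro power_mono) auto
  finally show "cmod (z ^ i * cnj z ^ j) \<le> 1 * (1 + cmod z) ^ (i + j)" by simp
qed auto

text \<open>The product of powers is a polynomial of degree below \<open>N\<close> in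
  \<open>w\<close> and \<open>cnj w\<close>. It translates vanishing moments into the lattice
  coordinates, in which the Fourier phases are linear.\<close>

lemma mom_linear_power:
  assumes g: "rapid M g" and m: "\<And>i j. i + j < N \<Longrightarrow> mom g i j = 0" and "N + 4 \<le> M" "a + b < N"
  shows "(\<Sum>\<^sub>\<infinity>w\<in>Z. g w * ((u * w + v * cnj w) ^ a * (u' * w + v' * cnj w) ^ b)) = 0"
proof -
  let ?c = "\<lambda>k l. (of_nat (a choose k) * u ^ k * v ^ (a - k)) * (of_nat (b choose l) * u' ^ l * v' ^ (b - l))"
  have "g w * ((u * w + v * cnj w) ^ a * (u' * w + v' * cnj w) ^ b)
      = (\<Sum>k\<le>a. \<Sum>l\<le>b. ?c k l * (g w * (w ^ (k + l) * cnj w ^ ((a - k) + (b - l)))))" for w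
    unfolding binomial_ring unfolding sum_product unfolding sum_distrib_left
    by (intro sum.cong refl) (simp only: power_mult_distrib power_add mult_ac)
  moreover have "((\<lambda>w. \<Sum>k\<le>a. \<Sum>l\<le>b. ?c k l * (g w * (w ^ (k + l) * cnj w ^ ((a - k) + (b - l))))) has_sum
     (\<Sum>k\<le>a. \<Sum>l\<le>b. ?c k l * mom g (k + l) ((a - k) + (b - l)))) Z"
    unfolding mom_def using assms by (intro has_sum_finite_sum has_sum_cmult_right has_sum_infsum mom_summable[OF g]) auto
  moreover have "(\<Sum>k\<le>a. \<Sum>l\<le>b. ?c k l * mom g (k + l) ((a - k) + (b - l))) = 0"
    using assms by (intro sum.neutral ballI) (auto intro!: m)
  ultimately show ?thesis by (simp add: infsumI)
qed

section \<open>Fourier series and their order at the origin\<close>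

definition b1 :: complex where "b1 = - cnj w2 / (2 * \<i> * of_real det)"
definition b2 :: complex where "b2 = cnj w1 / (2 * \<i> * of_real det)"

lemma c1_cplx: "of_real (c1 z) = b1 * z + cnj b1 * cnj z"
  using det_nz by (simp add: b1_def c1_def complex_eq_iff field_simps Re_divide Im_divide power2_eq_square)
lemma c2_cplx: "of_real (c2 z) = b2 * z + cnj b2 * cnj z"
  using det_nz by (simp add: b2_def c2_def complex_eq_iff field_simps Re_divide Im_divide power2_eq_square)

definition ang :: "real \<Rightarrow> real \<Rightarrow> complex \<Rightarrow> real" where "ang s t w = s * c1 w + t * c2 w"

lemma ang_cplx: "of_real (ang s t z) = (of_real s * b1 + of_real t * b2) * z + cnj (of_real s * b1 + of_real t * b2) * cnj z"
  by (simp add: ang_def c1_cplx c2_cplx algebra_simps)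

lemma ang_le: "\<bar>ang s t w\<bar> \<le> (\<bar>s\<bar> + \<bar>t\<bar>) * (coord_bound * cmod w)"
proof -
  have "\<bar>ang s t w\<bar> \<le> \<bar>s\<bar> * \<bar>c1 w\<bar> + \<bar>t\<bar> * \<bar>c2 w\<bar>" unfolding ang_def by (metis abs_mult abs_triangle_ineq)
  also have "\<dots> \<le> \<bar>s\<bar> * (coord_bound * cmod w) + \<bar>t\<bar> * (coord_bound * cmod w)"
    by (intro add_mono mult_left_mono c1_le c2_le) auto
  finally show ?thesis by (simp add: algebra_simps)
qed

text \<open>The \<open>j\<close>-th derivative in \<open>s\<close> of the Fourier series of
  \<open>g\<close>, written out termwise.\<close>

definition FTj :: "(complex \<Rightarrow> complex) \<Rightarrow> nat \<Rightarrow> real \<Rightarrow> real \<Rightarrow> complex" where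
  "FTj g j s t = (\<Sum>\<^sub>\<infinity>w\<in>Z. g w * ((\<i> * of_real (c1 w)) ^ j * cis (ang s t w)))"

abbreviation "FT g \<equiv> FTj g 0"

lemma c1_pow_le: "\<bar>c1 z\<bar> ^ j \<le> coord_bound ^ j * (1 + cmod z) ^ j"
proof -
  have "coord_bound * cmod z \<le> coord_bound * (1 + cmod z)" using coord_bound_ge1 by (intro mult_left_mono) auto
  with c1_le[of z] have "\<bar>c1 z\<bar> \<le> coord_bound * (1 + cmod z)" by linarith
  thus ?thesis unfolding power_mult_distrib[symmetric] by (intro power_mono) auto
qed

lemma FTj_summable: "rapid M g \<Longrightarrow> j + 4 \<le> M \<Longrightarrow> (\<lambda>w. g w * ((\<i> * of_real (c1 w)) ^ j * cis (ang s t w))) summable_on Z"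
  by (rule rapid_summable[where D = "coord_bound ^ j" and n = j]) (auto simp: norm_mult norm_power c1_pow_le)

text \<open>The Taylor remainder of \<open>cis\<close> bounds the error by \<open>h^2\<close> times
  a series with \<open>j + 2\<close> factors \<open>c1 w\<close>, hence the two additional powers of
  decay.\<close>

lemma FTj_deriv:
  assumes g: "rapid M g" and "j + 6 \<le> M"
  shows "((\<lambda>s. FTj g j s t) has_vector_derivative FTj g (Suc j) s t) (at s)"
proof (rule has_vector_derivative_quadratic)
  fix h :: real
  let ?f = "\<lambda>j s w. g w * ((\<i> * of_real (c1 w)) ^ j * cis (ang s t w))"
  let ?S = "\<lambda>w. cmod (g w) * \<bar>c1 w\<bar> ^ (j + 2)"
  have S: "?S summable_on Z"
    by (rule rapid_summable_real[OF g, where D = "coord_bound ^ (j + 2)" and n = "j + 2"]) (use c1_pow_le[of _ "j + 2"] assms in auto)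
  have sm: "?f i s summable_on Z" if "i + 4 \<le> M" for i s by (rule FTj_summable[OF g that])
  have hs: "((\<lambda>w. ?f j (s + h) w - ?f j s w - of_real h * ?f (Suc j) s w) has_sum (FTj g j (s + h) t - FTj g j s t - of_real h * FTj g (Suc j) s t)) Z"
    unfolding FTj_def using assms
    by (intro has_sum_minus has_sum_cmult_right has_sum_infsum sm) auto
  have b: "cmod (?f j (s + h) w - ?f j s w - of_real h * ?f (Suc j) s w) \<le> ?S w * h^2" for w
  proof -
    let ?x = "h * c1 w"
    have a: "ang (s + h) t w = ang s t w + ?x" by (simp add: ang_def algebra_simps)
    have "?f j (s + h) w - ?f j s w - of_real h * ?f (Suc j) s w
        = g w * (\<i> * of_real (c1 w)) ^ j * cis (ang s t w) * (cis ?x - (\<Sum>k<Suc 1. (\<i> * of_real ?x) ^ k / fact k))"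
      unfolding a cis_mult[symmetric] by (simp add: algebra_simps)
    also have "cmod \<dots> = (cmod (g w) * \<bar>c1 w\<bar> ^ j) * cmod (cis ?x - (\<Sum>k<Suc 1. (\<i> * of_real ?x) ^ k / fact k))"
      unfolding norm_mult norm_power by simp
    also have "\<dots> \<le> (cmod (g w) * \<bar>c1 w\<bar> ^ j) * (\<bar>?x\<bar> ^ Suc 1 / fact (Suc 1))"
      by (rule mult_left_mono[OF iexp_taylor]) simp
    also have "\<dots> \<le> (cmod (g w) * \<bar>c1 w\<bar> ^ j) * (\<bar>?x\<bar> ^ 2)"
      by (intro mult_left_mono) (auto simp: eval_nat_numeral abs_mult)
    also have "\<dots> = ?S w * h^2" by (simp add: abs_mult power_mult_distrib power_add power2_eq_square mult_ac)
    finally show ?thesis .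
  qed
  have "cmod (FTj g j (s + h) t - FTj g j s t - of_real h * FTj g (Suc j) s t) \<le> (\<Sum>\<^sub>\<infinity>w\<in>Z. ?S w * h^2)"
    using norm_infsum_le_infsum(2)[OF summable_on_cmult_left[OF S, of "h^2"] b] infsumI[OF hs] by simp
  also have "\<dots> = (\<Sum>\<^sub>\<infinity>w\<in>Z. ?S w) * h^2" by (rule infsum_cmult_left')
  finally show "norm (FTj g j (s + h) t - FTj g j s t - h *\<^sub>R FTj g (Suc j) s t) \<le> (\<Sum>\<^sub>\<infinity>w\<in>Z. ?S w) * h^2"
    by (simp add: scaleR_conv_of_real)
qed

text \<open>For \<open>j < N\<close> the Taylor polynomial of the phase of degree below
  \<open>N - j\<close> can be subtracted under the sum: with the \<open>j\<close> factors
  \<open>c1 w\<close> it only involves moments of degree below \<open>N\<close>. For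
  \<open>j \<ge> N\<close> the claimed power is bounded below on the box, and boundedness
  suffices.\<close>

lemma FTj_bound:
  assumes g: "rapid M g" and m: "\<And>i j. i + j < N \<Longrightarrow> mom g i j = 0" and "N + 4 \<le> M" "j + 4 \<le> M"
  shows "\<exists>C\<ge>0. \<forall>t\<in>punctured. \<forall>s. \<bar>s\<bar> \<le> pi \<longrightarrow> cmod (FTj g j s t) \<le> C * (\<bar>s\<bar> + \<bar>t\<bar>) powi (int N - int j)"
proof (cases "j < N")
  case True
  define n where "n = N - j"
  then obtain n' where n: "n = Suc n'" using True by (metis Suc_diff_Suc)
  let ?S = "\<lambda>w. cmod (g w) * (coord_bound * cmod w) ^ N"
  have S: "?S summable_on Z"
    by (rule rapid_summable_real[OF g, where D = "coord_bound ^ N" and n = N])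
       (use coord_bound_ge1 assms in \<open>auto simp: power_mult_distrib intro!: mult_left_mono power_mono\<close>)
  have "cmod (FTj g j s t) \<le> (\<Sum>\<^sub>\<infinity>w\<in>Z. ?S w) * (\<bar>s\<bar> + \<bar>t\<bar>) ^ n" for s t
  proof -
    let ?P = "\<lambda>w. (\<Sum>k<n. (\<i> * of_real (ang s t w)) ^ k / fact k)"
    let ?v = "of_real s * b1 + of_real t * b2"
    have P: "((\<lambda>w. g w * ((\<i> * of_real (c1 w)) ^ j * ?P w)) has_sum 0) Z"
    proof -
      have "((\<lambda>w. \<Sum>k<n. \<i> ^ j * \<i> ^ k / fact k * (g w * ((b1 * w + cnj b1 * cnj w) ^ j * (?v * w + cnj ?v * cnj w) ^ k))) has_sum
          (\<Sum>k<n. \<i> ^ j * \<i> ^ k / fact k * (\<Sum>\<^sub>\<infinity>w\<in>Z. g w * ((b1 * w + cnj b1 * cnj w) ^ j * (?v * w + cnj ?v * cnj w) ^ k)))) Z"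
      proof (intro has_sum_finite_sum has_sum_cmult_right has_sum_infsum)
        fix k assume k: "k \<in> {..<n}"
        have "(\<lambda>w. g w * (complex_of_real (c1 w) ^ j * complex_of_real (ang s t w) ^ k)) summable_on Z"
        proof (rule rapid_summable[OF g, where D = "coord_bound ^ j * ((\<bar>s\<bar> + \<bar>t\<bar>) * coord_bound) ^ k" and n = "j + k"])
          fix z
          have "\<bar>ang s t z\<bar> \<le> (\<bar>s\<bar> + \<bar>t\<bar>) * coord_bound * (1 + cmod z)"
          proof -
            have "(\<bar>s\<bar> + \<bar>t\<bar>) * coord_bound * cmod z \<le> (\<bar>s\<bar> + \<bar>t\<bar>) * coord_bound * (1 + cmod z)"
              using coord_bound_ge1 by (intro mult_left_mono) auto
            thus ?thesis using ang_le[of s t z] unfolding mult.assoc by linarith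
          qed
          hence "\<bar>ang s t z\<bar> ^ k \<le> ((\<bar>s\<bar> + \<bar>t\<bar>) * coord_bound) ^ k * (1 + cmod z) ^ k"
            unfolding power_mult_distrib[symmetric] by (intro power_mono) (auto simp: mult_ac)
          hence "\<bar>c1 z\<bar> ^ j * \<bar>ang s t z\<bar> ^ k \<le> (coord_bound ^ j * (1 + cmod z) ^ j) * (((\<bar>s\<bar> + \<bar>t\<bar>) * coord_bound) ^ k * (1 + cmod z) ^ k)"
            using c1_pow_le[of z j] coord_bound_ge1 by (intro mult_mono) auto
          thus "cmod (complex_of_real (c1 z) ^ j * complex_of_real (ang s t z) ^ k) \<le> coord_bound ^ j * ((\<bar>s\<bar> + \<bar>t\<bar>) * coord_bound) ^ k * (1 + cmod z) ^ (j + k)"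
            by (simp add: norm_mult norm_power power_add mult_ac)
        qed (use k assms in \<open>auto simp: n_def\<close>)
        thus "(\<lambda>w. g w * ((b1 * w + cnj b1 * cnj w) ^ j * (?v * w + cnj ?v * cnj w) ^ k)) summable_on Z"
          unfolding c1_cplx ang_cplx .
      qed
      also have "(\<Sum>k<n. \<i> ^ j * \<i> ^ k / fact k * (\<Sum>\<^sub>\<infinity>w\<in>Z. g w * ((b1 * w + cnj b1 * cnj w) ^ j * (?v * w + cnj ?v * cnj w) ^ k))) = 0"
        using True by (intro sum.neutral ballI) (subst mom_linear_power[OF g m assms(3)], auto simp: n_def)
      also have "(\<lambda>w. \<Sum>k<n. \<i> ^ j * \<i> ^ k / fact k * (g w * ((b1 * w + cnj b1 * cnj w) ^ j * (?v * w + cnj ?v * cnj w) ^ k)))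
         = (\<lambda>w. g w * ((\<i> * of_real (c1 w)) ^ j * ?P w))"
        unfolding c1_cplx[symmetric] ang_cplx[symmetric] sum_distrib_left
        by (simp add: power_mult_distrib mult_ac)
      finally show ?thesis .
    qed
    have "((\<lambda>w. g w * ((\<i> * of_real (c1 w)) ^ j * cis (ang s t w)) - g w * ((\<i> * of_real (c1 w)) ^ j * ?P w)) has_sum (FTj g j s t - 0)) Z"
      unfolding FTj_def by (intro has_sum_minus has_sum_infsum FTj_summable[OF g] P assms)
    hence hs: "((\<lambda>w. g w * ((\<i> * of_real (c1 w)) ^ j * (cis (ang s t w) - ?P w))) has_sum FTj g j s t) Z"
      by (simp add: algebra_simps)
    have "cmod (g w * ((\<i> * of_real (c1 w)) ^ j * (cis (ang s t w) - ?P w))) \<le> ?S w * (\<bar>s\<bar> + \<bar>t\<bar>) ^ n" for w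
    proof -
      have "cmod (cis (ang s t w) - ?P w) \<le> \<bar>ang s t w\<bar> ^ n / fact n"
        using iexp_taylor[of "ang s t w" n'] by (simp add: n)
      also have "\<dots> \<le> \<bar>ang s t w\<bar> ^ n" by (simp add: field_simps mult_right_mono[of 1 "fact n" "\<bar>ang s t w\<bar> ^ n", simplified])
      also have "\<dots> \<le> ((\<bar>s\<bar> + \<bar>t\<bar>) * (coord_bound * cmod w)) ^ n" by (intro power_mono ang_le) auto
      finally have a: "cmod (cis (ang s t w) - ?P w) \<le> ((\<bar>s\<bar> + \<bar>t\<bar>) * (coord_bound * cmod w)) ^ n" .
      have "cmod (g w * ((\<i> * of_real (c1 w)) ^ j * (cis (ang s t w) - ?P w))) \<le> cmod (g w) * ((coord_bound * cmod w) ^ j * ((\<bar>s\<bar> + \<bar>t\<bar>) * (coord_bound * cmod w)) ^ n)"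
      proof -
        have "cmod (g w * ((\<i> * of_real (c1 w)) ^ j * (cis (ang s t w) - ?P w))) = cmod (g w) * (\<bar>c1 w\<bar> ^ j * cmod (cis (ang s t w) - ?P w))"
          by (simp add: norm_mult norm_power)
        also have "\<dots> \<le> cmod (g w) * ((coord_bound * cmod w) ^ j * ((\<bar>s\<bar> + \<bar>t\<bar>) * (coord_bound * cmod w)) ^ n)"
          by (intro mult_left_mono mult_mono[OF power_mono[OF c1_le] a]) (use coord_bound_ge1 in auto)
        finally show ?thesis .
      qed
      also have "\<dots> = cmod (g w) * (coord_bound * cmod w) ^ (j + n) * (\<bar>s\<bar> + \<bar>t\<bar>) ^ n" by (simp add: power_mult_distrib power_add mult_ac)
      also have "j + n = N" using True by (simp add: n_def)
      finally show ?thesis .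
    qed
    from norm_infsum_le_infsum(2)[OF summable_on_cmult_left[OF S] this] have "cmod (FTj g j s t) \<le> (\<Sum>\<^sub>\<infinity>w\<in>Z. ?S w * (\<bar>s\<bar> + \<bar>t\<bar>) ^ n)"
      unfolding infsumI[OF hs] .
    also have "\<dots> = (\<Sum>\<^sub>\<infinity>w\<in>Z. ?S w) * (\<bar>s\<bar> + \<bar>t\<bar>) ^ n" by (rule infsum_cmult_left')
    finally show ?thesis .
  qed
  moreover have "(\<Sum>\<^sub>\<infinity>w\<in>Z. ?S w) \<ge> 0" using coord_bound_ge1 by (intro infsum_nonneg) auto
  moreover have "int N - int j = int n" using True by (simp add: n_def)
  ultimately show ?thesis by (intro exI[of _ "\<Sum>\<^sub>\<infinity>w\<in>Z. ?S w"]) auto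
next
  case False
  let ?S = "\<lambda>w. cmod (g w) * \<bar>c1 w\<bar> ^ j"
  have S: "?S summable_on Z"
    by (rule rapid_summable_real[OF g, where D = "coord_bound ^ j" and n = j]) (use c1_pow_le[of _ j] assms in auto)
  define A where "A = (\<Sum>\<^sub>\<infinity>w\<in>Z. ?S w)"
  have A: "A \<ge> 0" unfolding A_def by (intro infsum_nonneg) auto
  have b: "cmod (FTj g j s t) \<le> A" for s t
    unfolding FTj_def A_def by (rule norm_infsum_le_infsum(2)[OF S]) (simp add: norm_mult norm_power)
  have "cmod (FTj g j s t) \<le> (A * (2 * pi) ^ (j - N)) * (\<bar>s\<bar> + \<bar>t\<bar>) powi (int N - int j)" if t: "t \<in> punctured" "\<bar>s\<bar> \<le> pi" for s t
  proof -
    have r: "\<bar>s\<bar> + \<bar>t\<bar> > 0" "\<bar>s\<bar> + \<bar>t\<bar> \<le> 2 * pi" using t by (auto simp: punctured_def)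
    have "int N - int j = - int (j - N)" using False by simp
    hence e: "(\<bar>s\<bar> + \<bar>t\<bar>) powi (int N - int j) = inverse ((\<bar>s\<bar> + \<bar>t\<bar>) ^ (j - N))"
      by (simp only: power_int_minus power_int_of_nat)
    have "(\<bar>s\<bar> + \<bar>t\<bar>) ^ (j - N) \<le> (2 * pi) ^ (j - N)" using r by (intro power_mono) auto
    moreover have "(\<bar>s\<bar> + \<bar>t\<bar>) ^ (j - N) > 0" using r by (intro zero_less_power)
    ultimately have "1 \<le> (2 * pi) ^ (j - N) * inverse ((\<bar>s\<bar> + \<bar>t\<bar>) ^ (j - N))" by (simp add: divide_inverse[symmetric])
    from mult_left_mono[OF this A] have "A \<le> A * ((2 * pi) ^ (j - N) * inverse ((\<bar>s\<bar> + \<bar>t\<bar>) ^ (j - N)))" by simp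
    thus ?thesis using b[of s t] unfolding e mult.assoc by linarith
  qed
  thus ?thesis using A by (intro exI[of _ "A * (2 * pi) ^ (j - N)"]) auto
qed

text \<open>\<open>j + k\<close> stays constant along the induction, so one decay exponent serves
  all derivatives.\<close>

lemma ord_FTj:
  assumes g: "rapid M g" and m: "\<And>i j. i + j < N \<Longrightarrow> mom g i j = 0" and N: "N + 4 \<le> M"
  shows "j + k + 6 \<le> M \<Longrightarrow> ord k (int N - int j) (FTj g j)"
proof (induction k arbitrary: j)
  have o: "ord0 (int N - int j) (FTj g j)" if j: "j + 6 \<le> M" for j
    unfolding ord0_def
  proof (intro conjI ballI allI)
    fix t s assume "t \<in> punctured"
    show "continuous_on UNIV (\<lambda>s. FTj g j s t)"
      by (intro continuous_at_imp_continuous_on ballI has_vector_derivative_continuous[OF FTj_deriv[OF g j]])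
    show "FTj g j (s + 2 * pi) t = FTj g j s t" unfolding FTj_def
    proof (rule infsum_cong)
      fix w assume "w \<in> Z"
      then obtain k where k: "c1 w = of_int k" by (auto simp: Z_iff elim: Ints_cases)
      have "ang (s + 2 * pi) t w = ang s t w + 2 * pi * of_int k" by (simp add: ang_def k algebra_simps)
      thus "g w * ((\<i> * of_real (c1 w)) ^ j * cis (ang (s + 2 * pi) t w)) = g w * ((\<i> * of_real (c1 w)) ^ j * cis (ang s t w))"
        by (simp add: cis_shift)
    qed
  next
    show "\<exists>C\<ge>0. \<forall>t\<in>punctured. \<forall>s. \<bar>s\<bar> \<le> pi \<longrightarrow> cmod (FTj g j s t) \<le> C * (\<bar>s\<bar> + \<bar>t\<bar>) powi (int N - int j)"
      using j by (intro FTj_bound[OF g m N]) auto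
  qed
  {
    case 0
    thus ?case using o[of j] by simp
  next
    case (Suc k)
    have "int N - int (Suc j) = int N - int j - 1" by simp
    from Suc.IH[of "Suc j", unfolded this] Suc.prems have "ord k (int N - int j - 1) (FTj g (Suc j))" by simp
    thus ?case using Suc.prems by (intro ord_SucI[of _ _ "FTj g (Suc j)"] o) (auto intro!: FTj_deriv[OF g])
  }
qed

end

section \<open>Solving the discrete Poisson equation\<close>

text \<open>For \<open>k \<noteq> 0\<close> a single integration by parts of the constant 1 gives
  0.\<close>

lemma cis_sym_int: "(LBINT s:{-pi..pi}. cis (of_int k * s)) = (if k = 0 then of_real (2 * pi) else 0)"
proof (cases "k = 0")
  case True
  thus ?thesis by (simp add: set_lebesgue_integral_def scaleR_conv_of_real)
next
  case False
  have "(LBINT s:{-pi..pi}. 1 * cis (- (of_int (-k) * s))) = (LBINT s:{-pi..pi}. 0 * cis (- (of_int (-k) * s))) / (\<i> * of_int (-k))"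
    by (rule osc_by_parts) (use False in auto)
  thus ?thesis using False by simp
qed

context spherical_walk
begin

lemma rapid_finite:
  assumes "finite A" "\<And>z. z \<in> Z \<Longrightarrow> z \<notin> A \<Longrightarrow> g z = 0"
  shows "rapid M g"
  unfolding rapid_def
proof (intro exI[of _ "\<Sum>z\<in>A. cmod (g z) * (1 + cmod z) ^ M"] conjI ballI)
  fix z assume z: "z \<in> Z"
  have p: "(1 + cmod z) ^ M > 0" by (intro zero_less_power add_pos_nonneg) auto
  show "cmod (g z) \<le> (\<Sum>z\<in>A. cmod (g z) * (1 + cmod z) ^ M) / (1 + cmod z) ^ M"
  proof (cases "z \<in> A")
    case True
    have "cmod (g z) * (1 + cmod z) ^ M \<le> (\<Sum>z\<in>A. cmod (g z) * (1 + cmod z) ^ M)"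
      by (rule member_le_sum) (use True assms in auto)
    thus ?thesis using p by (simp add: pos_le_divide_eq)
  next
    case False
    have "(\<Sum>z\<in>A. cmod (g z) * (1 + cmod z) ^ M) \<ge> 0" by (intro sum_nonneg) auto
    thus ?thesis using assms(2)[OF z False] p by simp
  qed
qed (auto intro!: sum_nonneg)

lemma infsum_finite_supp:
  assumes "finite A" "A \<subseteq> Z" "\<And>z. z \<in> Z \<Longrightarrow> z \<notin> A \<Longrightarrow> g z = (0::complex)"
  shows "(\<Sum>\<^sub>\<infinity>w\<in>Z. g w * h w) = (\<Sum>w\<in>A. g w * h w)"
proof -
  have "(\<Sum>\<^sub>\<infinity>w\<in>Z. g w * h w) = (\<Sum>\<^sub>\<infinity>w\<in>A. g w * h w)"
    by (rule infsum_cong_neutral) (use assms in auto)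
  thus ?thesis using assms(1) by simp
qed

lemma kap_outside: "z \<notin> X \<Longrightarrow> kap z = 0"
  by (auto simp: X_def kap_def set_pmf_iff)

lemma rapid_kap: "rapid M kap" by (rule rapid_finite[OF finite_X kap_outside])

lemma mom_kap: "mom kap i j = kmom i j"
  unfolding mom_def kmom_def by (subst infsum_finite_supp[OF finite_X X_Z kap_outside]) (simp_all add: mult.assoc)

lemma FT_kap: "FT kap s t = (\<Sum>x\<in>X. kap x * cis (ang s t x))"
  unfolding FTj_def by (subst infsum_finite_supp[OF finite_X X_Z kap_outside]) simp_all

lemma ang_0: "ang s t 0 = 0" by (simp add: ang_def c1_0 c2_0)
lemma ang_add: "ang s t (x + y) = ang s t x + ang s t y" by (simp add: ang_def c1_add c2_add algebra_simps)
lemma ang_diff: "ang s t (x - y) = ang s t x - ang s t y" by (simp add: ang_def c1_diff c2_diff algebra_simps)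

section \<open>The spectral gap of the walk\<close>

definition spectral_gap :: "real \<Rightarrow> real \<Rightarrow> real" where
  "spectral_gap s t = (\<Sum>x\<in>set_pmf p. pmf p x * (1 - cos (ang s t x)))"

lemma Re_FT_kap: "Re (FT kap s t) = - spectral_gap s t"
  unfolding FT_kap sum_kap by (simp add: ang_0 spectral_gap_def right_diff_distrib sum_subtractf sum_pmf_1)

lemma spectral_gap_nonneg: "spectral_gap s t \<ge> 0"
  unfolding spectral_gap_def by (intro sum_nonneg mult_nonneg_nonneg) auto

lemma spectral_gap_le: "spectral_gap s t \<le> cmod (FT kap s t)"
  using abs_Re_le_cmod[of "FT kap s t"] unfolding Re_FT_kap by linarith

text \<open>A vanishing gap makes the character trivial on every step, hence on every reachable
  point, in particular on \<open>w1\<close> and \<open>w2\<close>. The argument covers periodic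
  walks as well.\<close>

lemma spectral_gap_zero:
  assumes "spectral_gap s t = 0" shows "cis s = 1" "cis t = 1"
proof -
  have st: "cis (ang s t x) = 1" if "x \<in> set_pmf p" for x
  proof -
    have "pmf p x * (1 - cos (ang s t x)) = 0"
      using assms that unfolding spectral_gap_def by (subst (asm) sum_nonneg_eq_0_iff) (auto simp: finite_supp)
    hence c: "cos (ang s t x) = 1" using that by (simp add: set_pmf_iff)
    hence "sin (ang s t x) = 0" using sin_cos_squared_add[of "ang s t x"] by simp
    thus ?thesis using c by (simp add: complex_eq_iff)
  qed
  have "z \<in> set_pmf (walk_dist p n) \<Longrightarrow> cis (ang s t z) = 1" for n z
  proof (induction n arbitrary: z)
    case 0
    thus ?case by (simp add: ang_0)
  next
    case (Suc n)
    then obtain x y where "x \<in> set_pmf (walk_dist p n)" "y \<in> set_pmf p" "z = x + y" by auto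
    thus ?case using Suc.IH st by (simp add: ang_add flip: cis_mult)
  qed
  hence a: "z \<in> Z \<Longrightarrow> cis (ang s t z) = 1" for z using reach[of z] by (auto simp: pmf_positive_iff)
  have "ang s t w1 = s" "ang s t w2 = t" unfolding ang_def using c1_w[of 1 0] c2_w[of 1 0] c1_w[of 0 1] c2_w[of 0 1] by simp_all
  moreover have "w1 \<in> Z" "w2 \<in> Z" using Z_w[of 1 0] Z_w[of 0 1] by simp_all
  ultimately show "cis s = 1" "cis t = 1" using a by metis+
qed

lemma cis_1_imp: assumes "cis s = 1" "\<bar>s\<bar> \<le> pi" shows "s = 0"
proof -
  have "cos s = 1" using assms(1) by (simp add: complex_eq_iff)
  hence "cos \<bar>s\<bar> = cos 0" by simp
  moreover have "\<bar>s\<bar> \<in> {0..pi}" "(0::real) \<in> {0..pi}" using assms(2) by auto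
  ultimately have "\<bar>s\<bar> = 0" using cos_inj_pi[of "\<bar>s\<bar>" 0] by auto
  thus ?thesis by simp
qed

text \<open>Writing the phase as \<open>u * z + cnj u * cnj z\<close>, the squares drop out by
  sphericity and the mixed term leaves a multiple of \<open>(cmod u)^2\<close>.\<close>

lemma second_moment: "(\<Sum>x\<in>set_pmf p. pmf p x * (ang s t x)^2) = 2 * (cmod (of_real s * b1 + of_real t * b2))^2 * sig"
proof -
  let ?u = "of_real s * b1 + of_real t * b2"
  have "complex_of_real (\<Sum>x\<in>set_pmf p. pmf p x * (ang s t x)^2) = (\<Sum>x\<in>X. kap x * (of_real (ang s t x))^2)"
    unfolding sum_kap by (simp add: ang_0)
  also have "\<dots> = ?u^2 * kmom 2 0 + 2 * (?u * cnj ?u) * kmom (Suc 0) (Suc 0) + (cnj ?u)^2 * kmom 0 2"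
    unfolding ang_cplx kmom_def sum_distrib_left sum.distrib[symmetric]
    by (intro sum.cong refl) (simp add: power2_eq_square algebra_simps)
  also have "\<dots> = of_real (2 * (cmod ?u)^2 * sig)" by (simp add: kmoms complex_norm_square[symmetric] del: complex_cnj_add complex_cnj_mult)
  finally show ?thesis using of_real_eq_iff by blast
qed

text \<open>\<open>s\<close> and \<open>t\<close> are recovered as the phases at \<open>w1\<close>
  and \<open>w2\<close>; thus the quadratic form of the second moments is nondegenerate.\<close>

lemma u_lower: "\<bar>s\<bar> + \<bar>t\<bar> \<le> 2 * (cmod w1 + cmod w2) * cmod (of_real s * b1 + of_real t * b2)"
proof -
  let ?u = "of_real s * b1 + of_real t * b2"
  have *: "\<bar>ang s t w\<bar> \<le> 2 * cmod w * cmod ?u" for w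
  proof -
    have "\<bar>ang s t w\<bar> = cmod (?u * w + cnj ?u * cnj w)" unfolding ang_cplx[symmetric] by simp
    also have "\<dots> \<le> cmod (?u * w) + cmod (cnj ?u * cnj w)" by (rule norm_triangle_ineq)
    also have "\<dots> = 2 * cmod w * cmod ?u" unfolding norm_mult complex_mod_cnj by simp
    finally show ?thesis .
  qed
  have "ang s t w1 = s" "ang s t w2 = t" unfolding ang_def using c1_w[of 1 0] c2_w[of 1 0] c1_w[of 0 1] c2_w[of 0 1] by simp_all
  with *[of w1] *[of w2] show ?thesis by (simp add: algebra_simps)
qed

lemma spectral_gap_near_0:
  obtains q C where "q > 0" "C \<ge> 0" "\<And>s t. spectral_gap s t \<ge> q * (\<bar>s\<bar> + \<bar>t\<bar>)^2 - C * (\<bar>s\<bar> + \<bar>t\<bar>)^3"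
proof -
  define W where "W = 2 * (cmod w1 + cmod w2)"
  have W: "W > 0" using w1_nz by (simp add: W_def add_pos_nonneg)
  define C where "C = (\<Sum>x\<in>set_pmf p. pmf p x * (coord_bound * cmod x)^3)"
  have "spectral_gap s t \<ge> sig / W^2 * (\<bar>s\<bar> + \<bar>t\<bar>)^2 - C * (\<bar>s\<bar> + \<bar>t\<bar>)^3" for s t
  proof -
    let ?u = "cmod (of_real s * b1 + of_real t * b2)" and ?r = "\<bar>s\<bar> + \<bar>t\<bar>"
    have cosb: "1 - cos x \<ge> x^2 / 2 - \<bar>x\<bar>^3" for x :: real
    proof -
      have "\<bar>Re (cis x - (\<Sum>k<Suc 2. (\<i> * of_real x) ^ k / fact k))\<bar> \<le> \<bar>x\<bar> ^ Suc 2 / fact (Suc 2)"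
        by (rule order_trans[OF abs_Re_le_cmod iexp_taylor])
      also have "\<dots> \<le> \<bar>x\<bar>^3"
      proof -
        have "Suc 2 = 3" "fact 3 = (6::real)" by (simp_all add: fact_numeral)
        thus ?thesis using zero_le_power[of "\<bar>x\<bar>" 3] by (simp del: zero_le_power_abs)
      qed
      finally have "\<bar>cos x - 1 + x^2/2\<bar> \<le> \<bar>x\<bar>^3" by (simp add: eval_nat_numeral)
      thus ?thesis by linarith
    qed
    have "(?r)^2 \<le> (W * ?u)^2" using u_lower[of s t] by (intro power_mono) (auto simp: W_def)
    hence "sig / W^2 * ?r^2 \<le> sig / W^2 * (W * ?u)^2" using sig_pos by (intro mult_left_mono) auto
    also have "\<dots> = (\<Sum>x\<in>set_pmf p. pmf p x * (ang s t x)^2) / 2" using W unfolding second_moment by (simp add: power_mult_distrib)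
    finally have 1: "sig / W^2 * ?r^2 \<le> (\<Sum>x\<in>set_pmf p. pmf p x * (ang s t x)^2) / 2" .
    have 2: "(\<Sum>x\<in>set_pmf p. pmf p x * \<bar>ang s t x\<bar>^3) \<le> C * ?r^3"
      unfolding C_def sum_distrib_right
    proof (rule sum_mono)
      fix x assume "x \<in> set_pmf p"
      have "\<bar>ang s t x\<bar>^3 \<le> (?r * (coord_bound * cmod x))^3" by (intro power_mono ang_le) auto
      from mult_left_mono[OF this pmf_nonneg[of p x]] show "pmf p x * \<bar>ang s t x\<bar>^3 \<le> pmf p x * (coord_bound * cmod x)^3 * ?r^3"
        by (simp add: power_mult_distrib mult_ac)
    qed
    have "(\<Sum>x\<in>set_pmf p. pmf p x * ((ang s t x)^2 / 2 - \<bar>ang s t x\<bar>^3)) \<le> spectral_gap s t"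
      unfolding spectral_gap_def by (intro sum_mono mult_left_mono cosb) auto
    also have "(\<Sum>x\<in>set_pmf p. pmf p x * ((ang s t x)^2 / 2 - \<bar>ang s t x\<bar>^3)) =
        (\<Sum>x\<in>set_pmf p. pmf p x * (ang s t x)^2) / 2 - (\<Sum>x\<in>set_pmf p. pmf p x * \<bar>ang s t x\<bar>^3)"
      by (simp add: right_diff_distrib sum_subtractf sum_divide_distrib)
    finally show ?thesis using 1 2 by linarith
  qed
  moreover have "sig / W^2 > 0" using sig_pos W by simp
  moreover have "C \<ge> 0" unfolding C_def using coord_bound_ge1 by (intro sum_nonneg) auto
  ultimately show ?thesis using that by blast
qed

text \<open>Near the origin the quadratic term dominates the cubic error; on the rest of the box
  compactness applies, as the gap has no zero there.\<close>

lemma spectral_gap_lower: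
  obtains c where "c > 0" "\<And>s t. \<bar>s\<bar> \<le> pi \<Longrightarrow> \<bar>t\<bar> \<le> pi \<Longrightarrow> c * (\<bar>s\<bar> + \<bar>t\<bar>)^2 \<le> spectral_gap s t"
proof -
  obtain q C where q: "q > 0" "C \<ge> 0" "\<And>s t. spectral_gap s t \<ge> q * (\<bar>s\<bar> + \<bar>t\<bar>)^2 - C * (\<bar>s\<bar> + \<bar>t\<bar>)^3"
    using spectral_gap_near_0 by metis
  \<comment> \<open>\<open>C + 1\<close> in place of \<open>C\<close> avoids a division by
    0.\<close>
  define \<delta> where "\<delta> = q / 2 / (C + 1)"
  have d: "\<delta> > 0" using q by (simp add: \<delta>_def)
  have near: "q / 2 * (\<bar>s\<bar> + \<bar>t\<bar>)^2 \<le> spectral_gap s t" if "\<bar>s\<bar> + \<bar>t\<bar> \<le> \<delta>" for s t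
  proof -
    let ?r = "\<bar>s\<bar> + \<bar>t\<bar>"
    have "C * ?r \<le> (C + 1) * \<delta>" using that q by (intro mult_mono) auto
    also have "\<dots> = q / 2"
    proof -
      have "C + 1 \<noteq> 0" using q by linarith
      thus ?thesis unfolding \<delta>_def by (metis nonzero_mult_div_cancel_left times_divide_eq_right)
    qed
    finally have "C * ?r * ?r^2 \<le> q / 2 * ?r^2" by (intro mult_right_mono) auto
    hence "C * ?r^3 \<le> q / 2 * ?r^2" by (simp add: power3_eq_cube power2_eq_square mult_ac)
    thus ?thesis using q(3)[of s t] by linarith
  qed
  define K where "K = {x \<in> {-pi..pi} \<times> {-pi..pi}. \<delta> \<le> \<bar>fst x\<bar> + \<bar>snd x\<bar>}"
  have "compact K"
  proof -
    have "closed {x::real\<times>real. \<delta> \<le> \<bar>fst x\<bar> + \<bar>snd x\<bar>}" by (intro closed_Collect_le continuous_intros)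
    hence "compact (({-pi..pi} \<times> {-pi..pi}) \<inter> {x::real\<times>real. \<delta> \<le> \<bar>fst x\<bar> + \<bar>snd x\<bar>})"
      by (intro compact_Int_closed compact_Times) auto
    moreover have "K = ({-pi..pi} \<times> {-pi..pi}) \<inter> {x::real\<times>real. \<delta> \<le> \<bar>fst x\<bar> + \<bar>snd x\<bar>}"
      unfolding K_def by blast
    ultimately show ?thesis by simp
  qed
  moreover have "continuous_on K (\<lambda>x. spectral_gap (fst x) (snd x))"
    unfolding spectral_gap_def ang_def by (intro continuous_intros)
  ultimately have "\<exists>\<mu>>0. \<forall>x\<in>K. \<mu> \<le> spectral_gap (fst x) (snd x)"
  proof (cases "K = {}")
    case True
    thus ?thesis by (intro exI[of _ 1]) auto
  next
    case False
    assume "compact K" "continuous_on K (\<lambda>x. spectral_gap (fst x) (snd x))"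
    then obtain x where x: "x \<in> K" "\<And>y. y \<in> K \<Longrightarrow> spectral_gap (fst x) (snd x) \<le> spectral_gap (fst y) (snd y)"
      using continuous_attains_inf[of K "\<lambda>x. spectral_gap (fst x) (snd x)"] False by blast
    have "spectral_gap (fst x) (snd x) \<noteq> 0"
    proof
      assume z: "spectral_gap (fst x) (snd x) = 0"
      have "fst x = 0" "snd x = 0" using spectral_gap_zero[OF z] x(1) by (auto simp: K_def intro!: cis_1_imp)
      thus False using x(1) d by (simp add: K_def)
    qed
    hence "spectral_gap (fst x) (snd x) > 0" using spectral_gap_nonneg[of "fst x" "snd x"] by linarith
    thus ?thesis using x by blast
  qed
  then obtain \<mu> where \<mu>: "\<mu> > 0" "\<And>x. x \<in> K \<Longrightarrow> \<mu> \<le> spectral_gap (fst x) (snd x)" by blast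
  \<comment> \<open>The second entry accounts for
    \<open>\<bar>s\<bar> + \<bar>t\<bar> \<le> 2 * pi\<close> on the box.\<close>
  define c where "c = min (q / 2) (\<mu> / (2 * pi)^2)"
  show ?thesis
  proof (rule that[of c])
    show "c > 0" using q \<mu> by (simp add: c_def)
    fix s t :: real assume st: "\<bar>s\<bar> \<le> pi" "\<bar>t\<bar> \<le> pi"
    show "c * (\<bar>s\<bar> + \<bar>t\<bar>)^2 \<le> spectral_gap s t"
    proof (cases "\<bar>s\<bar> + \<bar>t\<bar> \<le> \<delta>")
      case True
      have "c * (\<bar>s\<bar> + \<bar>t\<bar>)^2 \<le> q / 2 * (\<bar>s\<bar> + \<bar>t\<bar>)^2" by (intro mult_right_mono) (auto simp: c_def)
      thus ?thesis using near[OF True] by linarith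
    next
      case False
      have "(\<bar>s\<bar> + \<bar>t\<bar>)^2 \<le> (2 * pi)^2" using st by (intro power_mono) auto
      hence "c * (\<bar>s\<bar> + \<bar>t\<bar>)^2 \<le> \<mu> / (2 * pi)^2 * (2 * pi)^2"
        using \<mu> q by (intro mult_mono) (auto simp: c_def)
      also have "\<dots> = \<mu>" by simp
      also have "\<dots> \<le> spectral_gap s t" using \<mu>(2)[of "(s, t)"] st False by (auto simp: K_def abs_le_iff)
      finally show ?thesis .
    qed
  qed
qed

text \<open>Valid for every real \<open>s\<close>, since \<open>t\<close> alone excludes a zero;
  functions that are differentiated and periodic in \<open>s\<close> on the whole line need this
  form.\<close>

lemma FT_kap_nz: assumes "t \<in> punctured" shows "FT kap s t \<noteq> 0"
proof
  assume "FT kap s t = 0"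
  hence "spectral_gap s t = 0" using Re_FT_kap[of s t] by simp
  from cis_1_imp[OF spectral_gap_zero(2)[OF this]] assms show False by (auto simp: punctured_def)
qed

lemma FT_kap_nz': assumes "\<bar>s\<bar> \<le> pi" "\<bar>t\<bar> \<le> pi" "(s, t) \<noteq> (0, 0)" shows "FT kap s t \<noteq> 0"
proof
  assume "FT kap s t = 0"
  hence "spectral_gap s t = 0" using Re_FT_kap[of s t] by simp
  from cis_1_imp[OF spectral_gap_zero(2)[OF this]] cis_1_imp[OF spectral_gap_zero(1)[OF this]] assms show False by auto
qed

text \<open>Mass and first moments of \<open>kap\<close> vanish, so its symbol has order 2, and the
  spectral gap bounds it from below by the same order.\<close>

lemma ord_inverse_FT_kap: "ord k (-2) (\<lambda>s t. inverse (FT kap s t))"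
proof -
  obtain c where c: "c > 0" "\<And>s t. \<bar>s\<bar> \<le> pi \<Longrightarrow> \<bar>t\<bar> \<le> pi \<Longrightarrow> c * (\<bar>s\<bar> + \<bar>t\<bar>)^2 \<le> spectral_gap s t" using spectral_gap_lower by metis
  have m: "mom kap i j = 0" if "i + j < 2" for i j
  proof -
    have "(i = 0 \<and> j = 0) \<or> (i = Suc 0 \<and> j = 0) \<or> (i = 0 \<and> j = Suc 0)" using that by auto
    thus ?thesis by (auto simp: mom_kap kmom00 kmoms)
  qed
  have "ord k (int 2 - int 0) (FT kap)" by (rule ord_FTj[where M = "k + 6"]) (use rapid_kap m in auto)
  hence k2: "ord k 2 (FT kap)" by simp
  show ?thesis
  proof (rule ord_inverse[OF c(1) _ FT_kap_nz k2])
    fix s t assume "t \<in> punctured" "\<bar>s\<bar> \<le> pi"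
    thus "c * (\<bar>s\<bar> + \<bar>t\<bar>)^2 \<le> cmod (FT kap s t)"
      using c(2)[of s t] spectral_gap_le[of s t] by (simp add: punctured_def)
  qed
qed

section \<open>The Fourier quotient and its integrability\<close>

definition quot_FT :: "(complex \<Rightarrow> complex) \<Rightarrow> real \<Rightarrow> real \<Rightarrow> complex" where
  "quot_FT g s t = FT g s t * inverse (FT kap s t)"

lemma ord_Q:
  assumes "rapid M g" "\<And>i j. i + j < N \<Longrightarrow> mom g i j = 0" "N + 4 \<le> M" "k + 6 \<le> M"
  shows "ord k (int N - 2) (quot_FT g)"
proof -
  have "ord k (int N - int 0) (FT g)" by (rule ord_FTj[OF assms(1-3)]) (use assms in auto)
  from ord_mult[OF this ord_inverse_FT_kap] have "ord k (int N - 2) (\<lambda>s t. FT g s t * inverse (FT kap s t))" by simp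
  moreover have "quot_FT g = (\<lambda>s t. FT g s t * inverse (FT kap s t))" by (simp add: quot_FT_def fun_eq_iff)
  ultimately show ?thesis by simp
qed


text \<open>Turns sums over the lattice into ordinary series, as used for measurability and for
  termwise integration.\<close>

definition lattice_enum :: "nat \<Rightarrow> complex" where "lattice_enum = from_nat_into Z"

lemma countable_Z: "countable Z"
proof -
  have "Z = (\<lambda>(m, n). of_int m * w1 + of_int n * w2) ` (UNIV :: (int \<times> int) set)"
    by (auto simp: lattice2_def)
  thus ?thesis by (metis countable_image countableI_type)
qed

lemma infinite_Z: "infinite Z"
proof
  assume "finite Z"
  moreover have "range (\<lambda>n::nat. of_int (int n) * w1 + of_int 0 * w2) \<subseteq> Z" using Z_w by blast
  ultimately have "finite (range (\<lambda>n::nat. of_int (int n) * w1 + of_int 0 * w2))" by (rule finite_subset[rotated])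
  moreover have "inj (\<lambda>n::nat. of_int (int n) * w1 + of_int 0 * w2)" using w1_nz by (auto simp: inj_on_def)
  ultimately show False using finite_imageD infinite_UNIV_nat by blast
qed

lemma bij_en: "bij_betw lattice_enum UNIV Z"
  unfolding lattice_enum_def by (rule bij_betw_from_nat_into[OF countable_Z infinite_Z])

lemma lattice_enum_Z: "lattice_enum n \<in> Z" using bij_en by (auto simp: bij_betw_def)

lemma infsum_en:
  assumes "f summable_on Z" shows "(\<lambda>n. f (lattice_enum n)) sums (infsum f Z)"
proof -
  have "(f has_sum infsum f Z) Z" using assms by simp
  hence "((\<lambda>n. f (lattice_enum n)) has_sum infsum f Z) UNIV" using has_sum_reindex_bij_betw[OF bij_en, of f] by simp
  thus ?thesis by (rule has_sum_imp_sums)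
qed

lemma continuous_cis_ang: "continuous_on UNIV (\<lambda>x. cis (ang (snd x) (fst x) w))"
  unfolding ang_def by (intro continuous_intros)

lemma FT_measurable:
  assumes "rapid M g" "4 \<le> M"
  shows "(\<lambda>x. FT g (snd x) (fst x)) \<in> borel_measurable borel"
proof -
  have "FT g s t = (\<Sum>n. g (lattice_enum n) * cis (ang s t (lattice_enum n)))" for s t
    using infsum_en[OF FTj_summable[OF assms(1), of 0 s t]] assms(2) by (simp add: FTj_def sums_iff)
  moreover have "(\<lambda>x. \<Sum>n. g (lattice_enum n) * cis (ang (snd x) (fst x) (lattice_enum n))) \<in> borel_measurable borel"
    by (intro borel_measurable_suminf borel_measurable_continuous_onI continuous_on_mult continuous_on_const continuous_cis_ang)
  ultimately show ?thesis by simp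
qed

definition box_ind :: "(real \<times> real) \<Rightarrow> real" where
  "box_ind x = indicator {-pi..pi} (fst x) * indicator {-pi..pi} (snd x)"

lemma box_ind_measurable [measurable]: "box_ind \<in> borel_measurable borel"
  unfolding box_ind_def by (simp add: borel_prod[symmetric])

text \<open>The pair is \<open>(t, s)\<close>: the inner integral runs over \<open>s\<close>, where
  integration by parts takes place. The phase has the sign opposite to the one in
  \<open>FTj\<close>.\<close>

definition quot_integrand :: "(complex \<Rightarrow> complex) \<Rightarrow> complex \<Rightarrow> real \<times> real \<Rightarrow> complex" where
  "quot_integrand g z x = of_real (box_ind x) * (quot_FT g (snd x) (fst x) * cis (- ang (snd x) (fst x) z))"

lemma quot_integrand_measurable:
  assumes "rapid M g" "4 \<le> M"
  shows "quot_integrand g z \<in> borel_measurable (lborel \<Otimes>\<^sub>M lborel)"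
proof -
  have 1: "(\<lambda>x. quot_FT g (snd x) (fst x)) \<in> borel_measurable borel"
    unfolding quot_FT_def by (intro borel_measurable_times borel_measurable_inverse FT_measurable[OF assms] FT_measurable[OF rapid_kap order_refl])
  have 2: "(\<lambda>x. cis (- ang (snd x) (fst x) z)) \<in> borel_measurable borel"
    unfolding ang_def by (intro borel_measurable_continuous_onI continuous_intros)
  have "quot_integrand g z \<in> borel_measurable borel" unfolding quot_integrand_def[abs_def]
    by (intro borel_measurable_times 1 2) measurable
  thus ?thesis by (simp add: lborel_prod)
qed

lemma quot_integrand_inner: "(\<integral>s. quot_integrand g z (t, s) \<partial>lborel) = of_real (indicator {-pi..pi} t) * (LBINT s:{-pi..pi}. quot_FT g s t * cis (- ang s t z))"
  unfolding quot_integrand_def box_ind_def set_lebesgue_integral_def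
  by (simp add: scaleR_conv_of_real mult.assoc)

text \<open>The line \<open>t = 0\<close>, excluded from all pointwise estimates, is a null
  set.\<close>

lemma AE_T: "AE t in lborel. t \<in> punctured \<or> indicator {-pi..pi} t = (0::real)"
  using AE_lborel_singleton[of "0::real"] by eventually_elim (auto simp: punctured_def indicator_def)

lemma quot_FT_continuous:
  assumes "rapid M g" "6 \<le> M" "t \<in> punctured"
  shows "continuous_on UNIV (\<lambda>s. quot_FT g s t)"
proof -
  have "ord 0 (int 0 - 2) (quot_FT g)" by (rule ord_Q[OF assms(1)]) (use assms in auto)
  thus ?thesis using assms(3) by (simp add: ord0_def)
qed

lemma quot_integrand_norm_inner_le:
  assumes g: "rapid M g" "6 \<le> M" "5 \<le> M" and m: "mom g 0 0 = 0"
  obtains C where "C \<ge> 0" "\<And>t. t \<in> punctured \<Longrightarrow> (LBINT s:{-pi..pi}. cmod (quot_FT g s t)) \<le> C * \<bar>t\<bar> powr (-1/2)"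
proof -
  have "ord 0 (int 1 - 2) (quot_FT g)" by (rule ord_Q[OF g(1)]) (use g m in auto)
  then obtain C where C: "C \<ge> 0" "\<And>t s. t \<in> punctured \<Longrightarrow> \<bar>s\<bar> \<le> pi \<Longrightarrow> cmod (quot_FT g s t) \<le> C * (\<bar>s\<bar> + \<bar>t\<bar>) powi (-1)"
    unfolding ord.simps ord0_def by auto
  obtain A where A: "A \<ge> 0" "\<And>t. t \<in> punctured \<Longrightarrow> (LBINT s:{-pi..pi}. (\<bar>s\<bar> + \<bar>t\<bar>) powi (-1)) \<le> A * \<bar>t\<bar> powr (-1/2)"
    using int_rho by metis
  show ?thesis
  proof (rule that[of "C * A"])
    show "C * A \<ge> 0" using C A by simp
    fix t assume t: "t \<in> punctured"
    have "(LBINT s:{-pi..pi}. cmod (quot_FT g s t)) \<le> (LBINT s:{-pi..pi}. C * (\<bar>s\<bar> + \<bar>t\<bar>) powi (-1))"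
    proof (rule set_integral_mono)
      show "set_integrable lborel {-pi..pi} (\<lambda>s. cmod (quot_FT g s t))"
        by (rule set_integrable_norm[OF set_int_cont[OF quot_FT_continuous[OF g(1,2) t]]])
      show "set_integrable lborel {-pi..pi} (\<lambda>s. C * (\<bar>s\<bar> + \<bar>t\<bar>) powi (-1))"
        unfolding set_integrable_def using t
        by (intro borel_integrable_compact continuous_intros) (auto simp: punctured_def)
    qed (use C(2)[OF t] in auto)
    also have "\<dots> = C * (LBINT s:{-pi..pi}. (\<bar>s\<bar> + \<bar>t\<bar>) powi (-1))" by simp
    also have "\<dots> \<le> C * (A * \<bar>t\<bar> powr (-1/2))" by (intro mult_left_mono A t C)
    finally show "(LBINT s:{-pi..pi}. cmod (quot_FT g s t)) \<le> C * A * \<bar>t\<bar> powr (-1/2)" by simp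
  qed
qed

text \<open>An integrand of order -2 in the plane would permit a logarithmic divergence. The
  vanishing mass of \<open>g\<close> raises the order to -1, and the inner integral is then bounded
  by a multiple of \<open>\<bar>t\<bar> powr (-1/2)\<close>.\<close>

lemma quot_integrand_integrable:
  assumes g: "rapid M g" "6 \<le> M" and m: "mom g 0 0 = 0"
  shows "integrable (lborel \<Otimes>\<^sub>M lborel) (quot_integrand g z)"
proof (rule lborel_pair.Fubini_integrable)
  have 4: "4 \<le> M" "5 \<le> M" using g(2) by auto
  show meas: "quot_integrand g z \<in> borel_measurable (lborel \<Otimes>\<^sub>M lborel)" by (rule quot_integrand_measurable[OF g(1) 4(1)])
  have inner: "(\<integral>s. norm (quot_integrand g z (t, s)) \<partial>lborel) = indicator {-pi..pi} t * (LBINT s:{-pi..pi}. cmod (quot_FT g s t))" for t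
    unfolding quot_integrand_def box_ind_def set_lebesgue_integral_def
    by (simp add: norm_mult mult.assoc)
  obtain C where C: "C \<ge> 0" "\<And>t. t \<in> punctured \<Longrightarrow> (LBINT s:{-pi..pi}. cmod (quot_FT g s t)) \<le> C * \<bar>t\<bar> powr (-1/2)"
    using quot_integrand_norm_inner_le[OF g 4(2) m] by metis
  show "integrable lborel (\<lambda>t. \<integral>s. norm (quot_integrand g z (t, s)) \<partial>lborel)"
  proof (rule Bochner_Integration.integrable_bound)
    show "integrable lborel (\<lambda>t. indicator {-pi..pi} t *\<^sub>R (C * \<bar>t\<bar> powr (-1/2)))"
      using set_integrable_abs_powr[of "-1/2"] by (simp add: set_integrable_def mult.left_commute)
    show "(\<lambda>t. \<integral>s. norm (quot_integrand g z (t, s)) \<partial>lborel) \<in> borel_measurable lborel"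
      using meas by measurable
    show "AE t in lborel. norm (\<integral>s. norm (quot_integrand g z (t, s)) \<partial>lborel) \<le> norm (indicator {-pi..pi} t *\<^sub>R (C * \<bar>t\<bar> powr (-1/2)))"
      using AE_T
    proof eventually_elim
      case (elim t)
      have "(LBINT s:{-pi..pi}. cmod (quot_FT g s t)) \<ge> 0" unfolding set_lebesgue_integral_def by (rule integral_nonneg_AE) simp
      hence "norm (\<integral>s. norm (quot_integrand g z (t, s)) \<partial>lborel) = indicator {-pi..pi} t * (LBINT s:{-pi..pi}. cmod (quot_FT g s t))"
        unfolding inner by simp
      also have "\<dots> \<le> indicator {-pi..pi} t * (C * \<bar>t\<bar> powr (-1/2))"
        using elim
      proof
        assume "t \<in> punctured"
        thus ?thesis by (intro mult_left_mono C) auto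
      next
        assume "indicator {-pi..pi} t = (0::real)"
        thus ?thesis by (simp only: mult_zero_left)
      qed
      also have "\<dots> \<le> norm (indicator {-pi..pi} t *\<^sub>R (C * \<bar>t\<bar> powr (-1/2)))" by simp
      finally show ?case .
    qed
  qed
  show "AE t in lborel. integrable lborel (\<lambda>s. quot_integrand g z (t, s))"
    using AE_T
  proof eventually_elim
    case (elim t)
    show ?case
    proof (cases "t \<in> punctured")
      case True
      have "set_integrable lborel {-pi..pi} (\<lambda>s. of_real (indicator {-pi..pi} t) * (quot_FT g s t * cis (- ang s t z)))"
        unfolding ang_def by (intro set_int_cont continuous_intros quot_FT_continuous[OF g True])
      thus ?thesis unfolding set_integrable_def quot_integrand_def box_ind_def
        by (simp add: scaleR_conv_of_real mult_ac)
    next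
      case False
      thus ?thesis using elim by (simp add: quot_integrand_def box_ind_def)
    qed
  qed
qed

definition fourier_sol :: "(complex \<Rightarrow> complex) \<Rightarrow> complex \<Rightarrow> complex" where
  "fourier_sol g z = (\<integral>x. quot_integrand g z x \<partial>(lborel \<Otimes>\<^sub>M lborel)) / of_real ((2 * pi)^2)"

lemma fourier_sol_iterated:
  assumes g: "rapid M g" "6 \<le> M" and m: "mom g 0 0 = 0"
  shows "(\<integral>x. quot_integrand g z x \<partial>(lborel \<Otimes>\<^sub>M lborel)) = (LBINT t:{-pi..pi}. LBINT s:{-pi..pi}. quot_FT g s t * cis (- ang s t z))"
  unfolding lborel_pair.integral_fst'[OF quot_integrand_integrable[OF assms], symmetric] quot_integrand_inner
  by (simp add: set_lebesgue_integral_def scaleR_conv_of_real)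

text \<open>The quotient has order \<open>N - 2\<close> with \<open>N\<close> derivatives in
  \<open>s\<close>, which fits the interpolated estimate for \<open>K = N - 1\<close>. The phase in
  \<open>t\<close> has modulus 1 and is estimated trivially.\<close>

lemma fourier_sol_bound_c1:
  assumes g: "rapid M g" and m: "\<And>i j. i + j < N \<Longrightarrow> mom g i j = 0" and N: "N \<ge> 1" "N + 6 \<le> M"
  obtains C where "C \<ge> 0" "\<And>z. z \<in> Z \<Longrightarrow> c1 z \<noteq> 0 \<Longrightarrow> cmod (fourier_sol g z) \<le> C * \<bar>c1 z\<bar> powr (- real (N - 1) - 1/3)"
proof -
  have "ord (Suc (N - 1)) (int (N - 1) - 1) (quot_FT g)"
  proof -
    have "int (N - 1) - 1 = int N - 2" "Suc (N - 1) = N" using N by auto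
    thus ?thesis using ord_Q[OF g m, of N] N by simp
  qed
  from ord_osc_interpolate[OF this] obtain C where C0: "C \<ge> 0" and C: "\<forall>t\<in>punctured. \<forall>m::int. m \<noteq> 0 \<longrightarrow>
     cmod (LBINT s:{-pi..pi}. quot_FT g s t * cis (- (of_int m * s))) \<le> C * \<bar>of_int m\<bar> powr (- real (N - 1) - 1/3) * \<bar>t\<bar> powr (-5/6)"
    by (elim exE conjE)
  define B where "B = (LBINT t:{-pi..pi}. \<bar>t\<bar> powr (-5/6))"
  have B: "B \<ge> 0" unfolding B_def set_lebesgue_integral_def by (rule integral_nonneg_AE) simp
  have m0: "mom g 0 0 = 0" using m[of 0 0] N by simp
  have M6: "6 \<le> M" using N by simp
  show ?thesis
  proof (rule that[of "C * B / (2 * pi)^2"])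
    show "C * B / (2 * pi)^2 \<ge> 0" using C0 B by simp
    fix z assume z: "z \<in> Z" "c1 z \<noteq> 0"
    then obtain k where k: "c1 z = of_int k" "k \<noteq> 0" by (auto simp: Z_iff elim!: Ints_cases)
    let ?I = "\<lambda>t. LBINT s:{-pi..pi}. quot_FT g s t * cis (- ang s t z)"
    let ?p = "\<bar>c1 z\<bar> powr (- real (N - 1) - 1/3)"
    have I: "cmod (?I t) \<le> C * ?p * \<bar>t\<bar> powr (-5/6)" if t: "t \<in> punctured" for t
    proof -
      have "?I t = (LBINT s:{-pi..pi}. cis (- (t * c2 z)) * (quot_FT g s t * cis (- (of_int k * s))))"
      proof -
        have e: "cis (- ang s t z) = cis (- (t * c2 z)) * cis (- (of_int k * s))" for s
          by (simp add: ang_def k cis_mult algebra_simps)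
        show ?thesis by (simp only: e mult.left_commute)
      qed
      also have "\<dots> = cis (- (t * c2 z)) * (LBINT s:{-pi..pi}. quot_FT g s t * cis (- (of_int k * s)))" by simp
      finally have "cmod (?I t) = cmod (LBINT s:{-pi..pi}. quot_FT g s t * cis (- (of_int k * s)))"
        by (simp only: norm_mult norm_cis mult_1)
      thus ?thesis using C[rule_format, OF t k(2)] unfolding k by simp
    qed
    have "cmod (LBINT t:{-pi..pi}. ?I t) \<le> (\<integral>t. norm (indicator {-pi..pi} t *\<^sub>R ?I t) \<partial>lborel)"
      unfolding set_lebesgue_integral_def[of lborel "{-pi..pi}" ?I] by (rule integral_norm_bound)
    also have "\<dots> \<le> (\<integral>t. indicator {-pi..pi} t *\<^sub>R (C * ?p * \<bar>t\<bar> powr (-5/6)) \<partial>lborel)"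
    proof (rule integral_mono_AE)
      show "integrable lborel (\<lambda>t. norm (indicator {-pi..pi} t *\<^sub>R ?I t))"
        using integrable_norm[OF lborel_pair.integrable_fst'[OF quot_integrand_integrable[OF g M6 m0, of z]]] unfolding quot_integrand_inner
        by (simp add: scaleR_conv_of_real)
      show "integrable lborel (\<lambda>t. indicator {-pi..pi} t *\<^sub>R (C * ?p * \<bar>t\<bar> powr (-5/6)))"
        using set_integrable_mult_right[OF set_integrable_abs_powr[of "-5/6"], of "C * ?p"] by (simp add: set_integrable_def)
      show "AE t in lborel. norm (indicator {-pi..pi} t *\<^sub>R ?I t) \<le> indicator {-pi..pi} t *\<^sub>R (C * ?p * \<bar>t\<bar> powr (-5/6))"
        using AE_T
      proof eventually_elim
        case (elim t)
        have "norm (indicator {-pi..pi} t *\<^sub>R ?I t) = indicator {-pi..pi} t * cmod (?I t)" by simp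
        also have "\<dots> \<le> indicator {-pi..pi} t * (C * ?p * \<bar>t\<bar> powr (-5/6))"
          using elim
        proof
          assume "t \<in> punctured"
          thus ?thesis by (intro mult_left_mono I) auto
        next
          assume "indicator {-pi..pi} t = (0::real)"
          thus ?thesis by (simp only: mult_zero_left)
        qed
        finally show ?case by simp
      qed
    qed
    also have "\<dots> = C * ?p * B"
      unfolding B_def set_integral_mult_right[symmetric] by (simp only: set_lebesgue_integral_def)
    finally show "cmod (fourier_sol g z) \<le> C * B / (2 * pi)^2 * ?p"
      unfolding fourier_sol_def fourier_sol_iterated[OF g M6 m0] by (simp add: norm_divide norm_mult norm_power field_simps)
  qed
qed


section \<open>Fourier inversion on the box\<close>

lemma box_ind_eq: "box_ind x = indicator ({-pi..pi} \<times> {-pi..pi}) x"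
  by (cases x) (simp add: box_ind_def indicator_def)

lemma box_ind_cont_integrable:
  fixes f :: "real \<times> real \<Rightarrow> complex"
  assumes "continuous_on UNIV f"
  shows "integrable (lborel \<Otimes>\<^sub>M lborel) (\<lambda>x. of_real (box_ind x) * f x)"
proof -
  have "integrable lborel (\<lambda>x. indicator ({-pi..pi} \<times> {-pi..pi}) x *\<^sub>R f x)"
    by (rule borel_integrable_compact) (auto intro: compact_Times continuous_on_subset[OF assms])
  thus ?thesis by (simp add: lborel_prod box_ind_eq scaleR_conv_of_real)
qed

lemma box_ind_cis_integral:
  assumes "w \<in> Z"
  shows "(\<integral>x. of_real (box_ind x) * cis (ang (snd x) (fst x) w) \<partial>(lborel \<Otimes>\<^sub>M lborel)) = (if w = 0 then of_real ((2 * pi)^2) else 0)"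
proof -
  obtain k l where kl: "c1 w = of_int k" "c2 w = of_int l" using assms by (auto simp: Z_iff elim!: Ints_cases)
  have i: "integrable (lborel \<Otimes>\<^sub>M lborel) (\<lambda>x. of_real (box_ind x) * cis (ang (snd x) (fst x) w))"
    by (rule box_ind_cont_integrable[OF continuous_cis_ang])
  have e: "of_real (box_ind (t, s)) * cis (ang s t w) = (of_real (indicator {-pi..pi} t) * cis (of_int l * t)) * (indicator {-pi..pi} s *\<^sub>R cis (of_int k * s))" for s t
    by (simp add: box_ind_def ang_def kl scaleR_conv_of_real mult_ac cis_mult add.commute)
  have "(\<integral>x. of_real (box_ind x) * cis (ang (snd x) (fst x) w) \<partial>(lborel \<Otimes>\<^sub>M lborel))
      = (\<integral>t. (\<integral>s. of_real (box_ind (t, s)) * cis (ang s t w) \<partial>lborel) \<partial>lborel)"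
    using lborel_pair.integral_fst'[OF i] by simp
  also have "\<dots> = (\<integral>t. (of_real (indicator {-pi..pi} t) * cis (of_int l * t)) * (LBINT s:{-pi..pi}. cis (of_int k * s)) \<partial>lborel)"
    unfolding e set_lebesgue_integral_def by (simp only: integral_mult_right_zero)
  also have "\<dots> = (LBINT t:{-pi..pi}. cis (of_int l * t)) * (LBINT s:{-pi..pi}. cis (of_int k * s))"
    unfolding set_lebesgue_integral_def scaleR_conv_of_real by (simp only: integral_mult_left_zero)
  also have "\<dots> = (if w = 0 then of_real ((2 * pi)^2) else 0)"
  proof -
    have "w = 0 \<longleftrightarrow> k = 0 \<and> l = 0"
    proof
      assume "w = 0"
      thus "k = 0 \<and> l = 0" using kl c1_0 c2_0 by simp
    next
      assume "k = 0 \<and> l = 0"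
      thus "w = 0" using coord[of w] kl by simp
    qed
    thus ?thesis unfolding cis_sym_int by (auto simp: power2_eq_square)
  qed
  finally show ?thesis .
qed

text \<open>Termwise integration is justified by absolute summability of \<open>g\<close>;
  orthogonality leaves the one term with \<open>lattice_enum n = z\<close>.\<close>

lemma FT_inversion:
  assumes g: "rapid M g" "6 \<le> M" and z: "z \<in> Z"
  shows "(\<integral>x. of_real (box_ind x) * (FT g (snd x) (fst x) * cis (- ang (snd x) (fst x) z)) \<partial>(lborel \<Otimes>\<^sub>M lborel)) = of_real ((2 * pi)^2) * g z"
proof -
  let ?M = "lborel \<Otimes>\<^sub>M lborel :: (real \<times> real) measure"
  let ?f = "\<lambda>n x. of_real (box_ind x) * (g (lattice_enum n) * cis (ang (snd x) (fst x) (lattice_enum n - z)))"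
  have FTs: "(\<lambda>n. g (lattice_enum n) * cis (ang s t (lattice_enum n))) sums FT g s t" for s t
    using infsum_en[OF FTj_summable[OF g(1), of 0 s t]] g(2) by (simp add: FTj_def)
  have fs: "(\<lambda>n. ?f n x) sums (of_real (box_ind x) * (FT g (snd x) (fst x) * cis (- ang (snd x) (fst x) z)))" for x
  proof -
    have "?f n x = of_real (box_ind x) * ((g (lattice_enum n) * cis (ang (snd x) (fst x) (lattice_enum n))) * cis (- ang (snd x) (fst x) z))" for n
      by (simp add: ang_diff cis_mult mult.assoc)
    thus ?thesis by (simp only:) (intro sums_mult sums_mult2 FTs)
  qed
  have i: "integrable ?M (?f n)" for n
    by (intro box_ind_cont_integrable continuous_on_mult continuous_on_const continuous_cis_ang)
  have gs: "summable (\<lambda>n. cmod (g (lattice_enum n)))"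
  proof -
    have "(\<lambda>z. cmod (g z) * 1) summable_on Z"
      by (rule rapid_summable_real[OF g(1), where D = 1 and n = 0]) (use g in auto)
    from infsum_en[where f = "\<lambda>z. complex_of_real (cmod (g z))"] this
    have "(\<lambda>n. complex_of_real (cmod (g (lattice_enum n)))) sums infsum (\<lambda>z. complex_of_real (cmod (g z))) Z"
      by (simp add: summable_on_of_real)
    from sums_Re[OF this] show ?thesis by (auto simp: sums_iff)
  qed
  have nf: "norm (?f n x) = cmod (g (lattice_enum n)) * box_ind x" for n x
    by (simp add: norm_mult box_ind_def)
  have "(\<lambda>n. integral\<^sup>L ?M (?f n)) sums (\<integral>x. (\<Sum>n. ?f n x) \<partial>?M)"
  proof (rule sums_integral[OF i])
    show "AE x in ?M. summable (\<lambda>n. norm (?f n x))" unfolding nf by (intro always_eventually allI summable_mult2 gs)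
    show "summable (\<lambda>n. \<integral>x. norm (?f n x) \<partial>?M)" unfolding nf by (simp add: summable_mult2 gs)
  qed
  also have "(\<lambda>n. integral\<^sup>L ?M (?f n)) = (\<lambda>n. if n = inv_into UNIV lattice_enum z then of_real ((2 * pi)^2) * g z else 0)"
  proof
    fix n
    have "integral\<^sup>L ?M (?f n) = g (lattice_enum n) * (\<integral>x. of_real (box_ind x) * cis (ang (snd x) (fst x) (lattice_enum n - z)) \<partial>?M)"
      by (subst integral_mult_right_zero[symmetric]) (simp add: mult.left_commute)
    also have "\<dots> = (if lattice_enum n = z then of_real ((2 * pi)^2) * g z else 0)"
      using box_ind_cis_integral[OF Z_diff[OF lattice_enum_Z z], of n] by auto
    also have "lattice_enum n = z \<longleftrightarrow> n = inv_into UNIV lattice_enum z"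
      using bij_en z by (metis bij_betw_def f_inv_into_f inv_into_f_f UNIV_I)
    finally show "integral\<^sup>L ?M (?f n) = (if n = inv_into UNIV lattice_enum z then of_real ((2 * pi)^2) * g z else 0)" .
  qed
  finally have "(\<lambda>n. if n = inv_into UNIV lattice_enum z then of_real ((2 * pi)^2) * g z else 0) sums (\<integral>x. (\<Sum>n. ?f n x) \<partial>?M)" .
  moreover have "(\<lambda>n. if n = inv_into UNIV lattice_enum z then of_real ((2 * pi)^2) * g z else 0) sums (of_real ((2 * pi)^2) * g z)"
    by (rule sums_single)
  ultimately have "(\<integral>x. (\<Sum>n. ?f n x) \<partial>?M) = of_real ((2 * pi)^2) * g z" by (rule sums_unique2)
  moreover have "(\<Sum>n. ?f n x) = of_real (box_ind x) * (FT g (snd x) (fst x) * cis (- ang (snd x) (fst x) z))" for x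
    using fs[of x] by (rule sums_unique[symmetric])
  ultimately show ?thesis by simp
qed

text \<open>Shifts of \<open>z\<close> turn into phases, so \<open>lap\<close> multiplies the
  integrand by \<open>FT kap\<close>, which cancels the denominator on the box except at the origin,
  a null set.\<close>

lemma lap_U:
  assumes g: "rapid M g" "6 \<le> M" and m: "mom g 0 0 = 0" and z: "z \<in> Z"
  shows "lap (fourier_sol g) z = g z"
proof -
  let ?M = "lborel \<Otimes>\<^sub>M lborel :: (real \<times> real) measure"
  have "lap (fourier_sol g) z = (\<Sum>x\<in>X. kap x * (\<integral>y. quot_integrand g (z - x) y \<partial>?M)) / of_real ((2 * pi)^2)"
    by (simp add: lap_def conv_def fourier_sol_def sum_divide_distrib)
  also have "(\<Sum>x\<in>X. kap x * (\<integral>y. quot_integrand g (z - x) y \<partial>?M)) = (\<integral>y. (\<Sum>x\<in>X. kap x * quot_integrand g (z - x) y) \<partial>?M)"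
    by (subst Bochner_Integration.integral_sum) (auto intro!: quot_integrand_integrable[OF g m])
  also have "\<dots> = (\<integral>y. of_real (box_ind y) * (FT g (snd y) (fst y) * cis (- ang (snd y) (fst y) z)) \<partial>?M)"
  proof (rule integral_cong_AE)
    show "(\<lambda>y. \<Sum>x\<in>X. kap x * quot_integrand g (z - x) y) \<in> borel_measurable ?M"
      by (intro borel_measurable_sum borel_measurable_times borel_measurable_const quot_integrand_measurable[OF g(1)]) (use g in auto)
    have "(\<lambda>y. of_real (box_ind y) * (FT g (snd y) (fst y) * cis (- ang (snd y) (fst y) z))) \<in> borel_measurable borel"
    proof (intro borel_measurable_times FT_measurable[OF g(1)])
      show "(\<lambda>y. cis (- ang (snd y) (fst y) z)) \<in> borel_measurable borel"
        unfolding ang_def by (intro borel_measurable_continuous_onI continuous_intros)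
    qed (use g in \<open>auto intro: borel_measurable_of_real\<close>)
    thus "(\<lambda>y. of_real (box_ind y) * (FT g (snd y) (fst y) * cis (- ang (snd y) (fst y) z))) \<in> borel_measurable ?M"
      by (simp add: lborel_prod)
    have "AE y in ?M. y \<noteq> (0, 0)"
      unfolding lborel_prod by (rule AE_lborel_singleton)
    thus "AE y in ?M. (\<Sum>x\<in>X. kap x * quot_integrand g (z - x) y) = of_real (box_ind y) * (FT g (snd y) (fst y) * cis (- ang (snd y) (fst y) z))"
    proof eventually_elim
      case (elim y)
      obtain t s where y: "y = (t, s)" by (cases y)
      have "(\<Sum>x\<in>X. kap x * quot_integrand g (z - x) y) = (\<Sum>x\<in>X. (of_real (box_ind y) * quot_FT g s t * cis (- ang s t z)) * (kap x * cis (ang s t x)))"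
        by (intro sum.cong refl) (simp add: quot_integrand_def y ang_diff cis_mult mult_ac)
      also have "\<dots> = (of_real (box_ind y) * quot_FT g s t * cis (- ang s t z)) * FT kap s t"
        unfolding sum_distrib_left[symmetric] FT_kap ..
      also have "\<dots> = of_real (box_ind y) * (FT g s t * cis (- ang s t z))"
      proof (cases "box_ind y = 0")
        case False
        hence "\<bar>s\<bar> \<le> pi" "\<bar>t\<bar> \<le> pi" by (auto simp: box_ind_def y indicator_def abs_le_iff split: if_splits)
        hence "FT kap s t \<noteq> 0" using elim y by (intro FT_kap_nz') auto
        thus ?thesis by (simp add: quot_FT_def)
      qed simp
      finally show ?case by (simp add: y)
    qed
  qed
  also have "\<dots> = of_real ((2 * pi)^2) * g z" by (rule FT_inversion[OF g z])
  finally show ?thesis by simp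
qed

end

section \<open>Decay of the Fourier solution in both coordinates\<close>

lemma lattice2_swap: "lattice2 w2 w1 = lattice2 w1 w2"
  unfolding lattice2_def by (metis (no_types, opaque_lifting) add.commute)

lemma spherical_walk_swap: "spherical_walk w1 w2 p \<Longrightarrow> spherical_walk w2 w1 p"
  unfolding spherical_walk_def lattice2_swap[of w1 w2] lin_indep2_def
  by (auto simp: algebra_simps)

context spherical_walk
begin

text \<open>Only derivatives in \<open>s\<close> have been controlled. Swapping the basis vectors
  exchanges \<open>s\<close> and \<open>t\<close>; the two Fourier solutions agree because the order
  of integration may be exchanged.\<close>

lemma fourier_sol_bound_c2:
  assumes g: "rapid M g" and m: "\<And>i j. i + j < N \<Longrightarrow> mom g i j = 0" and N: "N \<ge> 1" "N + 6 \<le> M"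
  shows "\<exists>C\<ge>0. \<forall>z\<in>Z. c2 z \<noteq> 0 \<longrightarrow> cmod (fourier_sol g z) \<le> C * \<bar>c2 z\<bar> powr (- real (N - 1) - 1/3)"
proof -
  interpret sw: spherical_walk w2 w1 p by (rule spherical_walk_swap) unfold_locales
  have L: "lattice2 w2 w1 = Z" by (rule lattice2_swap)
  have d: "sw.det = - det" by (simp add: sw.det_def det_def algebra_simps)
  have c: "sw.c1 = c2" "sw.c2 = c1"
    unfolding sw.c1_def c2_def sw.c2_def c1_def d using det_nz by (auto simp: fun_eq_iff field_simps)
  have a: "sw.ang s t w = ang t s w" for s t w by (simp add: sw.ang_def ang_def c)
  have F: "sw.FTj h 0 s t = FTj h 0 t s" for h s t unfolding sw.FTj_def FTj_def a L by simp
  have quot_FT': "sw.quot_FT g s t = quot_FT g t s" for s t unfolding sw.quot_FT_def quot_FT_def F ..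
  have quot_integrand': "sw.quot_integrand g z (s, t) = quot_integrand g z (t, s)" for s t z by (simp add: sw.quot_integrand_def quot_integrand_def quot_FT' a sw.box_ind_def box_ind_def)
  have fourier_sol': "sw.fourier_sol g z = fourier_sol g z" for z
  proof -
    have "(\<integral>x. sw.quot_integrand g z x \<partial>(lborel \<Otimes>\<^sub>M lborel)) = (\<integral>x. quot_integrand g z x \<partial>(lborel \<Otimes>\<^sub>M lborel))"
    proof (cases "integrable (lborel \<Otimes>\<^sub>M lborel) (quot_integrand g z)")
      case True
      have "(\<lambda>(x, y). quot_integrand g z (y, x)) = sw.quot_integrand g z" by (auto simp: fun_eq_iff quot_integrand')
      with lborel_pair.integral_product_swap[of "quot_integrand g z"] True show ?thesis by auto
    next
      case False
      have "mom g 0 0 = 0" using m[of 0 0] N by simp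
      hence "integrable (lborel \<Otimes>\<^sub>M lborel) (quot_integrand g z)" using quot_integrand_integrable[OF g] N by simp
      with False show ?thesis by simp
    qed
    thus ?thesis by (simp add: sw.fourier_sol_def fourier_sol_def)
  qed
  have g': "sw.rapid M g" using g by (simp add: sw.rapid_def rapid_def L)
  have m': "sw.mom g i j = 0" if "i + j < N" for i j using m[OF that] by (simp add: sw.mom_def mom_def L)
  obtain C where "C \<ge> 0" "\<And>z. z \<in> lattice2 w2 w1 \<Longrightarrow> sw.c1 z \<noteq> 0 \<Longrightarrow> cmod (sw.fourier_sol g z) \<le> C * \<bar>sw.c1 z\<bar> powr (- real (N - 1) - 1/3)"
    using sw.fourier_sol_bound_c1[OF g' m' N] by metis
  thus ?thesis unfolding L c fourier_sol' by blast
qed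

text \<open>At each lattice point the larger coordinate is comparable to \<open>cmod z\<close>, and
  the bound in that coordinate is used.\<close>

theorem fourier_solve:
  assumes g: "rapid M g" and m: "\<And>i j. i + j < N \<Longrightarrow> mom g i j = 0" and N: "N \<ge> 1" "N + 6 \<le> M"
  shows "\<exists>u. (\<forall>z\<in>Z. lap u z = g z) \<and> (\<exists>C. \<forall>z\<in>Z. z \<noteq> 0 \<longrightarrow> cmod (u z) \<le> C * cmod z powr (- real (N - 1) - 1/3))"
proof (intro exI[of _ "fourier_sol g"] conjI ballI)
  have m0: "mom g 0 0 = 0" using m[of 0 0] N by simp
  fix z assume "z \<in> Z"
  thus "lap (fourier_sol g) z = g z" using lap_U[OF g _ m0] N by simp
next
  let ?e = "- real (N - 1) - 1/3"
  obtain C where C: "C \<ge> 0" "\<And>z. z \<in> Z \<Longrightarrow> c1 z \<noteq> 0 \<Longrightarrow> cmod (fourier_sol g z) \<le> C * \<bar>c1 z\<bar> powr ?e"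
    using fourier_sol_bound_c1[OF g m N] by metis
  obtain D where D: "D \<ge> 0" "\<And>z. z \<in> Z \<Longrightarrow> c2 z \<noteq> 0 \<Longrightarrow> cmod (fourier_sol g z) \<le> D * \<bar>c2 z\<bar> powr ?e"
    using fourier_sol_bound_c2[OF g m N] by metis
  define W where "W = cmod w1 + cmod w2"
  have W: "W > 0" using w1_nz by (simp add: W_def add_pos_nonneg)
  have "cmod (fourier_sol g z) \<le> (max C D * W powr (- ?e)) * cmod z powr ?e" if z: "z \<in> Z" "z \<noteq> 0" for z
  proof -
    have key: "a powr ?e \<le> W powr (- ?e) * cmod z powr ?e" if "cmod z \<le> a * W" "a > 0" for a
    proof -
      have "cmod z / W \<le> a" "cmod z / W > 0" using that W z by (auto simp: field_simps)
      hence "a powr ?e \<le> (cmod z / W) powr ?e" by (intro powr_mono2') auto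
      also have "\<dots> = W powr (- ?e) * cmod z powr ?e" using W by (simp add: powr_divide powr_minus field_simps)
      finally show ?thesis .
    qed
    have n: "cmod z \<le> \<bar>c1 z\<bar> * cmod w1 + \<bar>c2 z\<bar> * cmod w2" by (rule norm_le_coord)
    show ?thesis
    proof (cases "\<bar>c1 z\<bar> \<ge> \<bar>c2 z\<bar>")
      case True
      have le: "cmod z \<le> \<bar>c1 z\<bar> * W" using n mult_right_mono[OF True, of "cmod w2"] by (simp add: W_def algebra_simps)
      have pos: "\<bar>c1 z\<bar> > 0" using le z by (cases "c1 z = 0") auto
      have "cmod (fourier_sol g z) \<le> C * \<bar>c1 z\<bar> powr ?e" using C z pos by simp
      also have "\<dots> \<le> max C D * (W powr (- ?e) * cmod z powr ?e)" using C by (intro mult_mono key le pos) auto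
      finally show ?thesis by (simp add: mult.assoc)
    next
      case False
      hence le: "cmod z \<le> \<bar>c2 z\<bar> * W" using n mult_right_mono[of "\<bar>c1 z\<bar>" "\<bar>c2 z\<bar>" "cmod w1"] by (simp add: W_def algebra_simps)
      have pos: "\<bar>c2 z\<bar> > 0" using le z by (cases "c2 z = 0") auto
      have "cmod (fourier_sol g z) \<le> D * \<bar>c2 z\<bar> powr ?e" using D z pos by simp
      also have "\<dots> \<le> max C D * (W powr (- ?e) * cmod z powr ?e)" using C D by (intro mult_mono key le pos) auto
      finally show ?thesis by (simp add: mult.assoc)
    qed
  qed
  thus "\<exists>C. \<forall>z\<in>Z. z \<noteq> 0 \<longrightarrow> cmod (fourier_sol g z) \<le> C * cmod z powr ?e" by blast
qed

end

section \<open>Moments of finitely supported functions\<close>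

lemma sum_swap4: "(\<Sum>x\<in>A. \<Sum>y\<in>B. \<Sum>a\<in>C. \<Sum>b\<in>D. f x y a b) = (\<Sum>a\<in>C. \<Sum>b\<in>D. \<Sum>x\<in>A. \<Sum>y\<in>B. f x y a b)"
proof -
  have "(\<Sum>x\<in>A. \<Sum>y\<in>B. \<Sum>a\<in>C. \<Sum>b\<in>D. f x y a b) = (\<Sum>x\<in>A. \<Sum>a\<in>C. \<Sum>y\<in>B. \<Sum>b\<in>D. f x y a b)"
    by (rule sum.cong[OF refl], rule sum.swap)
  also have "\<dots> = (\<Sum>a\<in>C. \<Sum>x\<in>A. \<Sum>y\<in>B. \<Sum>b\<in>D. f x y a b)" by (rule sum.swap)
  also have "\<dots> = (\<Sum>a\<in>C. \<Sum>x\<in>A. \<Sum>b\<in>D. \<Sum>y\<in>B. f x y a b)"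
    by (rule sum.cong[OF refl], rule sum.cong[OF refl], rule sum.swap)
  also have "\<dots> = (\<Sum>a\<in>C. \<Sum>b\<in>D. \<Sum>x\<in>A. \<Sum>y\<in>B. f x y a b)"
    by (rule sum.cong[OF refl], rule sum.swap)
  finally show ?thesis .
qed

lemma double_sum_single:
  fixes f :: "nat \<Rightarrow> nat \<Rightarrow> complex"
  assumes "p \<le> i" "q \<le> j" "\<And>a b. a \<le> i \<Longrightarrow> b \<le> j \<Longrightarrow> (a, b) \<noteq> (p, q) \<Longrightarrow> f a b = 0"
  shows "(\<Sum>a\<le>i. \<Sum>b\<le>j. f a b) = f p q"
proof -
  have "(\<Sum>a\<le>i. \<Sum>b\<le>j. f a b) = (\<Sum>x\<in>{..i} \<times> {..j}. f (fst x) (snd x))"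
    by (simp add: sum.cartesian_product case_prod_unfold)
  also have "\<dots> = (\<Sum>x\<in>{(p, q)}. f (fst x) (snd x))"
  proof (rule sum.mono_neutral_right)
    show "\<forall>x\<in>{..i} \<times> {..j} - {(p, q)}. f (fst x) (snd x) = 0"
    proof
      fix x assume "x \<in> {..i} \<times> {..j} - {(p, q)}"
      thus "f (fst x) (snd x) = 0" using assms(3)[of "fst x" "snd x"] by (cases x) auto
    qed
  qed (use assms in auto)
  finally show ?thesis by simp
qed

context spherical_walk
begin

section \<open>Finitely supported functions on the lattice\<close>

definition finsup :: "(complex \<Rightarrow> complex) \<Rightarrow> bool" where
  "finsup h \<longleftrightarrow> (\<exists>A. finite A \<and> A \<subseteq> Z \<and> (\<forall>z. z \<notin> A \<longrightarrow> h z = 0))"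

lemma finsup_dec: "finsup h \<Longrightarrow> rapid M h"
  by (auto simp: finsup_def intro: rapid_finite)

lemma finsup_0: "finsup (\<lambda>_. 0)" by (auto simp: finsup_def)

lemma finsup_cmult: "finsup h \<Longrightarrow> finsup (\<lambda>z. c * h z)" by (auto simp: finsup_def)

lemma finsup_add: "finsup h \<Longrightarrow> finsup k \<Longrightarrow> finsup (\<lambda>z. h z + k z)"
proof -
  assume "finsup h" "finsup k"
  then obtain A B where "finite A" "A \<subseteq> Z" "\<forall>z. z \<notin> A \<longrightarrow> h z = 0" "finite B" "B \<subseteq> Z" "\<forall>z. z \<notin> B \<longrightarrow> k z = 0"
    by (auto simp: finsup_def)
  thus ?thesis unfolding finsup_def by (intro exI[of _ "A \<union> B"]) auto
qed

lemma finsup_sum: "(\<And>i. i \<in> I \<Longrightarrow> finsup (h i)) \<Longrightarrow> finsup (\<lambda>z. \<Sum>i\<in>I. h i z)"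
  by (induction I rule: infinite_finite_induct) (auto intro: finsup_0 finsup_add)

lemma finsup_conv:
  assumes "finite Y" "Y \<subseteq> Z" "finsup h" shows "finsup (conv Y \<kappa> h)"
proof -
  obtain A where A: "finite A" "A \<subseteq> Z" "\<And>z. z \<notin> A \<Longrightarrow> h z = 0" using assms(3) by (auto simp: finsup_def)
  let ?B = "(\<lambda>(a, y). a + y) ` (A \<times> Y)"
  have "finite ?B" using A assms by auto
  moreover have "?B \<subseteq> Z" using A assms by (auto intro!: Z_add)
  moreover have "conv Y \<kappa> h z = 0" if "z \<notin> ?B" for z
    unfolding conv_def
  proof (rule sum.neutral, rule ballI)
    fix y assume y: "y \<in> Y"
    have "z - y \<notin> A" using that y by (force simp: image_iff)
    thus "\<kappa> y * h (z - y) = 0" using A by simp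
  qed
  ultimately show ?thesis unfolding finsup_def by blast
qed

lemma finsup_lap: "finsup h \<Longrightarrow> finsup (lap h)"
  unfolding lap_def by (rule finsup_conv[OF finite_X X_Z])

lemma rapid_add: "rapid M f \<Longrightarrow> rapid M g \<Longrightarrow> rapid M (\<lambda>z. f z + g z)"
proof -
  assume "rapid M f" "rapid M g"
  then obtain C D where "C \<ge> 0" "\<forall>z\<in>Z. cmod (f z) \<le> C / (1 + cmod z) ^ M" "D \<ge> 0" "\<forall>z\<in>Z. cmod (g z) \<le> D / (1 + cmod z) ^ M"
    by (auto simp: rapid_def)
  thus ?thesis unfolding rapid_def by (intro exI[of _ "C + D"]) (auto simp: add_divide_distrib intro!: norm_triangle_mono)
qed

lemma rapid_cmult: "rapid M f \<Longrightarrow> rapid M (\<lambda>z. c * f z)"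
proof -
  assume "rapid M f"
  then obtain C where C: "C \<ge> 0" "\<forall>z\<in>Z. cmod (f z) \<le> C / (1 + cmod z) ^ M" by (auto simp: rapid_def)
  have "cmod (c * f z) \<le> (cmod c * C) / (1 + cmod z) ^ M" if "z \<in> Z" for z
    using mult_left_mono[OF bspec[OF C(2) that], of "cmod c"] by (simp add: norm_mult)
  thus ?thesis unfolding rapid_def using C by (intro exI[of _ "cmod c * C"]) auto
qed

lemma rapid_diff: "rapid M f \<Longrightarrow> rapid M g \<Longrightarrow> rapid M (\<lambda>z. f z - g z)"
  using rapid_add[OF _ rapid_cmult[of M g "-1"]] by simp

lemma mom_add: "rapid M f \<Longrightarrow> rapid M g \<Longrightarrow> i + j + 4 \<le> M \<Longrightarrow> mom (\<lambda>z. f z + g z) i j = mom f i j + mom g i j"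
  unfolding mom_def by (subst infsum_add[symmetric]) (auto simp: mom_summable distrib_right)

lemma mom_cmult: "mom (\<lambda>z. c * f z) i j = c * mom f i j"
  unfolding mom_def mult.assoc by (rule infsum_cmult_right')

lemma mom_diff: "rapid M f \<Longrightarrow> rapid M g \<Longrightarrow> i + j + 4 \<le> M \<Longrightarrow> mom (\<lambda>z. f z - g z) i j = mom f i j - mom g i j"
  using mom_add[OF _ rapid_cmult[of M g "-1"], of f i j] by (simp add: mom_cmult[of "-1", simplified])

lemma mom_0: "mom (\<lambda>_. 0) i j = 0" by (simp add: mom_def)

lemma mom_sum: "finite I \<Longrightarrow> (\<And>k. k \<in> I \<Longrightarrow> finsup (h k)) \<Longrightarrow> mom (\<lambda>z. \<Sum>k\<in>I. h k z) i j = (\<Sum>k\<in>I. mom (h k) i j)"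
proof (induction I rule: finite_induct)
  case (insert x F)
  hence "mom (\<lambda>z. h x z + (\<Sum>k\<in>F. h k z)) i j = mom (h x) i j + mom (\<lambda>z. \<Sum>k\<in>F. h k z) i j"
    by (intro mom_add[of "i + j + 4"] finsup_dec finsup_sum) auto
  thus ?case using insert by simp
qed (simp add: mom_0)

section \<open>Moments of convolutions\<close>

definition kernel_mom :: "complex set \<Rightarrow> (complex \<Rightarrow> complex) \<Rightarrow> nat \<Rightarrow> nat \<Rightarrow> complex" where
  "kernel_mom Y \<kappa> a b = (\<Sum>x\<in>Y. \<kappa> x * x ^ a * cnj x ^ b)"

lemma mom_conv:
  assumes Y: "finite Y" "Y \<subseteq> Z" and h: "finsup h"
  shows "mom (conv Y \<kappa> h) i j = (\<Sum>a\<le>i. \<Sum>b\<le>j. of_nat (i choose a) * of_nat (j choose b) * kernel_mom Y \<kappa> a b * mom h (i - a) (j - b))"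
proof -
  obtain A where A: "finite A" "A \<subseteq> Z" "\<And>z. z \<notin> A \<Longrightarrow> h z = 0" using h by (auto simp: finsup_def)
  have mh: "mom h i j = (\<Sum>v\<in>A. h v * (v ^ i * cnj v ^ j))" for i j
    unfolding mom_def by (rule infsum_finite_supp[OF A(1,2)]) (use A in auto)
  have hs: "((\<lambda>w. h (w - x) * (w ^ i * cnj w ^ j)) has_sum (\<Sum>v\<in>A. h v * ((x + v) ^ i * (cnj x + cnj v) ^ j))) Z" if x: "x \<in> Y" for x
  proof -
    let ?A = "(\<lambda>v. x + v) ` A"
    have "(\<Sum>v\<in>A. h v * ((x + v) ^ i * (cnj x + cnj v) ^ j)) = (\<Sum>w\<in>?A. h (w - x) * (w ^ i * cnj w ^ j))"
      by (subst sum.reindex) (auto simp: inj_on_def)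
    hence "((\<lambda>w. h (w - x) * (w ^ i * cnj w ^ j)) has_sum (\<Sum>v\<in>A. h v * ((x + v) ^ i * (cnj x + cnj v) ^ j))) ?A"
      using A by (intro has_sum_finiteI) auto
    moreover have "?A \<subseteq> Z" using A Y x by (auto intro!: Z_add)
    moreover have "h (w - x) = 0" if "w \<in> Z - ?A" for w
    proof -
      have "w - x \<notin> A" using that by (force simp: image_iff)
      thus ?thesis using A by simp
    qed
    ultimately show ?thesis
      by (subst has_sum_cong_neutral[where T = ?A and g = "\<lambda>w. h (w - x) * (w ^ i * cnj w ^ j)"]) auto
  qed
  have "((\<lambda>w. \<Sum>x\<in>Y. \<kappa> x * (h (w - x) * (w ^ i * cnj w ^ j))) has_sum (\<Sum>x\<in>Y. \<kappa> x * (\<Sum>v\<in>A. h v * ((x + v) ^ i * (cnj x + cnj v) ^ j)))) Z"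
    by (intro has_sum_finite_sum has_sum_cmult_right hs)
  hence "mom (conv Y \<kappa> h) i j = (\<Sum>x\<in>Y. \<kappa> x * (\<Sum>v\<in>A. h v * ((x + v) ^ i * (cnj x + cnj v) ^ j)))"
    unfolding mom_def conv_def by (intro infsumI) (simp add: sum_distrib_right mult.assoc)
  also have "\<dots> = (\<Sum>x\<in>Y. \<Sum>v\<in>A. \<Sum>a\<le>i. \<Sum>b\<le>j. of_nat (i choose a) * of_nat (j choose b) * (\<kappa> x * x ^ a * cnj x ^ b) * (h v * (v ^ (i - a) * cnj v ^ (j - b))))"
    unfolding binomial_ring unfolding sum_product unfolding sum_distrib_left
    by (intro sum.cong refl) (simp add: mult_ac)
  also have "\<dots> = (\<Sum>a\<le>i. \<Sum>b\<le>j. \<Sum>x\<in>Y. \<Sum>v\<in>A. of_nat (i choose a) * of_nat (j choose b) * (\<kappa> x * x ^ a * cnj x ^ b) * (h v * (v ^ (i - a) * cnj v ^ (j - b))))"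
    by (rule sum_swap4)
  also have "\<dots> = (\<Sum>a\<le>i. \<Sum>b\<le>j. of_nat (i choose a) * of_nat (j choose b) * kernel_mom Y \<kappa> a b * mom h (i - a) (j - b))"
    unfolding mh kernel_mom_def sum_product sum_distrib_left sum_distrib_right
    by (rule sum.cong[OF refl], rule sum.cong[OF refl], subst sum.swap, simp add: mult_ac)
  finally show ?thesis .
qed

definition unitmom :: "nat \<Rightarrow> nat \<Rightarrow> (complex \<Rightarrow> complex) \<Rightarrow> bool" where
  "unitmom i j h \<longleftrightarrow> finsup h \<and> (\<forall>a b. a + b \<le> i + j \<longrightarrow> mom h a b = (if a = i \<and> b = j then 1 else 0))"

text \<open>The kernel has no moments of degree below \<open>r\<close>, and \<open>h\<close> has
  only one moment of degree at most \<open>i + j\<close>. Counting degrees leaves at most one term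
  of the binomial double sum.\<close>

lemma mom_conv_unit:
  assumes Y: "finite Y" "Y \<subseteq> Z" and h: "unitmom i j h" and le: "a + b \<le> i + j + r"
    and k: "\<And>a b. a + b < r \<Longrightarrow> kernel_mom Y \<kappa> a b = 0"
  shows "mom (conv Y \<kappa> h) a b = (if i \<le> a \<and> j \<le> b \<and> a + b = i + j + r then of_nat (a choose (a - i)) * of_nat (b choose (b - j)) * kernel_mom Y \<kappa> (a - i) (b - j) else 0)"
proof -
  let ?t = "\<lambda>a' b'. of_nat (a choose a') * of_nat (b choose b') * kernel_mom Y \<kappa> a' b' * mom h (a - a') (b - b')"
  have z: "?t a' b' = 0" if "a' \<le> a" "b' \<le> b" "\<not> (a - a' = i \<and> b - b' = j \<and> a' + b' = r)" for a' b'
  proof (cases "a' + b' < r")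
    case True
    thus ?thesis using k by simp
  next
    case False
    hence "(a - a') + (b - b') \<le> i + j" using le that by linarith
    moreover have "\<not> (a - a' = i \<and> b - b' = j)" using that False le by linarith
    ultimately have "mom h (a - a') (b - b') = 0" using h unfolding unitmom_def by (metis (full_types))
    thus ?thesis by simp
  qed
  have m: "mom (conv Y \<kappa> h) a b = (\<Sum>a'\<le>a. \<Sum>b'\<le>b. ?t a' b')"
    by (rule mom_conv[OF Y]) (use h in \<open>simp add: unitmom_def\<close>)
  show ?thesis
  proof (cases "i \<le> a \<and> j \<le> b \<and> a + b = i + j + r")
    case True
    have "(\<Sum>a'\<le>a. \<Sum>b'\<le>b. ?t a' b') = ?t (a - i) (b - j)"
    proof (rule double_sum_single)
      fix a' b' assume "a' \<le> a" "b' \<le> b" "(a', b') \<noteq> (a - i, b - j)"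
      moreover from this have "\<not> (a - a' = i \<and> b - b' = j \<and> a' + b' = r)" by auto
      ultimately show "?t a' b' = 0" by (intro z)
    qed auto
    moreover have "mom h (a - (a - i)) (b - (b - j)) = 1" using True h by (simp add: unitmom_def)
    ultimately show ?thesis using True m by simp
  next
    case False
    have "(\<Sum>a'\<le>a. \<Sum>b'\<le>b. ?t a' b') = 0"
      by (intro sum.neutral ballI z) (use False in auto)
    thus ?thesis unfolding if_not_P[OF False] m .
  qed
qed

text \<open>A discrete counterpart of a first derivative. The weights at \<open>0\<close>,
  \<open>w1\<close>, \<open>w2\<close> solve the 3 by 3 system for the three moments, whose
  determinant \<open>\<Delta>\<close> is not 0 because the basis is independent.\<close>

lemma ex_dipole:
  obtains Y \<kappa> where "finite Y" "Y \<subseteq> Z" "kernel_mom Y \<kappa> 0 0 = 0" "kernel_mom Y \<kappa> (Suc 0) 0 = 1" "kernel_mom Y \<kappa> 0 (Suc 0) = 0"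
proof
  define \<Delta> where "\<Delta> = w1 * cnj w2 - w2 * cnj w1"
  have D: "\<Delta> \<noteq> 0"
    using det_nz by (auto simp: \<Delta>_def det_def complex_eq_iff)
  have ne: "w1 \<noteq> 0" "w2 \<noteq> 0" "w1 \<noteq> w2" using D by (auto simp: \<Delta>_def)
  let ?Y = "{0, w1, w2}"
  define \<kappa> where "\<kappa> x = (if x = w1 then cnj w2 / \<Delta> else if x = w2 then - cnj w1 / \<Delta> else (cnj w1 - cnj w2) / \<Delta>)" for x
  show "finite ?Y" by simp
  show "?Y \<subseteq> Z" using Z_w[of 1 0] Z_w[of 0 1] by simp
  have s: "kernel_mom ?Y \<kappa> a b = \<kappa> 0 * 0 ^ a * 0 ^ b + \<kappa> w1 * w1 ^ a * cnj w1 ^ b + \<kappa> w2 * w2 ^ a * cnj w2 ^ b" for a b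
    unfolding kernel_mom_def using ne by simp
  show "kernel_mom ?Y \<kappa> 0 0 = 0" unfolding s using ne by (simp add: \<kappa>_def diff_divide_distrib)
  have "(cnj w2 * w1 - cnj w1 * w2) / \<Delta> = 1" using D by (simp add: \<Delta>_def mult.commute)
  thus "kernel_mom ?Y \<kappa> (Suc 0) 0 = 1" unfolding s using ne by (simp add: \<kappa>_def diff_divide_distrib)
  show "kernel_mom ?Y \<kappa> 0 (Suc 0) = 0" unfolding s using ne by (simp add: \<kappa>_def mult.commute)
qed

text \<open>Convolution with the dipole moves the leading moment from \<open>(i, j)\<close> to
  \<open>(i + 1, j)\<close> and multiplies it by \<open>i + 1\<close>, which is then divided
  out.\<close>

lemma unitmom_step1: assumes "unitmom i j h" shows "\<exists>h. unitmom (Suc i) j h"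
proof -
  obtain Y \<kappa> where Y: "finite Y" "Y \<subseteq> Z" "kernel_mom Y \<kappa> 0 0 = 0" "kernel_mom Y \<kappa> (Suc 0) 0 = 1" "kernel_mom Y \<kappa> 0 (Suc 0) = 0"
    using ex_dipole by metis
  have m: "mom (conv Y \<kappa> h) a b = (if a = Suc i \<and> b = j then of_nat (Suc i) else 0)" if le: "a + b \<le> i + j + 1" for a b
  proof -
    have "mom (conv Y \<kappa> h) a b = (if i \<le> a \<and> j \<le> b \<and> a + b = i + j + 1 then of_nat (a choose (a - i)) * of_nat (b choose (b - j)) * kernel_mom Y \<kappa> (a - i) (b - j) else 0)"
      by (rule mom_conv_unit[OF Y(1,2) assms le]) (use Y in auto)
    moreover have "(i \<le> a \<and> j \<le> b \<and> a + b = i + j + 1) \<longleftrightarrow> (a = Suc i \<and> b = j) \<or> (a = i \<and> b = Suc j)" by auto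
    ultimately show ?thesis using Y by auto
  qed
  have "finsup (conv Y \<kappa> h)" using finsup_conv[OF Y(1,2)] assms by (simp add: unitmom_def)
  hence "unitmom (Suc i) j (\<lambda>z. 1 / of_nat (Suc i) * conv Y \<kappa> h z)"
    unfolding unitmom_def by (auto intro!: finsup_cmult simp only: mom_cmult m) (auto simp: m simp del: of_nat_Suc)
  thus ?thesis by blast
qed

text \<open>Conjugation exchanges the two indices, so this reduces to the previous case.\<close>

lemma unitmom_step2: assumes "unitmom i j h" shows "\<exists>h. unitmom i (Suc j) h"
proof -
  have c: "mom (\<lambda>z. cnj (h z)) a b = cnj (mom h b a)" for h a b
  proof -
    have "mom (\<lambda>z. cnj (h z)) a b = (\<Sum>\<^sub>\<infinity>w\<in>Z. cnj (h w * (w ^ b * cnj w ^ a)))"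
      unfolding mom_def by (simp add: mult_ac)
    thus ?thesis by (simp add: mom_def infsum_cnj del: complex_cnj_mult)
  qed
  have "unitmom j i (\<lambda>z. cnj (h z))" if "unitmom i j h" for i j h
    using that unfolding unitmom_def finsup_def c by (auto simp: add.commute)
  with assms unitmom_step1 show ?thesis by meson
qed

lemma ex_unitmom: "\<exists>h. unitmom i j h"
proof -
  have "unitmom 0 0 (\<lambda>z. if z = 0 then 1 else 0)"
  proof -
    have "mom (\<lambda>z. if z = 0 then 1 else 0) 0 0 = (\<Sum>w\<in>{0}. (if w = 0 then 1 else 0) * (w ^ 0 * cnj w ^ 0))"
      unfolding mom_def by (rule infsum_finite_supp) auto
    thus ?thesis by (auto simp: unitmom_def finsup_def intro!: exI[of _ "{0}"])
  qed
  moreover have "unitmom 0 0 h \<Longrightarrow> \<exists>h. unitmom 0 j h" for h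
    by (induction j) (use unitmom_step2 in blast)+
  ultimately have "\<exists>h. unitmom 0 j h" by blast
  thus ?thesis by (induction i) (use unitmom_step1 in blast)+
qed

lemma mom_lap_unit:
  assumes "unitmom i j h" "a + b \<le> i + j + 2"
  shows "mom (lap h) a b = (if a = Suc i \<and> b = Suc j then of_nat (Suc i) * of_nat (Suc j) * of_real sig else 0)"
proof -
  have k: "kernel_mom X kap a b = kmom a b" for a b by (simp add: kernel_mom_def kmom_def)
  have k0: "kmom a b = 0" if "a + b < 2" for a b
  proof -
    have "(a = 0 \<and> b = 0) \<or> (a = Suc 0 \<and> b = 0) \<or> (a = 0 \<and> b = Suc 0)" using that by auto
    thus ?thesis by (auto simp: kmom00 kmoms)
  qed
  have "mom (lap h) a b = (if i \<le> a \<and> j \<le> b \<and> a + b = i + j + 2 then of_nat (a choose (a - i)) * of_nat (b choose (b - j)) * kmom (a - i) (b - j) else 0)"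
    unfolding lap_def by (subst mom_conv_unit[OF finite_X X_Z assms]) (auto simp: k k0)
  moreover have "(i \<le> a \<and> j \<le> b \<and> a + b = i + j + 2) \<longleftrightarrow> (a = Suc i \<and> b = Suc j) \<or> (a = i + 2 \<and> b = j) \<or> (a = i \<and> b = j + 2)" by auto
  ultimately show ?thesis using kmoms by auto
qed

text \<open>A pair \<open>(i, j)\<close> with both entries positive is hit by \<open>lap\<close> of
  a function with leading moment \<open>(i - 1, j - 1)\<close>, without disturbing lower degrees or
  other pairs of degree \<open>k\<close>. The pairs \<open>(k, 0)\<close> and \<open>(0, k)\<close>
  are not reached.\<close>

lemma kill_mixed_moments:
  assumes g: "rapid M g" and k: "k + 4 \<le> M" and m: "\<And>i j. i + j < k \<Longrightarrow> mom g i j = 0"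
  shows "\<exists>h. finsup h \<and> (\<forall>i j. i + j < k \<longrightarrow> mom (\<lambda>z. g z - lap h z) i j = 0) \<and>
    (\<forall>i j. i + j = k \<longrightarrow> i \<noteq> 0 \<longrightarrow> j \<noteq> 0 \<longrightarrow> mom (\<lambda>z. g z - lap h z) i j = 0)"
proof -
  obtain H where H: "\<And>i j. unitmom i j (H i j)" using ex_unitmom by metis
  \<comment> \<open>The denominator is the factor that \<open>mom_lap_unit\<close> attaches to the
    pair \<open>(i, k - i)\<close>.\<close>
  define c where "c i = mom g i (k - i) / (of_nat i * of_nat (k - i) * of_real sig)" for i
  define h where "h z = (\<Sum>i\<in>{1..<k}. c i * H (i - 1) (k - i - 1) z)" for z
  have fs: "finsup (H i j)" for i j using H[of i j] by (simp add: unitmom_def)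
  have fh: "finsup h" unfolding h_def[abs_def] by (intro finsup_sum finsup_cmult fs)
  have lh: "lap h z = (\<Sum>i\<in>{1..<k}. c i * lap (H (i - 1) (k - i - 1)) z)" for z
  proof -
    have "lap h z = (\<Sum>x\<in>X. \<Sum>i\<in>{1..<k}. c i * (kap x * H (i - 1) (k - i - 1) (z - x)))"
      by (simp add: lap_def conv_def h_def sum_distrib_left mult_ac)
    also have "\<dots> = (\<Sum>i\<in>{1..<k}. \<Sum>x\<in>X. c i * (kap x * H (i - 1) (k - i - 1) (z - x)))" by (rule sum.swap)
    finally show ?thesis by (simp add: lap_def conv_def sum_distrib_left)
  qed
  have ml: "mom (lap h) a b = (if a + b = k \<and> a \<noteq> 0 \<and> b \<noteq> 0 then mom g a b else 0)" if le: "a + b \<le> k" for a b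
  proof -
    have "mom (lap h) a b = (\<Sum>i\<in>{1..<k}. c i * mom (lap (H (i - 1) (k - i - 1))) a b)"
      unfolding lh[abs_def] by (subst mom_sum) (auto simp: mom_cmult intro!: finsup_cmult finsup_lap fs)
    also have "\<dots> = (\<Sum>i\<in>{1..<k}. if i = a then (if b = k - a then c a * (of_nat a * of_nat b * of_real sig) else 0) else 0)"
    proof (rule sum.cong[OF refl])
      fix i assume i: "i \<in> {1..<k}"
      have "mom (lap (H (i - 1) (k - i - 1))) a b = (if a = Suc (i - 1) \<and> b = Suc (k - i - 1) then of_nat (Suc (i - 1)) * of_nat (Suc (k - i - 1)) * of_real sig else 0)"
        by (rule mom_lap_unit[OF H]) (use i le in auto)
      also have "\<dots> = (if a = i \<and> b = k - i then of_nat i * of_nat (k - i) * of_real sig else 0)"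
        using i by (auto simp: Suc_diff_Suc simp del: of_nat_Suc)
      finally show "c i * mom (lap (H (i - 1) (k - i - 1))) a b = (if i = a then (if b = k - a then c a * (of_nat a * of_nat b * of_real sig) else 0) else 0)" by auto
    qed
    also have "\<dots> = (if a \<in> {1..<k} then (if b = k - a then c a * (of_nat a * of_nat b * of_real sig) else 0) else 0)"
      by (simp add: sum.delta)
    also have "\<dots> = (if a + b = k \<and> a \<noteq> 0 \<and> b \<noteq> 0 then mom g a b else 0)"
      using sig_pos le by (auto simp: c_def)
    finally show ?thesis .
  qed
  have md: "mom (\<lambda>z. g z - lap h z) a b = mom g a b - mom (lap h) a b" if "a + b \<le> k" for a b
    by (rule mom_diff[OF g finsup_dec[OF finsup_lap[OF fh]]]) (use that k in auto)
  show ?thesis by (intro exI[of _ h] conjI fh) (auto simp: md ml m)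
qed

section \<open>Decay along the lattice\<close>

text \<open>The exponent is real in order to hold the gain of 1/3. The origin is left out because
  \<open>0 powr (- e) = 0\<close> would force \<open>f 0 = 0\<close>.\<close>

definition decays :: "real \<Rightarrow> (complex \<Rightarrow> complex) \<Rightarrow> bool" where
  "decays e f \<longleftrightarrow> (\<exists>C\<ge>0. \<forall>z\<in>Z. z \<noteq> 0 \<longrightarrow> cmod (f z) \<le> C * cmod z powr (- e))"

text \<open>Nonzero lattice points stay away from 0, which is what permits lowering the exponent in
  \<open>decays\<close>.\<close>

lemma Z_norm_ge: assumes "z \<in> Z" "z \<noteq> 0" shows "1 / coord_bound \<le> cmod z"
proof -
  have "1 \<le> \<bar>x\<bar>" if "x \<in> \<int>" "x \<noteq> 0" for x :: real
    using that by (metis Ints_nonzero_abs_ge1)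
  moreover have "c1 z \<noteq> 0 \<or> c2 z \<noteq> 0" using coord[of z] assms(2) by auto
  ultimately have "1 \<le> coord_bound * cmod z" using assms(1) c1_le[of z] c2_le[of z] by (auto simp: Z_iff intro: order_trans)
  thus ?thesis using coord_bound_ge1 by (simp add: field_simps)
qed

lemma decays_0: "decays e (\<lambda>_. 0)" by (auto simp: decays_def)

lemma decays_add: "decays e f \<Longrightarrow> decays e g \<Longrightarrow> decays e (\<lambda>z. f z + g z)"
proof -
  assume "decays e f" "decays e g"
  then obtain C D where "C \<ge> 0" "\<forall>z\<in>Z. z \<noteq> 0 \<longrightarrow> cmod (f z) \<le> C * cmod z powr (- e)" "D \<ge> 0" "\<forall>z\<in>Z. z \<noteq> 0 \<longrightarrow> cmod (g z) \<le> D * cmod z powr (- e)"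
    by (auto simp: decays_def)
  thus ?thesis unfolding decays_def by (intro exI[of _ "C + D"]) (auto simp: distrib_right intro!: norm_triangle_mono)
qed

lemma decays_cmult: "decays e f \<Longrightarrow> decays e (\<lambda>z. c * f z)"
proof -
  assume "decays e f"
  then obtain C where C: "C \<ge> 0" "\<forall>z\<in>Z. z \<noteq> 0 \<longrightarrow> cmod (f z) \<le> C * cmod z powr (- e)" by (auto simp: decays_def)
  have "cmod (c * f z) \<le> (cmod c * C) * cmod z powr (- e)" if "z \<in> Z" "z \<noteq> 0" for z
    using mult_left_mono[OF C(2)[rule_format, OF that], of "cmod c"] by (simp add: norm_mult mult.assoc)
  thus ?thesis unfolding decays_def using C by (intro exI[of _ "cmod c * C"]) auto
qed

lemma decays_diff: "decays e f \<Longrightarrow> decays e g \<Longrightarrow> decays e (\<lambda>z. f z - g z)"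
  using decays_add[OF _ decays_cmult[of e g "-1"]] by simp

lemma decays_le: "decays e f \<Longrightarrow> (\<And>z. z \<in> Z \<Longrightarrow> z \<noteq> 0 \<Longrightarrow> cmod (g z) \<le> cmod (f z)) \<Longrightarrow> decays e g"
  unfolding decays_def by (meson order_trans)

lemma decays_mono: assumes "decays e f" "d \<le> e" shows "decays d f"
proof -
  obtain C where C: "C \<ge> 0" "\<And>z. z \<in> Z \<Longrightarrow> z \<noteq> 0 \<Longrightarrow> cmod (f z) \<le> C * cmod z powr (- e)" using assms by (auto simp: decays_def)
  have "cmod (f z) \<le> (C * coord_bound powr (e - d)) * cmod z powr (- d)" if z: "z \<in> Z" "z \<noteq> 0" for z
  proof -
    have "1 \<le> coord_bound * cmod z" using Z_norm_ge[OF z] coord_bound_ge1 by (simp add: field_simps)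
    hence "1 powr (e - d) \<le> (coord_bound * cmod z) powr (e - d)" using assms(2) by (intro powr_mono2) auto
    hence "cmod z powr (- e) * 1 \<le> cmod z powr (- e) * (coord_bound powr (e - d) * cmod z powr (e - d))"
      using coord_bound_ge1 by (intro mult_left_mono) (auto simp: powr_mult)
    also have "\<dots> = coord_bound powr (e - d) * (cmod z powr (- e) * cmod z powr (e - d))" by simp
    also have "cmod z powr (- e) * cmod z powr (e - d) = cmod z powr (- d)" by (simp flip: powr_add)
    finally have "C * cmod z powr (- e) \<le> C * (coord_bound powr (e - d) * cmod z powr (- d))" using C by (intro mult_left_mono) auto
    thus ?thesis using C(2)[OF z] by (simp add: mult.assoc)
  qed
  thus ?thesis unfolding decays_def using C by (intro exI[of _ "C * coord_bound powr (e - d)"]) auto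
qed

lemma decays_outside_ball:
  assumes "\<And>z. z \<in> Z \<Longrightarrow> cmod z \<ge> R \<Longrightarrow> cmod (f z) \<le> C * cmod z powr (- e)"
  shows "decays e f"
proof -
  define A where "A = {z \<in> Z. cmod z \<le> R}"
  have A: "finite A" unfolding A_def by (rule finite_Z_ball)
  define D where "D = (\<Sum>z\<in>A. cmod (f z) * cmod z powr e) + \<bar>C\<bar>"
  have s0: "(\<Sum>z\<in>A. cmod (f z) * cmod z powr e) \<ge> 0" by (intro sum_nonneg) auto
  have "cmod (f z) \<le> D * cmod z powr (- e)" if z: "z \<in> Z" "z \<noteq> 0" for z
  proof (cases "z \<in> A")
    case True
    have "cmod (f z) * cmod z powr e \<le> (\<Sum>z\<in>A. cmod (f z) * cmod z powr e)"
      by (rule member_le_sum) (use True A in auto)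
    hence "cmod (f z) * cmod z powr e \<le> D" by (simp add: D_def)
    from mult_right_mono[OF this, of "cmod z powr (- e)"] show ?thesis
      using z by (simp add: mult.assoc flip: powr_add)
  next
    case False
    hence "cmod (f z) \<le> C * cmod z powr (- e)" using assms z by (auto simp: A_def)
    also have "\<dots> \<le> D * cmod z powr (- e)" using s0 by (intro mult_right_mono) (auto simp: D_def)
    finally show ?thesis .
  qed
  thus ?thesis unfolding decays_def using s0 by (intro exI[of _ D]) (auto simp: D_def)
qed

lemma decays_bO: assumes "bigO (int m) f" shows "decays (real m) f"
proof -
  obtain C where "\<forall>\<^sub>F z in at_infinity. cmod (f z) \<le> C * cmod z powi (- int m)" using assms by (auto simp: bigO_def)
  then obtain R where R: "\<And>z. cmod z \<ge> R \<Longrightarrow> cmod (f z) \<le> C * cmod z powi (- int m)" by (auto simp: eventually_at_infinity)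
  show ?thesis
  proof (rule decays_outside_ball[of "max R 1"])
    fix z :: complex assume z: "cmod z \<ge> max R 1"
    hence "cmod z > 0" by linarith
    hence "cmod z powi (- int m) = cmod z powr (- real m)" by (simp add: power_int_minus powr_minus powr_realpow)
    thus "cmod (f z) \<le> C * cmod z powr (- real m)" using R[of z] z by simp
  qed
qed

lemma bigO_dec: assumes "bigO (int M) f" shows "rapid M f"
proof -
  obtain C where C: "C \<ge> 0" "\<And>z. z \<in> Z \<Longrightarrow> z \<noteq> 0 \<Longrightarrow> cmod (f z) \<le> C * cmod z powr (- real M)"
    using decays_bO[OF assms] by (auto simp: decays_def)
  define D where "D = cmod (f 0) + C * (coord_bound + 1) ^ M"
  have D: "D \<ge> 0" using C coord_bound_ge1 by (simp add: D_def)
  have "cmod (f z) \<le> D / (1 + cmod z) ^ M" if z: "z \<in> Z" for z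
  proof (cases "z = 0")
    case True
    thus ?thesis using C coord_bound_ge1 by (simp add: D_def)
  next
    case False
    have p: "cmod z > 0" using False by simp
    have "1 \<le> coord_bound * cmod z" using Z_norm_ge[OF z False] coord_bound_ge1 by (simp add: field_simps)
    hence "1 + cmod z \<le> (coord_bound + 1) * cmod z" by (simp add: algebra_simps)
    hence "(1 + cmod z) ^ M \<le> (coord_bound + 1) ^ M * cmod z ^ M" unfolding power_mult_distrib[symmetric] by (intro power_mono) auto
    hence "C * (1 + cmod z) ^ M \<le> C * ((coord_bound + 1) ^ M * cmod z ^ M)" using C by (intro mult_left_mono) auto
    hence "C / cmod z ^ M \<le> C * (coord_bound + 1) ^ M / (1 + cmod z) ^ M" using p
      by (simp add: divide_le_eq le_divide_eq add_pos_pos mult_ac)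
    also have "\<dots> \<le> D / (1 + cmod z) ^ M" by (intro divide_right_mono) (auto simp: D_def)
    finally show ?thesis using C(2)[OF z False] p by (simp add: powr_minus powr_realpow divide_inverse)
  qed
  thus ?thesis unfolding rapid_def using D by blast
qed

lemma decays_finsup: "finsup h \<Longrightarrow> decays e h"
proof -
  assume "finsup h"
  then obtain A where A: "finite A" "\<And>z. z \<notin> A \<Longrightarrow> h z = 0" by (auto simp: finsup_def)
  obtain B where B: "\<And>z. z \<in> A \<Longrightarrow> cmod z \<le> B" using finite_imp_bounded[OF A(1)] by (auto simp: bounded_iff)
  show ?thesis
  proof (rule decays_outside_ball[of "B + 1" _ 0])
    fix z :: complex assume "cmod z \<ge> B + 1"
    hence "z \<notin> A" using B[of z] by auto
    thus "cmod (h z) \<le> 0 * cmod z powr (- e)" using A by simp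
  qed
qed

lemma decays_cnj: "decays e f \<Longrightarrow> decays e (\<lambda>z. cnj (f z))"
  by (erule decays_le) simp

section \<open>Slow variation of decaying functions and of the logarithm\<close>

lemma decays_small:
  assumes "decays e f" "e > 0" "\<epsilon> > 0"
  obtains R where "\<And>z. z \<in> Z \<Longrightarrow> cmod z \<ge> R \<Longrightarrow> cmod (f z) \<le> \<epsilon>"
proof -
  obtain C where C: "C \<ge> 0" "\<And>z. z \<in> Z \<Longrightarrow> z \<noteq> 0 \<Longrightarrow> cmod (f z) \<le> C * cmod z powr (- e)" using assms by (auto simp: decays_def)
  have "((\<lambda>x::real. C * x powr (- e)) \<longlongrightarrow> C * 0) at_top"
    using assms(2) by (intro tendsto_intros tendsto_neg_powr filterlim_ident) auto
  hence "eventually (\<lambda>x::real. C * x powr (- e) < \<epsilon>) at_top" using assms(3) by (intro order_tendstoD(2)) auto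
  then obtain R where R: "\<And>x. x \<ge> R \<Longrightarrow> C * x powr (- e) < \<epsilon>" by (auto simp: eventually_at_top_linorder)
  show ?thesis
  proof (rule that[of "max R 1"])
    fix z assume z: "z \<in> Z" "cmod z \<ge> max R 1"
    hence "z \<noteq> 0" by auto
    from C(2)[OF z(1) this] R[of "cmod z"] z show "cmod (f z) \<le> \<epsilon>" by simp
  qed
qed

lemma slow_decays: assumes "decays e f" "e > 0" shows "slow f"
  unfolding slow_def
proof (intro ballI allI impI)
  fix y and \<epsilon> :: real assume y: "y \<in> Z" and e: "\<epsilon> > 0"
  have e2: "\<epsilon> / 2 > 0" using e by simp
  obtain R where R: "\<And>z. z \<in> Z \<Longrightarrow> cmod z \<ge> R \<Longrightarrow> cmod (f z) \<le> \<epsilon> / 2" using decays_small[OF assms e2] by metis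
  show "\<exists>R. \<forall>z\<in>Z. cmod z \<ge> R \<longrightarrow> cmod (f (z - y) - f z) \<le> \<epsilon>"
  proof (intro exI[of _ "R + cmod y"] ballI impI)
    fix z assume z: "z \<in> Z" "cmod z \<ge> R + cmod y"
    have "cmod (z - y) \<ge> R" using z(2) norm_triangle_ineq2[of z y] by linarith
    hence "cmod (f (z - y)) \<le> \<epsilon> / 2" using R Z_diff[OF z(1) y] by blast
    moreover have "cmod z \<ge> R" using z(2) norm_ge_zero[of y] by linarith
    hence "cmod (f z) \<le> \<epsilon> / 2" using R[OF z(1)] by blast
    ultimately show "cmod (f (z - y) - f z) \<le> \<epsilon>" using norm_triangle_ineq4[of "f (z - y)" "f z"] by linarith
  qed
qed

lemma slow_add: assumes "slow f" "slow g" shows "slow (\<lambda>z. f z + g z)"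
  unfolding slow_def
proof (intro ballI allI impI)
  fix y and \<epsilon> :: real assume y: "y \<in> Z" and e: "\<epsilon> > 0"
  have e2: "\<epsilon> / 2 > 0" using e by simp
  from assms y e2 obtain R S where R: "\<And>z. z \<in> Z \<Longrightarrow> cmod z \<ge> R \<Longrightarrow> cmod (f (z - y) - f z) \<le> \<epsilon> / 2"
    and S: "\<And>z. z \<in> Z \<Longrightarrow> cmod z \<ge> S \<Longrightarrow> cmod (g (z - y) - g z) \<le> \<epsilon> / 2"
    unfolding slow_def by metis
  show "\<exists>R. \<forall>z\<in>Z. cmod z \<ge> R \<longrightarrow> cmod (f (z - y) + g (z - y) - (f z + g z)) \<le> \<epsilon>"
  proof (intro exI[of _ "max R S"] ballI impI)
    fix z assume z: "z \<in> Z" "cmod z \<ge> max R S"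
    have e: "f (z - y) + g (z - y) - (f z + g z) = (f (z - y) - f z) + (g (z - y) - g z)" by simp
    have "cmod ((f (z - y) - f z) + (g (z - y) - g z)) \<le> \<epsilon> / 2 + \<epsilon> / 2"
      using R[of z] S[of z] z by (intro norm_triangle_mono) auto
    thus "cmod (f (z - y) + g (z - y) - (f z + g z)) \<le> \<epsilon>" unfolding e by simp
  qed
qed

lemma slow_cmult: assumes "slow f" shows "slow (\<lambda>z. c * f z)"
  unfolding slow_def
proof (intro ballI allI impI)
  fix y and \<epsilon> :: real assume y: "y \<in> Z" and e: "\<epsilon> > 0"
  have "\<epsilon> / (cmod c + 1) > 0" using e by (simp add: add_nonneg_pos)
  with assms y obtain R where R: "\<And>z. z \<in> Z \<Longrightarrow> cmod z \<ge> R \<Longrightarrow> cmod (f (z - y) - f z) \<le> \<epsilon> / (cmod c + 1)"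
    unfolding slow_def by metis
  show "\<exists>R. \<forall>z\<in>Z. cmod z \<ge> R \<longrightarrow> cmod (c * f (z - y) - c * f z) \<le> \<epsilon>"
  proof (intro exI[of _ R] ballI impI)
    fix z assume z: "z \<in> Z" "cmod z \<ge> R"
    have "cmod (c * f (z - y) - c * f z) = cmod c * cmod (f (z - y) - f z)" by (simp add: norm_mult flip: right_diff_distrib)
    also have "\<dots> \<le> (cmod c + 1) * (\<epsilon> / (cmod c + 1))" using R[OF z] by (intro mult_mono) auto
    also have "\<dots> = \<epsilon>" using add_nonneg_pos[of "cmod c" 1] by (metis norm_ge_zero zero_less_one less_irrefl nonzero_mult_div_cancel_left times_divide_eq_right)
    finally show "cmod (c * f (z - y) - c * f z) \<le> \<epsilon>" .
  qed
qed

lemma slow_ln: "slow (\<lambda>z. of_real (ln (cmod z)))"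
  unfolding slow_def
proof (intro ballI allI impI)
  fix y and \<epsilon> :: real assume y: "y \<in> Z" and e: "\<epsilon> > 0"
  \<comment> \<open>Makes both \<open>cmod z\<close> and \<open>cmod (z - y)\<close> positive and at
    least \<open>cmod y / \<epsilon>\<close>, as the estimate of \<open>ln\<close> is used in both
    directions.\<close>
  define B where "B = cmod y / \<epsilon> + cmod y + 1"
  show "\<exists>R. \<forall>z\<in>Z. cmod z \<ge> R \<longrightarrow> cmod (of_real (ln (cmod (z - y))) - complex_of_real (ln (cmod z))) \<le> \<epsilon>"
  proof (intro exI[of _ B] ballI impI)
    fix z assume z: "cmod z \<ge> B"
    let ?a = "cmod (z - y)" and ?b = "cmod z"
    have ab: "\<bar>?a - ?b\<bar> \<le> cmod y" using norm_triangle_ineq3[of "z - y" z] by simp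
    have q: "cmod y / \<epsilon> \<ge> 0" using e by simp
    have a: "?a > 0" "?a \<ge> cmod y / \<epsilon>" and b: "?b > 0" "?b \<ge> cmod y / \<epsilon>" using z ab q norm_ge_zero[of y] unfolding B_def by linarith+
    have m: "(u - v) / w \<le> \<epsilon>" if "\<bar>u - v\<bar> \<le> cmod y" "w > 0" "w \<ge> cmod y / \<epsilon>" for u v w
    proof -
      have "u - v \<le> cmod y" using that by linarith
      also have "\<dots> \<le> \<epsilon> * w" using that e by (simp add: field_simps)
      finally show ?thesis using that by (simp add: field_simps)
    qed
    have "ln ?a - ln ?b \<le> (?a - ?b) / ?b" by (rule ln_diff_le) (use a b in auto)
    also have "\<dots> \<le> \<epsilon>" by (rule m) (use ab b in auto)
    finally have 1: "ln ?a - ln ?b \<le> \<epsilon>" .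
    have "ln ?b - ln ?a \<le> (?b - ?a) / ?a" by (rule ln_diff_le) (use a b in auto)
    also have "\<dots> \<le> \<epsilon>" by (rule m) (use ab a in auto)
    finally have 2: "ln ?b - ln ?a \<le> \<epsilon>" .
    show "cmod (of_real (ln (cmod (z - y))) - complex_of_real (ln (cmod z))) \<le> \<epsilon>"
      unfolding of_real_diff[symmetric] norm_of_real using 1 2 by linarith
  qed
qed

text \<open>Lattice points approximate every direction, so the leading coefficients of an expansion are
  determined by the values on the lattice.\<close>

lemma decays_direction:
  assumes "decays (real n + 1/3) (\<lambda>z. c * inverse z ^ n + d * cnj (inverse z ^ n))" "\<zeta> \<noteq> 0"
  shows "c * inverse \<zeta> ^ n + d * cnj (inverse \<zeta> ^ n) = 0"
proof -
  obtain C where C: "C \<ge> 0" "\<And>z. z \<in> Z \<Longrightarrow> z \<noteq> 0 \<Longrightarrow> cmod (c * inverse z ^ n + d * cnj (inverse z ^ n)) \<le> C * cmod z powr (- (real n + 1/3))"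
    using assms by (auto simp: decays_def)
  \<comment> \<open>The lattice point obtained from \<open>j * \<zeta>\<close> by rounding down both
    coordinates; divided by \<open>j\<close> it tends to \<open>\<zeta>\<close>.\<close>
  define zz where "zz j = of_int \<lfloor>real j * c1 \<zeta>\<rfloor> * w1 + of_int \<lfloor>real j * c2 \<zeta>\<rfloor> * w2" for j :: nat
  define y where "y j = zz j / of_nat j" for j
  have fl: "(\<lambda>j. of_int \<lfloor>real j * x\<rfloor> / real j) \<longlonglongrightarrow> x" for x
    by real_asymp
  have "(\<lambda>j. of_real (of_int \<lfloor>real j * c1 \<zeta>\<rfloor> / real j) * w1 + of_real (of_int \<lfloor>real j * c2 \<zeta>\<rfloor> / real j) * w2) \<longlonglongrightarrow> of_real (c1 \<zeta>) * w1 + of_real (c2 \<zeta>) * w2"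
    by (intro tendsto_intros fl)
  hence yl: "y \<longlonglongrightarrow> \<zeta>" using coord[of \<zeta>] by (simp add: y_def[abs_def] zz_def add_divide_distrib)
  hence "(\<lambda>j. c * inverse (y j) ^ n + d * cnj (inverse (y j) ^ n)) \<longlonglongrightarrow> c * inverse \<zeta> ^ n + d * cnj (inverse \<zeta> ^ n)"
    by (intro tendsto_intros assms(2))
  moreover have "(\<lambda>j. c * inverse (y j) ^ n + d * cnj (inverse (y j) ^ n)) \<longlonglongrightarrow> 0"
  proof (rule Lim_null_comparison)
    have "eventually (\<lambda>j. y j \<noteq> 0) sequentially" using yl assms(2) by (rule tendsto_imp_eventually_ne)
    thus "eventually (\<lambda>j. norm (c * inverse (y j) ^ n + d * cnj (inverse (y j) ^ n)) \<le> C * (cmod (y j) powr (- (real n + 1/3)) * real j powr (-1/3))) sequentially"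
      using eventually_gt_at_top[of 0]
    proof eventually_elim
      case (elim j)
      have j: "real j > 0" using elim by simp
      have zy: "zz j = of_nat j * y j" using elim by (simp add: y_def)
      have zn: "zz j \<noteq> 0" using elim zy by simp
      have zZ: "zz j \<in> Z" unfolding zz_def by (rule Z_w)
      \<comment> \<open>Homogeneity of degree \<open>- n\<close>: scaling by \<open>j\<close> uses
        up the integer part of the decay and leaves the vanishing factor
        \<open>j powr (-1/3)\<close>.\<close>
      have "c * inverse (y j) ^ n + d * cnj (inverse (y j) ^ n) = of_nat j ^ n * (c * inverse (zz j) ^ n + d * cnj (inverse (zz j) ^ n))"
        unfolding zy using elim by (simp add: power_mult_distrib field_simps)
      hence "cmod (c * inverse (y j) ^ n + d * cnj (inverse (y j) ^ n)) = real j ^ n * cmod (c * inverse (zz j) ^ n + d * cnj (inverse (zz j) ^ n))"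
        by (simp add: norm_mult norm_power)
      also have "\<dots> \<le> real j ^ n * (C * cmod (zz j) powr (- (real n + 1/3)))" by (intro mult_left_mono C(2) zn zZ) auto
      also have "cmod (zz j) powr (- (real n + 1/3)) = real j powr (- (real n + 1/3)) * cmod (y j) powr (- (real n + 1/3))"
        unfolding zy norm_mult using j by (simp add: powr_mult)
      also have "real j ^ n * (C * (real j powr (- (real n + 1/3)) * cmod (y j) powr (- (real n + 1/3)))) = C * (cmod (y j) powr (- (real n + 1/3)) * (real j powr real n * real j powr (- (real n + 1/3))))"
        using j by (simp add: powr_realpow mult_ac)
      also have "real j powr real n * real j powr (- (real n + 1/3)) = real j powr (-1/3)" by (simp flip: powr_add)
      finally show ?case .
    qed
    have "(\<lambda>j. real j powr (-1/3)) \<longlonglongrightarrow> 0" by real_asymp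
    hence "(\<lambda>j. C * (cmod (y j) powr (- (real n + 1/3)) * real j powr (-1/3))) \<longlonglongrightarrow> C * (cmod \<zeta> powr (- (real n + 1/3)) * 0)"
      using assms(2) by (intro tendsto_intros yl) auto
    thus "(\<lambda>j. C * (cmod (y j) powr (- (real n + 1/3)) * real j powr (-1/3))) \<longlonglongrightarrow> 0" by simp
  qed
  ultimately show ?thesis using LIMSEQ_unique by blast
qed

text \<open>Two directions suffice: 1 gives \<open>c + d = 0\<close>, and a direction with
  \<open>\<zeta> ^ n = \<i>\<close> gives \<open>c = d\<close>.\<close>

lemma decays_leading_zero:
  assumes "decays (real n + 1/3) (\<lambda>z. c * inverse z ^ n + d * cnj (inverse z ^ n))" "n \<ge> 1"
  shows "c = 0 \<and> d = 0"
proof -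
  have 1: "c + d = 0" using decays_direction[OF assms(1), of 1] by simp
  define \<zeta> where "\<zeta> = cis (pi / (2 * real n))"
  have "real n * (pi / (2 * real n)) = pi / 2" using assms(2) by simp
  hence "\<zeta> ^ n = cis (pi / 2)" by (simp only: \<zeta>_def Complex.DeMoivre)
  hence "\<zeta> ^ n = \<i>" by simp
  hence i: "inverse \<zeta> ^ n = - \<i>" by (simp add: power_inverse)
  have "\<zeta> \<noteq> 0" by (simp add: \<zeta>_def)
  from decays_direction[OF assms(1) this] have "c * (- \<i>) + d * \<i> = 0" unfolding i by simp
  hence "\<i> * (d - c) = 0" by (simp add: algebra_simps)
  thus ?thesis using 1 by simp
qed

text \<open>Along the multiples of \<open>w1\<close> the logarithm is unbounded, so its coefficient
  must vanish, and then the constant as well.\<close>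

lemma decays_log_zero:
  assumes "decays e (\<lambda>z. \<alpha> * of_real (ln (cmod z)) - k)" "e > 0"
  shows "\<alpha> = 0 \<and> k = 0"
proof -
  obtain C where C: "C \<ge> 0" "\<And>z. z \<in> Z \<Longrightarrow> z \<noteq> 0 \<Longrightarrow> cmod (\<alpha> * of_real (ln (cmod z)) - k) \<le> C * cmod z powr (- e)"
    using assms by (auto simp: decays_def)
  define f where "f j = \<alpha> * of_real (ln (cmod w1) + ln (real (Suc j))) - k" for j
  have f0: "f \<longlonglongrightarrow> 0"
  proof (rule Lim_null_comparison)
    show "eventually (\<lambda>j. norm (f j) \<le> C * (cmod w1 * real (Suc j)) powr (- e)) sequentially"
    proof (intro always_eventually allI)
      fix j
      have z: "of_nat (Suc j) * w1 \<in> Z" using Z_w[of "int (Suc j)" 0] by simp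
      have "of_nat (Suc j) * w1 \<noteq> 0" using w1_nz by (simp del: of_nat_Suc)
      from C(2)[OF z this] show "norm (f j) \<le> C * (cmod w1 * real (Suc j)) powr (- e)"
        using w1_nz by (simp add: f_def norm_mult ln_mult mult.commute add.commute del: of_nat_Suc)
    qed
    have "filterlim (\<lambda>j. cmod w1 * real (Suc j)) at_top sequentially"
      using w1_nz by (intro filterlim_tendsto_pos_mult_at_top[OF tendsto_const] filterlim_compose[OF filterlim_real_sequentially filterlim_Suc]) auto
    hence "(\<lambda>j. C * (cmod w1 * real (Suc j)) powr (- e)) \<longlonglongrightarrow> C * 0"
      using assms(2) by (intro tendsto_intros tendsto_neg_powr) auto
    thus "(\<lambda>j. C * (cmod w1 * real (Suc j)) powr (- e)) \<longlonglongrightarrow> 0" by simp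
  qed
  have "\<alpha> = 0"
  proof (rule ccontr)
    assume a: "\<alpha> \<noteq> 0"
    have "(\<lambda>j. (f j + k) / \<alpha> - of_real (ln (cmod w1))) \<longlonglongrightarrow> (0 + k) / \<alpha> - of_real (ln (cmod w1))"
      using a by (intro tendsto_intros f0)
    also have "(\<lambda>j. (f j + k) / \<alpha> - of_real (ln (cmod w1))) = (\<lambda>j. of_real (ln (real (Suc j))))"
      using a by (simp add: f_def)
    finally have "(\<lambda>j. Re (complex_of_real (ln (real (Suc j))))) \<longlonglongrightarrow> Re ((0 + k) / \<alpha> - of_real (ln (cmod w1)))"
      by (rule tendsto_Re)
    hence "(\<lambda>j. ln (real (Suc j))) \<longlonglongrightarrow> Re ((0 + k) / \<alpha> - of_real (ln (cmod w1)))" by simp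
    moreover have "filterlim (\<lambda>j. ln (real (Suc j))) at_top sequentially" by real_asymp
    ultimately show False using not_tendsto_and_filterlim_at_infinity[OF sequentially_bot]
      by (metis filterlim_at_top_imp_at_infinity)
  qed
  moreover from this have "f = (\<lambda>_. - k)" by (simp add: f_def fun_eq_iff)
  hence "k = 0" using f0 by (simp add: LIMSEQ_const_iff)
  ultimately show ?thesis by simp
qed

end

section \<open>The asymptotic expansion\<close>

text \<open>Cramer's rule if the determinant is not 0; otherwise \<open>(b, - a)\<close>, or
  \<open>(b', - a')\<close> if the first row is zero, lies in the kernel. In the application the
  first alternative is refuted analytically.\<close>

lemma two_by_two:
  fixes a b a' b' :: complex
  shows "(\<exists>x y. \<not> (x = 0 \<and> y = 0) \<and> x * a + y * b = 0 \<and> x * a' + y * b' = 0) \<or>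
    (\<forall>p q. \<exists>x y. x * a + y * b = p \<and> x * a' + y * b' = q)"
proof (cases "a * b' - a' * b = 0")
  case False
  show ?thesis
  proof (intro disjI2 allI)
    fix p q
    let ?D = "a * b' - a' * b"
    have "(p * b' - q * b) / ?D * a + (a * q - a' * p) / ?D * b = (p * ?D) / ?D"
      unfolding times_divide_eq_left add_divide_distrib[symmetric] by (simp add: algebra_simps)
    moreover have "(p * b' - q * b) / ?D * a' + (a * q - a' * p) / ?D * b' = (q * ?D) / ?D"
      unfolding times_divide_eq_left add_divide_distrib[symmetric] by (simp add: algebra_simps)
    ultimately show "\<exists>x y. x * a + y * b = p \<and> x * a' + y * b' = q"
      using nonzero_mult_div_cancel_right[OF False, of p] nonzero_mult_div_cancel_right[OF False, of q]
      by (intro exI[of _ "(p * b' - q * b) / ?D"] exI[of _ "(a * q - a' * p) / ?D"]) argo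
  qed
next
  case True
  show ?thesis
  proof (cases "a = 0 \<and> b = 0")
    case False
    have "b * a + (- a) * b = 0" "b * a' + (- a) * b' = 0" using True by (auto simp: algebra_simps)
    thus ?thesis using False by (intro disjI1 exI[of _ b] exI[of _ "- a"]) auto
  next
    case ab: True
    show ?thesis
    proof (cases "a' = 0 \<and> b' = 0")
      case False
      thus ?thesis using ab by (intro disjI1 exI[of _ b'] exI[of _ "- a'"]) (auto simp: algebra_simps)
    next
      case True
      thus ?thesis using ab by (intro disjI1 exI[of _ 1] exI[of _ 0]) auto
    qed
  qed
qed

text \<open>The correctors are fixed once for a given decay exponent \<open>M\<close>, so that the
  same functions \<open>L\<close> and \<open>B m\<close> serve every degree.\<close>

locale walk_expansion = spherical_walk w1 w2 p for w1 w2 p +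
  fixes M :: nat and G0 :: "complex \<Rightarrow> complex" and GG :: "nat \<Rightarrow> complex \<Rightarrow> complex"
  assumes G0: "G0 \<in> Mon 1" and GG: "\<And>m. GG m \<in> Mon (int m + 1)"
    and lapL: "bigO (int M) (lap (\<lambda>z. of_real (ln (cmod z)) - of_real (Re (G0 z))))"
    and lapB: "\<And>m. bigO (int M) (lap (\<lambda>z. monE 0 m z - GG m z))"
begin

definition L :: "complex \<Rightarrow> complex" where "L z = of_real (ln (cmod z)) - of_real (Re (G0 z))"
definition B :: "nat \<Rightarrow> complex \<Rightarrow> complex" where "B m z = monE 0 m z - GG m z"

lemma rapid_lap_L: "rapid M (lap L)" using bigO_dec[OF lapL] by (simp add: L_def[abs_def])
lemma rapid_lap_B: "rapid M (lap (B m))" using bigO_dec[OF lapB[of m]] by (simp add: B_def[abs_def])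

lemma lap_cnj_B: "lap (\<lambda>z. cnj (B m z)) = (\<lambda>z. cnj (lap (B m) z))" by (simp add: lap_cnj fun_eq_iff)

lemma rapid_cnj: "rapid M' f \<Longrightarrow> rapid M' (\<lambda>z. cnj (f z))" by (simp add: rapid_def)

lemma rapid_lap_cnj_B: "rapid M (lap (\<lambda>z. cnj (B m z)))" unfolding lap_cnj_B by (rule rapid_cnj[OF rapid_lap_B])

lemma decays_GG: "decays (real m + 1) (GG m)"
  using decays_bO[of "Suc m"] Mon_bO[OF GG[of m]] by (simp add: add.commute)

lemma decays_ReG0: "decays 1 (\<lambda>z. of_real (Re (G0 z)))"
  using decays_bO[of 1 "\<lambda>z. of_real (Re (G0 z))"] bigO_Re[OF Mon_bO[OF G0]] by simp

lemma decays_B: "decays (real m) (B m)"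
proof -
  have "decays (real m) (monE 0 m)" by (rule decays_bO[OF bigO_monE]) simp
  moreover have "decays (real m) (GG m)" by (rule decays_mono[OF decays_GG]) simp
  ultimately have "decays (real m) (\<lambda>z. monE 0 m z - GG m z)" by (rule decays_diff)
  thus ?thesis by (simp add: B_def[abs_def])
qed

lemma slow_L: "slow L"
proof -
  have "slow (\<lambda>z. of_real (ln (cmod z)) + (-1) * of_real (Re (G0 z)))"
    by (intro slow_add slow_ln slow_cmult slow_decays[OF decays_ReG0]) auto
  thus ?thesis by (simp add: L_def[abs_def])
qed

lemma slow_B: "m \<ge> 1 \<Longrightarrow> slow (B m)" "m \<ge> 1 \<Longrightarrow> slow (\<lambda>z. cnj (B m z))"
  using slow_decays[OF decays_B] slow_decays[OF decays_cnj[OF decays_B]] by auto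

text \<open>For \<open>n \<ge> 1\<close> the span of \<open>L\<close> and of \<open>B m\<close>,
  \<open>cnj (B m)\<close> with \<open>1 \<le> m < n\<close>: \<open>2 * n - 1\<close> generators
  for the \<open>2 * n - 1\<close> harmonic moments of degree below \<open>n\<close>. The inner case
  distinction reflects that degree 0 adds one function and every later degree two.\<close>

fun harmonic_span :: "nat \<Rightarrow> (complex \<Rightarrow> complex) set" where
  "harmonic_span 0 = {\<lambda>_. 0}"
| "harmonic_span (Suc n) = (if n = 0 then {f. \<exists>\<alpha>. f = (\<lambda>z. \<alpha> * L z)} else
     {f. \<exists>A\<in>harmonic_span n. \<exists>x y. f = (\<lambda>z. A z + x * B n z + y * cnj (B n z))})"

lemma harmonic_span_SucI: "A \<in> harmonic_span n \<Longrightarrow> n \<ge> 1 \<Longrightarrow> (\<lambda>z. A z + x * B n z + y * cnj (B n z)) \<in> harmonic_span (Suc n)"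
  by auto

lemma harmonic_span_SucE:
  assumes "f \<in> harmonic_span (Suc n)" "n \<ge> 1"
  obtains A x y where "A \<in> harmonic_span n" "f = (\<lambda>z. A z + x * B n z + y * cnj (B n z))"
  using assms by auto

lemma harmonic_span_induct [consumes 1, case_names zero L B]:
  assumes "f \<in> harmonic_span n" and "\<Phi> (\<lambda>_. 0)" "\<And>\<alpha>. \<Phi> (\<lambda>z. \<alpha> * L z)"
    "\<And>A n x y. \<Phi> A \<Longrightarrow> n \<ge> 1 \<Longrightarrow> \<Phi> (\<lambda>z. A z + x * B n z + y * cnj (B n z))"
  shows "\<Phi> f"
  using assms(1)
proof (induction n arbitrary: f)
  case 0
  thus ?case using assms by auto
next
  case (Suc n)
  show ?case
  proof (cases "n = 0")
    case True
    thus ?thesis using Suc.prems assms(3) by auto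
  next
    case False
    hence n: "n \<ge> 1" by simp
    obtain A x y where "A \<in> harmonic_span n" "f = (\<lambda>z. A z + x * B n z + y * cnj (B n z))" using harmonic_span_SucE[OF Suc.prems n] by metis
    thus ?thesis using assms(4)[OF Suc.IH n] by simp
  qed
qed

lemma harmonic_span_lin: "A \<in> harmonic_span n \<Longrightarrow> A' \<in> harmonic_span n \<Longrightarrow> (\<lambda>z. a * A z + b * A' z) \<in> harmonic_span n"
proof (induction n arbitrary: A A')
  case (Suc n)
  show ?case
  proof (cases "n = 0")
    case True
    with Suc.prems obtain \<alpha> \<beta> where "A = (\<lambda>z. \<alpha> * L z)" "A' = (\<lambda>z. \<beta> * L z)" by auto
    hence "(\<lambda>z. a * A z + b * A' z) = (\<lambda>z. (a * \<alpha> + b * \<beta>) * L z)" by (simp add: distrib_right mult.assoc)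
    thus ?thesis using True by auto
  next
    case False
    hence n: "n \<ge> 1" by simp
    obtain C x y where 1: "C \<in> harmonic_span n" "A = (\<lambda>z. C z + x * B n z + y * cnj (B n z))" using harmonic_span_SucE[OF Suc.prems(1) n] by metis
    obtain C' x' y' where 2: "C' \<in> harmonic_span n" "A' = (\<lambda>z. C' z + x' * B n z + y' * cnj (B n z))" using harmonic_span_SucE[OF Suc.prems(2) n] by metis
    have eq: "(\<lambda>z. a * A z + b * A' z) = (\<lambda>z. (a * C z + b * C' z) + (a * x + b * x') * B n z + (a * y + b * y') * cnj (B n z))"
      unfolding 1 2 by (simp add: algebra_simps)
    show ?thesis unfolding eq by (rule harmonic_span_SucI[OF Suc.IH[OF 1(1) 2(1)] n])
  qed
qed simp

lemma harmonic_span_dec: "A \<in> harmonic_span n \<Longrightarrow> rapid M (lap A)"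
proof (induction rule: harmonic_span_induct)
  case zero
  have "lap (\<lambda>_. 0) = (\<lambda>_. 0)" by (simp add: lap_0 fun_eq_iff)
  thus ?case using finsup_dec[OF finsup_0] by simp
next
  case (L \<alpha>)
  have "lap (\<lambda>z. \<alpha> * L z) = (\<lambda>z. \<alpha> * lap L z)" by (simp add: lap_cmult fun_eq_iff)
  thus ?case using rapid_cmult[OF rapid_lap_L] by simp
next
  case (B A n x y)
  have "lap (\<lambda>z. A z + x * B n z + y * cnj (B n z)) = (\<lambda>z. lap A z + x * lap (B n) z + y * lap (\<lambda>z. cnj (B n z)) z)"
    by (simp add: lap_add lap_cmult fun_eq_iff)
  thus ?case using rapid_add[OF rapid_add[OF B.IH rapid_cmult[OF rapid_lap_B]] rapid_cmult[OF rapid_lap_cnj_B]] by simp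
qed

lemma harmonic_span_slow: "A \<in> harmonic_span n \<Longrightarrow> slow A"
  by (induction rule: harmonic_span_induct) (auto intro!: slow_add slow_cmult slow_L slow_B slow_decays[OF decays_0, of 1])

lemma indep_top:
  assumes IH: "\<And>A k. A \<in> harmonic_span n \<Longrightarrow> decays (real n - 1 + 1/3) (\<lambda>z. A z - k) \<Longrightarrow> (\<forall>z. A z = 0) \<and> k = 0"
    and n: "n \<ge> 1" and A: "A \<in> harmonic_span n" and d: "decays (real n + 1/3) (\<lambda>z. A z + x * B n z + y * cnj (B n z) - k)"
  shows "(\<forall>z. A z = 0) \<and> k = 0 \<and> x = 0 \<and> y = 0"
proof -
  let ?e = "real n - 1 + 1/3"
  have "decays ?e (\<lambda>z. (A z + x * B n z + y * cnj (B n z) - k) - (x * B n z + y * cnj (B n z)))"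
    by (intro decays_diff decays_add decays_cmult decays_mono[OF d] decays_mono[OF decays_B[of n]] decays_mono[OF decays_cnj[OF decays_B[of n]]]) auto
  hence "decays ?e (\<lambda>z. A z - k)" by (simp add: algebra_simps)
  from IH[OF A this] have A0: "\<And>z. A z = 0" "k = 0" by auto
  have "decays (real n + 1/3) (\<lambda>z. (A z + x * B n z + y * cnj (B n z) - k) + (x * GG n z + y * cnj (GG n z)))"
    by (intro d decays_add decays_cmult decays_mono[OF decays_GG[of n]] decays_mono[OF decays_cnj[OF decays_GG[of n]]]) auto
  hence "decays (real n + 1/3) (\<lambda>z. x * inverse z ^ n + y * cnj (inverse z ^ n))"
    by (simp add: A0 B_def monE_def algebra_simps)
  from decays_leading_zero[OF this n] A0 show ?thesis by auto
qed

lemma harmonic_span_indep: "A \<in> harmonic_span (Suc n) \<Longrightarrow> decays (real n + 1/3) (\<lambda>z. A z - k) \<Longrightarrow> (\<forall>z. A z = 0) \<and> k = 0"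
proof (induction n arbitrary: A k)
  case 0
  then obtain \<alpha> where A: "A = (\<lambda>z. \<alpha> * L z)" by auto
  have "decays (1/3) (\<lambda>z. (A z - k) + \<alpha> * of_real (Re (G0 z)))"
    using 0 by (intro decays_add decays_cmult decays_mono[OF decays_ReG0]) auto
  hence "decays (1/3) (\<lambda>z. \<alpha> * of_real (ln (cmod z)) - k)" by (simp add: A L_def algebra_simps)
  from decays_log_zero[OF this] show ?case by (simp add: A)
next
  case (Suc n)
  obtain A' x y where A: "A' \<in> harmonic_span (Suc n)" "A = (\<lambda>z. A' z + x * B (Suc n) z + y * cnj (B (Suc n) z))"
    using harmonic_span_SucE[OF Suc.prems(1)] by (metis One_nat_def Suc_le_mono le0)
  have "(\<forall>z. A' z = 0) \<and> k = 0 \<and> x = 0 \<and> y = 0"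
    by (rule indep_top[of "Suc n"]) (use Suc A in auto)
  thus ?case by (simp add: A(2))
qed

text \<open>Converts vanishing moments into decay: the Fourier solution \<open>u\<close> for the
  right-hand side decays, and \<open>A + h - u\<close> is slow and harmonic, hence constant on the
  lattice.\<close>

lemma harmonic_span_moments_decay:
  assumes A: "A \<in> harmonic_span n" and n: "n \<ge> 1" "n + 6 \<le> M" and h: "finsup h"
    and m: "\<And>i j. i + j < n \<Longrightarrow> mom (\<lambda>z. lap A z + lap h z) i j = 0"
  shows "\<exists>k. decays (real n - 1 + 1/3) (\<lambda>z. A z - k)"
proof -
  have d: "rapid M (\<lambda>z. lap A z + lap h z)" by (intro rapid_add harmonic_span_dec[OF A] finsup_dec finsup_lap h)
  obtain u C where u: "\<And>z. z \<in> Z \<Longrightarrow> lap u z = lap A z + lap h z"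
    "\<And>z. z \<in> Z \<Longrightarrow> z \<noteq> 0 \<Longrightarrow> cmod (u z) \<le> C * cmod z powr (- real (n - 1) - 1/3)"
    using fourier_solve[OF d m n] by metis
  have e: "- real (n - 1) - 1/3 = - (real n - 1 + 1/3)" using n by (simp add: of_nat_diff)
  have du: "decays (real n - 1 + 1/3) u"
    by (rule decays_outside_ball[of 1 _ C], rule u(2)[unfolded e]) auto
  define v where "v z = A z + h z - u z" for z
  have lv: "lap v z = 0" if "z \<in> Z" for z
    unfolding v_def lap_diff lap_add using u(1)[OF that] by simp
  have "slow (\<lambda>z. A z + h z + (-1) * u z)"
    using n by (intro slow_add slow_cmult harmonic_span_slow[OF A] slow_decays[OF decays_finsup[OF h], of 1] slow_decays[OF du]) auto
  hence sv: "slow v" by (simp add: v_def[abs_def])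
  have "decays (real n - 1 + 1/3) (\<lambda>z. A z - v 0)"
  proof (rule decays_le[OF decays_diff[OF du decays_finsup[OF h]]])
    fix z assume "z \<in> Z"
    from harmonic_slow_const[OF sv lv this] have "A z - v 0 = u z - h z" by (simp add: v_def algebra_simps)
    thus "cmod (A z - v 0) \<le> cmod (u z - h z)" by simp
  qed
  thus ?thesis by blast
qed

lemma moment_matching:
  "n + 6 \<le> M \<Longrightarrow> rapid M g \<Longrightarrow> \<exists>A\<in>harmonic_span n. \<exists>h. finsup h \<and> (\<forall>i j. i + j < n \<longrightarrow> mom (\<lambda>z. g z - lap A z - lap h z) i j = 0)"
proof (induction n arbitrary: g)
  case 0
  show ?case using finsup_0 by auto
next
  case (Suc n)
  show ?case
  proof (cases "n = 0")
    case True
    \<comment> \<open>With vanishing mass, \<open>L\<close> minus a constant would decay, which the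
      logarithm does not.\<close>
    have nz: "mom (lap L) 0 0 \<noteq> 0"
    proof
      assume z: "mom (lap L) 0 0 = 0"
      have "(\<lambda>z. 1 * L z) \<in> harmonic_span 1"
        by (simp only: One_nat_def harmonic_span.simps simp_thms if_True mem_Collect_eq, rule exI, rule refl)
      hence LF: "L \<in> harmonic_span 1" by simp
      have "mom (\<lambda>z. lap L z + lap (\<lambda>_. 0) z) i j = 0" if "i + j < 1" for i j
        using that z by (simp add: lap_0)
      from harmonic_span_moments_decay[OF LF _ _ finsup_0 this] Suc.prems True obtain k where "decays (1/3) (\<lambda>z. L z - k)" by auto
      hence "decays (1/3) (\<lambda>z. (L z - k) + of_real (Re (G0 z)))" by (intro decays_add decays_mono[OF decays_ReG0]) auto
      hence "decays (1/3) (\<lambda>z. 1 * of_real (ln (cmod z)) - k)" by (simp add: L_def algebra_simps)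
      from decays_log_zero[OF this] show False by simp
    qed
    define \<alpha> where "\<alpha> = mom g 0 0 / mom (lap L) 0 0"
    have l: "lap (\<lambda>z. \<alpha> * L z) z = \<alpha> * lap L z" for z by (simp add: lap_cmult)
    have "mom (\<lambda>z. g z - lap (\<lambda>z. \<alpha> * L z) z - lap (\<lambda>_. 0) z) 0 0 = mom (\<lambda>z. g z - \<alpha> * lap L z) 0 0"
      by (simp add: l lap_0)
    also have "\<dots> = mom g 0 0 - \<alpha> * mom (lap L) 0 0"
      using Suc.prems by (subst mom_diff[of M]) (auto intro!: rapid_cmult rapid_lap_L simp: mom_cmult)
    also have "\<dots> = 0" using nz by (simp add: \<alpha>_def)
    finally have 0: "mom (\<lambda>z. g z - lap (\<lambda>z. \<alpha> * L z) z - lap (\<lambda>_. 0) z) 0 0 = 0" .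
    have "(\<lambda>z. \<alpha> * L z) \<in> harmonic_span (Suc n)" using True by auto
    moreover have "\<forall>i j. i + j < Suc n \<longrightarrow> mom (\<lambda>z. g z - lap (\<lambda>z. \<alpha> * L z) z - lap (\<lambda>_. 0) z) i j = 0"
      using True 0 by auto
    ultimately show ?thesis using finsup_0 by blast
  next
    case False
    hence n: "n \<ge> 1" by simp
    have nM: "n + 6 \<le> M" "n + 4 \<le> M" using Suc.prems by auto
    \<comment> \<open>The induction hypothesis clears the degrees below \<open>n\<close>, and
      \<open>kill_mixed_moments\<close> clears degree \<open>n\<close> except for the two harmonic
      moments.\<close>
    have red: "\<exists>A h. A \<in> harmonic_span n \<and> finsup h \<and> (\<forall>i j. i + j < Suc n \<longrightarrow> (i, j) \<noteq> (n, 0) \<longrightarrow> (i, j) \<noteq> (0, n) \<longrightarrow> mom (\<lambda>z. f z - lap A z - lap h z) i j = 0)"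
      if f: "rapid M f" for f
    proof -
      obtain A h where A: "A \<in> harmonic_span n" "finsup h" "\<And>i j. i + j < n \<Longrightarrow> mom (\<lambda>z. f z - lap A z - lap h z) i j = 0"
        using Suc.IH[OF nM(1) f] by blast
      have d: "rapid M (\<lambda>z. f z - lap A z - lap h z)" by (intro rapid_diff f harmonic_span_dec[OF A(1)] finsup_dec finsup_lap A)
      have "\<exists>h'. finsup h' \<and> (\<forall>i j. i + j < n \<longrightarrow> mom (\<lambda>z. (f z - lap A z - lap h z) - lap h' z) i j = 0) \<and>
         (\<forall>i j. i + j = n \<longrightarrow> i \<noteq> 0 \<longrightarrow> j \<noteq> 0 \<longrightarrow> mom (\<lambda>z. (f z - lap A z - lap h z) - lap h' z) i j = 0)"
        by (rule kill_mixed_moments[OF d nM(2)]) (rule A(3))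
      then obtain h' where h': "finsup h'"
         "\<forall>i j. i + j < n \<longrightarrow> mom (\<lambda>z. (f z - lap A z - lap h z) - lap h' z) i j = 0"
         "\<forall>i j. i + j = n \<longrightarrow> i \<noteq> 0 \<longrightarrow> j \<noteq> 0 \<longrightarrow> mom (\<lambda>z. (f z - lap A z - lap h z) - lap h' z) i j = 0"
        by (elim exE conjE)
      have e: "f z - lap A z - lap (\<lambda>z. h z + h' z) z = (f z - lap A z - lap h z) - lap h' z" for z
        by (simp add: lap_add)
      have "mom (\<lambda>z. f z - lap A z - lap (\<lambda>z. h z + h' z) z) i j = 0" if "i + j < Suc n" "(i, j) \<noteq> (n, 0)" "(i, j) \<noteq> (0, n)" for i j
        unfolding e using h'(2)[rule_format, of i j] h'(3)[rule_format, of i j] that by (cases "i + j < n") auto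
      thus ?thesis using A(1) finsup_add[OF A(2) h'(1)]
        by (intro exI[of _ A] exI[of _ "\<lambda>z. h z + h' z"] conjI allI impI)
    qed
    from red[OF Suc.prems(2)] obtain A0 h0 where 0: "A0 \<in> harmonic_span n" "finsup h0"
      and m0: "\<forall>i j. i + j < Suc n \<longrightarrow> (i, j) \<noteq> (n, 0) \<longrightarrow> (i, j) \<noteq> (0, n) \<longrightarrow> mom (\<lambda>z. g z - lap A0 z - lap h0 z) i j = 0"
      by (elim exE conjE)
    from red[OF rapid_lap_B[of n]] obtain A1 h1 where 1: "A1 \<in> harmonic_span n" "finsup h1"
      and m1: "\<forall>i j. i + j < Suc n \<longrightarrow> (i, j) \<noteq> (n, 0) \<longrightarrow> (i, j) \<noteq> (0, n) \<longrightarrow> mom (\<lambda>z. lap (B n) z - lap A1 z - lap h1 z) i j = 0"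
      by (elim exE conjE)
    from red[OF rapid_lap_cnj_B[of n]] obtain A2 h2 where 2: "A2 \<in> harmonic_span n" "finsup h2"
      and m2: "\<forall>i j. i + j < Suc n \<longrightarrow> (i, j) \<noteq> (n, 0) \<longrightarrow> (i, j) \<noteq> (0, n) \<longrightarrow> mom (\<lambda>z. lap (\<lambda>z. cnj (B n z)) z - lap A2 z - lap h2 z) i j = 0"
      by (elim exE conjE)
    define r0 where "r0 z = g z - lap A0 z - lap h0 z" for z
    define r1 where "r1 z = lap (B n) z - lap A1 z - lap h1 z" for z
    define r2 where "r2 z = lap (\<lambda>z. cnj (B n z)) z - lap A2 z - lap h2 z" for z
    have d0: "rapid M r0" unfolding r0_def[abs_def] by (intro rapid_diff Suc.prems harmonic_span_dec[OF 0(1)] finsup_dec finsup_lap 0)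
    have d1: "rapid M r1" unfolding r1_def[abs_def] by (intro rapid_diff rapid_lap_B harmonic_span_dec[OF 1(1)] finsup_dec finsup_lap 1)
    have d2: "rapid M r2" unfolding r2_def[abs_def] by (intro rapid_diff rapid_lap_cnj_B harmonic_span_dec[OF 2(1)] finsup_dec finsup_lap 2)
    note z0 = m0[folded r0_def, rule_format] and z1 = m1[folded r1_def, rule_format] and z2 = m2[folded r2_def, rule_format]
    have lin: "mom (\<lambda>z. x * r1 z + y * r2 z) i j = x * mom r1 i j + y * mom r2 i j" if "i + j < Suc n" for x y i j
      using that nM by (subst mom_add[of M]) (auto intro!: rapid_cmult d1 d2 simp: mom_cmult)
    consider x y where "\<not> (x = 0 \<and> y = 0)" "x * mom r1 n 0 + y * mom r2 n 0 = 0" "x * mom r1 0 n + y * mom r2 0 n = 0"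
      | x y where "x * mom r1 n 0 + y * mom r2 n 0 = mom r0 n 0" "x * mom r1 0 n + y * mom r2 0 n = mom r0 0 n"
      using two_by_two[of "mom r1 n 0" "mom r2 n 0" "mom r1 0 n" "mom r2 0 n"] by blast
    thus ?thesis
    proof cases
      \<comment> \<open>A kernel vector would give a combination with top part
        \<open>x * B n + y * cnj (B n)\<close> and no moments up to degree \<open>n\<close>; by
        decay and independence \<open>x\<close> and \<open>y\<close> would be 0.\<close>
      case (1 x y)
      define A where "A z = (- x) * A1 z + (- y) * A2 z" for z
      have A: "A \<in> harmonic_span n" unfolding A_def[abs_def] by (rule harmonic_span_lin[OF \<open>A1 \<in> harmonic_span n\<close> \<open>A2 \<in> harmonic_span n\<close>])
      define h where "h z = (- x) * h1 z + (- y) * h2 z" for z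
      have h: "finsup h" unfolding h_def[abs_def] by (intro finsup_add finsup_cmult \<open>finsup h1\<close> \<open>finsup h2\<close>)
      have e: "lap (\<lambda>z. A z + x * B n z + y * cnj (B n z)) z + lap h z = x * r1 z + y * r2 z" for z
        by (simp only: A_def h_def[abs_def] r1_def r2_def lap_add lap_cmult) (simp add: algebra_simps)
      have "mom (\<lambda>z. lap (\<lambda>z. A z + x * B n z + y * cnj (B n z)) z + lap h z) i j = 0" if "i + j < Suc n" for i j
        unfolding e lin[OF that] using 1(2,3) z1[OF that] z2[OF that] by (cases "(i, j) = (n, 0) \<or> (i, j) = (0, n)") auto
      from harmonic_span_moments_decay[OF harmonic_span_SucI[OF A n] _ _ h this] Suc.prems
      obtain k where "decays (real (Suc n) - 1 + 1/3) (\<lambda>z. A z + x * B n z + y * cnj (B n z) - k)" by auto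
      hence dk: "decays (real n + 1/3) (\<lambda>z. A z + x * B n z + y * cnj (B n z) - k)" by simp
      obtain n' where n': "n = Suc n'" using n by (cases n) auto
      have "x = 0 \<and> y = 0"
        using indep_top[OF _ n A dk] harmonic_span_indep[of _ n'] by (simp add: n' del: harmonic_span.simps)
      thus ?thesis using 1(1) by simp
    next
      \<comment> \<open>The solution of the 2 by 2 system cancels the two harmonic moments of
        \<open>r0\<close>; the reductions made for \<open>g\<close>, \<open>B n\<close> and its
        conjugate are collected in \<open>A\<close> and \<open>h\<close>.\<close>
      case (2 x y)
      define A where "A z = 1 * A0 z + (-1) * (x * A1 z + y * A2 z)" for z
      have A: "A \<in> harmonic_span n" unfolding A_def[abs_def] by (intro harmonic_span_lin \<open>A0 \<in> harmonic_span n\<close> \<open>A1 \<in> harmonic_span n\<close> \<open>A2 \<in> harmonic_span n\<close>)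
      define h where "h z = h0 z + ((- x) * h1 z + (- y) * h2 z)" for z
      have h: "finsup h" unfolding h_def[abs_def] by (intro finsup_add finsup_cmult \<open>finsup h0\<close> \<open>finsup h1\<close> \<open>finsup h2\<close>)
      have e: "g z - lap (\<lambda>z. A z + x * B n z + y * cnj (B n z)) z - lap h z = r0 z - (x * r1 z + y * r2 z)" for z
        by (simp only: A_def h_def[abs_def] r0_def r1_def r2_def lap_add lap_cmult) (simp add: algebra_simps)
      have "mom (\<lambda>z. g z - lap (\<lambda>z. A z + x * B n z + y * cnj (B n z)) z - lap h z) i j = 0" if ij: "i + j < Suc n" for i j
      proof -
        have "mom (\<lambda>z. r0 z - (x * r1 z + y * r2 z)) i j = mom r0 i j - (x * mom r1 i j + y * mom r2 i j)"
          using ij nM by (subst mom_diff[of M]) (auto intro!: rapid_add rapid_cmult d0 d1 d2 simp: lin)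
        also have "\<dots> = 0" using 2 z0[OF ij] z1[OF ij] z2[OF ij] by (cases "(i, j) = (n, 0) \<or> (i, j) = (0, n)") auto
        finally show ?thesis unfolding e .
      qed
      thus ?thesis using harmonic_span_SucI[OF A n] h by blast
    qed
  qed
qed

text \<open>Monomials in \<open>Mon\<close> have powers of \<open>z\<close>, never of
  \<open>cnj z\<close>, in the denominator, so the conjugated functions are carried by a separate
  \<open>s\<close>.\<close>

lemma harmonic_span_form: "A \<in> harmonic_span n \<Longrightarrow> \<exists>\<alpha> r s. r \<in> Mon 1 \<and> s \<in> Mon 1 \<and> (\<forall>z. A z = \<alpha> * of_real (ln (cmod z)) + r z + cnj (s z))"
proof (induction rule: harmonic_span_induct)
  case zero
  show ?case by (intro exI[of _ 0] exI[of _ "\<lambda>_. 0"]) (simp add: Mon_0)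
next
  case (L \<alpha>)
  have "\<alpha> * L z = \<alpha> * of_real (ln (cmod z)) + (- \<alpha> / 2) * G0 z + cnj ((- cnj \<alpha> / 2) * G0 z)" for z
  proof -
    have e: "complex_of_real (Re (G0 z)) = (G0 z + cnj (G0 z)) / 2" by (simp add: complex_eq_iff)
    show ?thesis unfolding L_def e by (simp add: field_simps)
  qed
  thus ?case using Mon_cmult[OF G0] by blast
next
  case (B A n x y)
  then obtain \<alpha> r s where rs: "r \<in> Mon 1" "s \<in> Mon 1" "\<And>z. A z = \<alpha> * of_real (ln (cmod z)) + r z + cnj (s z)" by blast
  have "(\<lambda>z. 1 * monE 0 n z - GG n z) \<in> Mon 1"
    using B.hyps by (intro Mon_diff Mon_monE Mon_mono[OF GG]) auto
  hence Bn: "B n \<in> Mon 1" by (simp add: B_def[abs_def])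
  have "A z + x * B n z + y * cnj (B n z) = \<alpha> * of_real (ln (cmod z)) + (r z + x * B n z) + cnj (s z + cnj y * B n z)" for z
    by (simp add: rs algebra_simps)
  moreover have "(\<lambda>z. r z + x * B n z) \<in> Mon 1" "(\<lambda>z. s z + cnj y * B n z) \<in> Mon 1"
    by (intro Mon_add Mon_cmult Bn rs)+
  ultimately show ?case by blast
qed

text \<open>Once the moments of the unit mass at 0 are matched by \<open>A\<close> and
  \<open>h\<close>, the rest is solved by a decaying \<open>u\<close>. Then
  \<open>v = A + h + u\<close>, and \<open>A\<close> carries the whole expansion.\<close>

theorem green_function:
  assumes "n \<ge> 1" "n + 6 \<le> M"
  shows "\<exists>v \<alpha> r s. slow v \<and> (\<forall>z\<in>Z. lap v z = (if z = 0 then 1 else 0)) \<and> r \<in> Mon 1 \<and> s \<in> Mon 1 \<and>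
    decays (real n - 1 + 1/3) (\<lambda>z. v z - (\<alpha> * of_real (ln (cmod z)) + r z + cnj (s z)))"
proof -
  define \<delta> :: "complex \<Rightarrow> complex" where "\<delta> z = (if z = 0 then 1 else 0)" for z
  have d: "rapid M \<delta>" by (rule rapid_finite[of "{0}"]) (auto simp: \<delta>_def)
  obtain A h where A: "A \<in> harmonic_span n" "finsup h" "\<And>i j. i + j < n \<Longrightarrow> mom (\<lambda>z. \<delta> z - lap A z - lap h z) i j = 0"
    using moment_matching[OF assms(2) d] by blast
  have dg: "rapid M (\<lambda>z. \<delta> z - lap A z - lap h z)" by (intro rapid_diff d harmonic_span_dec[OF A(1)] finsup_dec finsup_lap A)
  obtain u C where u: "\<And>z. z \<in> Z \<Longrightarrow> lap u z = \<delta> z - lap A z - lap h z"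
    "\<And>z. z \<in> Z \<Longrightarrow> z \<noteq> 0 \<Longrightarrow> cmod (u z) \<le> C * cmod z powr (- real (n - 1) - 1/3)"
    using fourier_solve[OF dg A(3) assms] by metis
  have e: "- real (n - 1) - 1/3 = - (real n - 1 + 1/3)" using assms by (simp add: of_nat_diff)
  have du: "decays (real n - 1 + 1/3) u"
    by (rule decays_outside_ball[of 1 _ C], rule u(2)[unfolded e]) auto
  define v where "v z = A z + (h z + u z)" for z
  have "lap v z = \<delta> z" if "z \<in> Z" for z unfolding v_def lap_add using u(1)[OF that] by simp
  moreover have "slow v" unfolding v_def[abs_def]
    using assms by (intro slow_add harmonic_span_slow[OF A(1)] slow_decays[OF decays_finsup[OF A(2)], of 1] slow_decays[OF du]) auto
  moreover obtain \<alpha> r s where rs: "r \<in> Mon 1" "s \<in> Mon 1" and Aeq: "\<And>z. A z = \<alpha> * of_real (ln (cmod z)) + r z + cnj (s z)"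
    using harmonic_span_form[OF A(1)] by blast
  moreover have "decays (real n - 1 + 1/3) (\<lambda>z. v z - A z)"
    using decays_add[OF decays_finsup[OF A(2)] du] by (simp add: v_def)
  hence "decays (real n - 1 + 1/3) (\<lambda>z. v z - (\<alpha> * of_real (ln (cmod z)) + r z + cnj (s z)))"
    unfolding Aeq .
  ultimately show ?thesis using rs unfolding \<delta>_def
    by (intro exI[of _ v] exI[of _ \<alpha>] exI[of _ r] exI[of _ s] conjI ballI)
qed

end

context spherical_walk
begin

text \<open>Only real parts matter, so each monomial is replaced by its conjugate, a power of
  \<open>z\<close> over a power of \<open>cmod z\<close>, with conjugated coefficient. Then
  \<open>l = a + b\<close> and \<open>k = 2 * b\<close> give \<open>l - k = a - b\<close> and
  \<open>k \<le> 2 * l\<close>; terms of order above \<open>K\<close> join the error.\<close>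

lemma Mon_normal_form:
  assumes "f \<in> Mon 1"
  shows "\<exists>S c. finite S \<and> (\<forall>(l,k)\<in>S. - int K \<le> int l - int k \<and> int l - int k \<le> -1 \<and> k \<le> 2 * l) \<and>
    decays (real K) (\<lambda>z. of_real (Re (f z) - Re (\<Sum>(l,k)\<in>S. c (l,k) * z ^ l / complex_of_real (cmod z ^ k))))"
  using assms
proof (induction rule: Mon.induct)
  case Mon_0
  show ?case by (rule exI[of _ "{}"]) (simp add: decays_0)
next
  case (Mon_step f b a d)
  let ?s = "\<lambda>S c z. (\<Sum>(l,k)\<in>S. c (l,k) * z ^ l / complex_of_real (cmod z ^ k))"
  obtain S c where S: "finite S" "\<forall>(l,k)\<in>S. - int K \<le> int l - int k \<and> int l - int k \<le> -1 \<and> k \<le> 2 * l"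
    and dS: "decays (real K) (\<lambda>z. of_real (Re (f z) - Re (?s S c z)))" using Mon_step.IH by blast
  show ?case
  proof (cases "int b - int a \<le> int K")
    case False
    have "bigO (int K) (\<lambda>z. of_real (Re (d * monE a b z)))" using False by (intro bigO_Re bigO_cmult bigO_monE) auto
    from decays_add[OF dS decays_bO[OF this]]
    have "decays (real K) (\<lambda>z. of_real (Re (f z + d * monE a b z) - Re (?s S c z)))"
      by (simp add: algebra_simps)
    thus ?thesis using S by blast
  next
    case True
    let ?p = "(a + b, 2 * b)"
    \<comment> \<open>The pair may already occur in \<open>S\<close>, and then the coefficients add
      up; otherwise the old value of \<open>c\<close> there is arbitrary and is replaced by
      0.\<close>
    define c' where "c' = c(?p := (if ?p \<in> S then c ?p else 0) + cnj d)"
    have s': "?s (insert ?p S) c' z = ?s S c z + cnj d * z ^ (a + b) / complex_of_real (cmod z ^ (2 * b))" for z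
    proof -
      have r: "?s (S - {?p}) c' z = ?s (S - {?p}) c z"
      proof (rule sum.cong[OF refl])
        fix q assume "q \<in> S - {?p}"
        hence "c' q = c q" unfolding c'_def by (intro fun_upd_other) auto
        thus "(case q of (l, k) \<Rightarrow> c' (l, k) * z ^ l / complex_of_real (cmod z ^ k)) = (case q of (l, k) \<Rightarrow> c (l, k) * z ^ l / complex_of_real (cmod z ^ k))"
          by (cases q) simp
      qed
      have "?s (insert ?p S) c' z = c' ?p * z ^ (a + b) / complex_of_real (cmod z ^ (2 * b)) + ?s (S - {?p}) c' z"
        using S(1) by (subst sum.insert_remove) auto
      also have "\<dots> = ?s S c z + cnj d * z ^ (a + b) / complex_of_real (cmod z ^ (2 * b))"
      proof (cases "?p \<in> S")
        case True
        have "?s S c z = c ?p * z ^ (a + b) / complex_of_real (cmod z ^ (2 * b)) + ?s (S - {?p}) c z"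
          using S(1) True by (subst sum.remove[of S ?p]) auto
        thus ?thesis unfolding r using True by (simp add: c'_def add_divide_distrib distrib_right)
      next
        case False
        hence "S - {?p} = S" by simp
        thus ?thesis unfolding r using False by (simp add: c'_def)
      qed
      finally show ?thesis .
    qed
    have t: "Re (cnj d * z ^ (a + b) / complex_of_real (cmod z ^ (2 * b))) = Re (d * monE a b z)" if "z \<noteq> 0" for z
    proof -
      have "complex_of_real (cmod z ^ (2 * b)) = (z * cnj z) ^ b"
        by (simp only: power_mult of_real_power[symmetric] complex_norm_square[symmetric])
      hence "cnj d * z ^ (a + b) / complex_of_real (cmod z ^ (2 * b)) = cnj (d * monE a b z)"
        using that by (simp add: monE_def power_mult_distrib power_add field_simps power_inverse)
      thus ?thesis by (metis complex_cnj_cancel_iff cnj.simps(1))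
    qed
    have "decays (real K) (\<lambda>z. of_real (Re (f z + d * monE a b z) - Re (?s (insert ?p S) c' z)))"
    proof (rule decays_le[OF dS])
      fix z :: complex assume "z \<noteq> 0"
      hence "Re (f z + d * monE a b z) - Re (?s (insert ?p S) c' z) = Re (f z) - Re (?s S c z)"
        unfolding s' plus_complex.simps t[OF \<open>z \<noteq> 0\<close>] by (simp only: add_diff_cancel_right)
      thus "cmod (of_real (Re (f z + d * monE a b z) - Re (?s (insert ?p S) c' z))) \<le> cmod (of_real (Re (f z) - Re (?s S c z)))"
        by (simp only: order_refl)
    qed
    moreover have "\<forall>(l,k)\<in>insert ?p S. - int K \<le> int l - int k \<and> int l - int k \<le> -1 \<and> k \<le> 2 * l"
      using S(2) True Mon_step.hyps by auto
    ultimately show ?thesis using S(1) by blast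
  qed
qed

lemma ex_expansion: "\<exists>G0 GG. walk_expansion w1 w2 p M G0 GG"
proof -
  obtain G0 where G0: "G0 \<in> Mon 1" "bigO (int M) (lap (\<lambda>z. of_real (ln (cmod z)) - of_real (Re (G0 z))))"
    using ex_harmonic_ln by blast
  have "\<forall>m. \<exists>G. G \<in> Mon (int m + 1) \<and> bigO (int M) (lap (\<lambda>z. monE 0 m z - G z))"
    using ex_harmonic_monE by blast
  then obtain GG where "\<forall>m. GG m \<in> Mon (int m + 1) \<and> bigO (int M) (lap (\<lambda>z. monE 0 m z - GG m z))"
    by (rule choice[THEN exE])
  thus ?thesis using G0
    by (intro exI[of _ G0] exI[of _ GG] walk_expansion.intro spherical_walk_axioms walk_expansion_axioms.intro) auto
qed

end

theorem mainTheorem6: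
  fixes w1 w2 :: complex and p :: "complex pmf" and K :: nat
  assumes "lin_indep2 w1 w2"
    and "random_walk_on (lattice2 w1 w2) p"
    and "spherical p"
    and "K \<ge> 1"
  shows "\<exists>(\<alpha>::real) (lam::real) (S::(nat \<times> nat) set) (c::nat \<times> nat \<Rightarrow> complex).
           finite S \<and>
           (\<forall>(l,k)\<in>S. - int K \<le> int l - int k \<and> int l - int k \<le> -1) \<and>
           (\<lambda>z. harmonic_potential p z
                 - (\<alpha> * ln (cmod z) + lam
                    + Re (\<Sum>(l,k)\<in>S. c (l,k) * z ^ l / complex_of_real (cmod z ^ k))))
             \<in> O[inf at_infinity (principal (lattice2 w1 w2))](\<lambda>z. cmod z powr (- real K)) \<and>
           (\<forall>(l,k)\<in>S. 2 * l < k \<longrightarrow> c (l,k) = 0)"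
proof -
  interpret spherical_walk w1 w2 p using assms by unfold_locales
  \<comment> \<open>The degree used below is \<open>K + 1\<close>, which requires a decay exponent
    of \<open>K + 7\<close> and leaves an error of order \<open>K + 1/3\<close>.\<close>
  obtain G0 GG where "walk_expansion w1 w2 p (K + 7) G0 GG" using ex_expansion by blast
  then interpret E: walk_expansion w1 w2 p "K + 7" G0 GG .
  obtain v \<alpha> r s where v: "slow v" "\<And>z. z \<in> Z \<Longrightarrow> lap v z = (if z = 0 then 1 else 0)" and rs: "r \<in> Mon 1" "s \<in> Mon 1"
    and dv: "decays (real (K + 1) - 1 + 1/3) (\<lambda>z. v z - (\<alpha> * of_real (ln (cmod z)) + r z + cnj (s z)))"
    using E.green_function[of "K + 1"] by auto
  \<comment> \<open>\<open>cnj (s z)\<close> and \<open>s z\<close> have the same real part, so the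
    two sums of monomials merge.\<close>
  have "(\<lambda>z. r z + s z) \<in> Mon 1" by (rule Mon_add[OF rs(2,1)])
  then obtain S c where S: "finite S" "\<forall>(l,k)\<in>S. - int K \<le> int l - int k \<and> int l - int k \<le> -1 \<and> k \<le> 2 * l"
    and dS: "decays (real K) (\<lambda>z. of_real (Re (r z + s z) - Re (\<Sum>(l,k)\<in>S. c (l,k) * z ^ l / complex_of_real (cmod z ^ k))))"
    using Mon_normal_form[of "\<lambda>z. r z + s z" K] by blast
  define err where "err z = harmonic_potential p z - (Re \<alpha> * ln (cmod z) + - Re (v 0)
                    + Re (\<Sum>(l,k)\<in>S. c (l,k) * z ^ l / complex_of_real (cmod z ^ k)))" for z
  have "decays (real K) (\<lambda>z. (v z - (\<alpha> * of_real (ln (cmod z)) + r z + cnj (s z))))"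
    by (rule decays_mono[OF dv]) simp
  hence "decays (real K) (\<lambda>z. of_real (Re (v z - (\<alpha> * of_real (ln (cmod z)) + r z + cnj (s z)))))"
    by (rule decays_le) (simp add: abs_Re_le_cmod del: minus_complex.simps)
  from decays_add[OF this dS] have "decays (real K) (\<lambda>z. of_real (err z))"
  proof (rule decays_le)
    fix z assume z: "z \<in> Z"
    have hp: "harmonic_potential p z = Re (v z) - Re (v 0)" using harmonic_potential_eq[OF v z] by simp
    show "cmod (of_real (err z)) \<le> cmod (of_real (Re (v z - (\<alpha> * of_real (ln (cmod z)) + r z + cnj (s z)))) +
       of_real (Re (r z + s z) - Re (\<Sum>(l,k)\<in>S. c (l,k) * z ^ l / complex_of_real (cmod z ^ k))))"
      unfolding err_def hp of_real_add[symmetric] norm_of_real by simp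
  qed
  then obtain C where C: "\<And>z. z \<in> Z \<Longrightarrow> z \<noteq> 0 \<Longrightarrow> \<bar>err z\<bar> \<le> C * cmod z powr (- real K)"
    by (auto simp: decays_def)
  have "err \<in> O[inf at_infinity (principal Z)](\<lambda>z. cmod z powr (- real K))"
  proof (rule bigoI[of _ C])
    have "\<forall>\<^sub>F z in at_infinity. z \<in> Z \<longrightarrow> norm (err z) \<le> C * norm (cmod z powr (- real K))"
      using eventually_norm_ge[of 1]
    proof eventually_elim
      case (elim z)
      hence "z \<noteq> 0" by auto
      thus ?case using C[of z] by auto
    qed
    thus "\<forall>\<^sub>F z in inf at_infinity (principal Z). norm (err z) \<le> C * norm (cmod z powr (- real K))"
      by (simp add: eventually_inf_principal)
  qed
  hence err: "(\<lambda>z. harmonic_potential p z - (Re \<alpha> * ln (cmod z) + - Re (v 0)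
                    + Re (\<Sum>(l,k)\<in>S. c (l,k) * z ^ l / complex_of_real (cmod z ^ k))))
             \<in> O[inf at_infinity (principal Z)](\<lambda>z. cmod z powr (- real K))"
    unfolding err_def[abs_def] .
  show ?thesis
  proof (intro exI conjI)
    show "\<forall>(l,k)\<in>S. - int K \<le> int l - int k \<and> int l - int k \<le> -1" using S(2) by fast
    \<comment> \<open>All pairs in \<open>S\<close> satisfy \<open>k \<le> 2 * l\<close>, so no
      coefficient has to be checked.\<close>
    show "\<forall>(l,k)\<in>S. 2 * l < k \<longrightarrow> c (l,k) = 0" using S(2) by fastforce
  qed (rule S(1) err)+
qed

end
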